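(* Let $\lambda\ge0$ and $p_0=\frac{2\lambda}{2\lambda+1}$. For $p_0\le p<\infty$ with $p>0$, the space $A^p_\lambda(\mathbb{D})$ is complete.
   Context: Fix $\lambda\ge0$; $\mathbb{D}$ is the open unit disk in $\mathbb{C}$. For a complex-valued function $f$ put $D_{\bar z}f(z)=\partial_{\bar z}f(z)-\lambda\frac{f(z)-f(\bar z)}{z-\bar z}$, $z=x+iy$ (at real points the quotient is read as its limit $-i\,\partial_y f$). A $C^2$ (real sense) function $f:\mathbb{D}\to\mathbb{C}$ is $\lambda$-analytic if $D_{\bar z}f=0$ in $\mathbb{D}$. $d\sigma_\lambda(z)=c_\lambda|y|^{2\lambda}dx\,dy$, $z=x+iy$, with $c_\lambda=\frac{\Gamma(\lambda+2)}{\Gamma(\lambda+1/2)\Gamma(1/2)}$. For $0<p<\infty$, $A^p_\lambda(\mathbb{D})$ is the set of $\lambda$-analytic functions $f$ on $\mathbb{D}$ with $\|f\|_{A^p_\lambda}=\left(\int_{\mathbb{D}}|f|^pd\sigma_\lambda\right)^{1/p}<\infty$. It is equipped with the norm $\|\cdot\|_{A^p_\lambda}$ if $p\ge1$, and with the metric $\|f-g\|^p_{A^p_\lambda}$ if $0<p<1$. *)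

theory Defs
  imports "HOL-Analysis.Analysis"
begin

text \<open>The open unit disk is \<^term>\<open>ball (0 :: complex) 1\<close>.\<close>

definition partial_x :: "(complex \<Rightarrow> complex) \<Rightarrow> complex \<Rightarrow> complex" where
  "partial_x f z = vector_derivative (\<lambda>t. f (z + complex_of_real t)) (at 0)"

definition partial_y :: "(complex \<Rightarrow> complex) \<Rightarrow> complex \<Rightarrow> complex" where
  "partial_y f z = vector_derivative (\<lambda>t. f (z + \<i> * complex_of_real t)) (at 0)"

definition dzbar :: "(complex \<Rightarrow> complex) \<Rightarrow> complex \<Rightarrow> complex" where
  "dzbar f z = (partial_x f z + \<i> * partial_y f z) / 2"

text \<open>
  At a real point the difference quotient is replaced by its limit: there
  \<open>(f z - f (cnj z)) / (z - cnj z)\<close> behaves like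
  \<open>(2 * y * partial_y f z) / (2 * \<i> * y) = - \<i> * partial_y f z\<close>.
\<close>

definition dunkl_dzbar :: "real \<Rightarrow> (complex \<Rightarrow> complex) \<Rightarrow> complex \<Rightarrow> complex" where
  "dunkl_dzbar lam f z = dzbar f z - complex_of_real lam *
     (if Im z = 0 then - \<i> * partial_y f z else (f z - f (cnj z)) / (z - cnj z))"

text \<open>
  Twice continuous differentiability in the real sense, on an open set: the derivatives
  are bounded \<open>real\<close>-linear maps.
\<close>

definition C2_on :: "complex set \<Rightarrow> (complex \<Rightarrow> complex) \<Rightarrow> bool" where
  "C2_on S f \<longleftrightarrow>
     (\<exists>(f' :: complex \<Rightarrow> complex \<Rightarrow>\<^sub>L complex) (f'' :: complex \<Rightarrow> complex \<Rightarrow>\<^sub>L complex \<Rightarrow>\<^sub>L complex).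
        (\<forall>z\<in>S. (f has_derivative blinfun_apply (f' z)) (at z)) \<and>
        (\<forall>z\<in>S. (f' has_derivative blinfun_apply (f'' z)) (at z)) \<and>
        continuous_on S f'')"

definition lambda_analytic :: "real \<Rightarrow> (complex \<Rightarrow> complex) \<Rightarrow> bool" where
  "lambda_analytic lam f \<longleftrightarrow>
     C2_on (ball 0 1) f \<and> (\<forall>z\<in>ball 0 1. dunkl_dzbar lam f z = 0)"

definition c_lambda :: "real \<Rightarrow> real" where
  "c_lambda lam = Gamma (lam + 2) / (Gamma (lam + 1/2) * Gamma (1/2))"

text \<open>
  For \<open>lam = 0\<close> the convention \<open>0 powr 0 = 0\<close> changes the density only on the real axis,
  which is a null set.
\<close>

definition sigma_lambda :: "real \<Rightarrow> complex measure" where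
  "sigma_lambda lam =
     density lborel (\<lambda>z. ennreal (c_lambda lam * \<bar>Im z\<bar> powr (2 * lam)))"

definition bergman_integral :: "real \<Rightarrow> real \<Rightarrow> (complex \<Rightarrow> complex) \<Rightarrow> ennreal" where
  "bergman_integral lam p f =
     (\<integral>\<^sup>+z\<in>ball 0 1. ennreal (norm (f z) powr p) \<partial>sigma_lambda lam)"

definition bergman_norm :: "real \<Rightarrow> real \<Rightarrow> (complex \<Rightarrow> complex) \<Rightarrow> real" where
  "bergman_norm lam p f = enn2real (bergman_integral lam p f) powr (1 / p)"

text \<open>
  Functions on the disk are represented by total functions that are \<open>undefined\<close>
  off the disk, so that two of them are equal iff they agree on the disk.
\<close>

definition bergman_space :: "real \<Rightarrow> real \<Rightarrow> (complex \<Rightarrow> complex) set" where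
  "bergman_space lam p =
     {f \<in> extensional (ball 0 1). lambda_analytic lam f \<and> bergman_integral lam p f < \<infinity>}"

definition bergman_dist ::
    "real \<Rightarrow> real \<Rightarrow> (complex \<Rightarrow> complex) \<Rightarrow> (complex \<Rightarrow> complex) \<Rightarrow> real" where
  "bergman_dist lam p f g =
     (if 1 \<le> p then bergman_norm lam p (\<lambda>z. f z - g z)
      else bergman_norm lam p (\<lambda>z. f z - g z) powr p)"

end

theory Submission
  imports Defs "HOL-Complex_Analysis.Complex_Analysis"
begin

text \<open>
  Two facts make the space complete: convergence in the integral norm forces locally uniform
  convergence on the disk, and a locally uniform limit of \<open>\<lambda>\<close>-analytic functions is again
  \<open>\<lambda>\<close>-analytic, which includes that it is of class \<open>C\<^sup>2\<close>. Both come out of one representation of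
  \<open>\<lambda>\<close>-analytic functions in which no derivative occurs.

  Let \<open>E f = f\<^sub>x + \<i> (f\<^sub>y + (\<lambda>/y)(f(z) - f(cnj z)))\<close>, so that \<open>\<lambda>\<close>-analytic functions satisfy
  \<open>E f = 0\<close> off the real axis. With respect to the weight \<open>|y|\<^sup>2\<^sup>\<lambda>\<close> the operator \<open>E\<close> is
  skew-symmetric (\<open>dunkl_weak\<close>), and for real \<open>x\<close> the kernel \<open>cnj (w - x) / |w - x|\<^sup>2\<^sup>\<lambda>\<^sup>+\<^sup>2\<close> is a
  fundamental solution with its pole at \<open>x\<close>. This gives a Cauchy-Pompeiu formula for the values of \<open>f\<close>
  on the real axis (\<open>pompeiu_real_axis\<close>): for \<open>|x| < a\<close> the value \<open>f(x)\<close> is an integral of \<open>f\<close> over an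
  annulus \<open>a \<le> |w| \<le> b\<close>. The kernel in this integral extends holomorphically from real \<open>x\<close> to complex
  \<open>\<zeta>\<close> with \<open>|\<zeta>| < a\<close>. Hence \<open>f\<close> coincides on the real axis with a holomorphic function \<open>g\<close>, the
  \<open>axis_transform\<close> of \<open>f\<close>, and \<open>g\<close> is bounded by the integral of \<open>|f|\<close> over the annulus.

  In the other direction, the intertwining operator averages a holomorphic function over the vertical
  segments from \<open>cnj z\<close> to \<open>z\<close> with a Beta density. It produces smooth solutions of the Dunkl equation
  and does not change the values on the real axis (\<open>intertwine_lambda_analytic\<close>). Finally, a solution
  that vanishes on the real axis vanishes identically (\<open>dunkl_unique\<close>). By the Cauchy-Pompeiu formula
  its weighted means with respect to all radial densities centred on the axis are zero;
  differentiating these means in the centre produces the moments in \<open>Re w\<close>; the Weierstrass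
  approximation theorem then removes the part of the function that is even in \<open>y\<close>; and the remaining
  odd part satisfies an ordinary differential equation in \<open>y\<close> and vanishes on the axis, so it is zero. Together
  this yields \<open>f = intertwine (axis_transform f)\<close> (\<open>dunkl_representation\<close>).

  The representation bounds \<open>|f(z)|\<close> by a power of a distance times the integral of \<open>|f|\<close> over a slightly
  larger disk. For \<open>p > 1\<close> the integral of \<open>|f|\<^sup>p\<close> controls that of \<open>|f|\<close>; for \<open>p \<le> 1\<close> a factor
  \<open>|f|\<^sup>1\<^sup>-\<^sup>p\<close> is absorbed into a weighted maximum of \<open>|f|\<close>. So Cauchy sequences converge locally uniformly
  (\<open>small_norm_imp_uniformly_small\<close>). The representation passes to the limit function, which is
  therefore \<open>\<lambda>\<close>-analytic, and Fatou's lemma shows that it lies in the space and is the limit in the metric.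
\<close>

section \<open>The weighted measure\<close>

text \<open>
  Through this identification the Fubini theorem for product measures applies to the plane.
\<close>

lemma distr_Complex_lborel:
  "distr (lborel \<Otimes>\<^sub>M lborel) borel (\<lambda>(x, y). Complex x y) = (lborel :: complex measure)"
proof (rule lborel_eqI[symmetric])
  have meas: "(\<lambda>(x, y). Complex x y) \<in> borel_measurable (lborel \<Otimes>\<^sub>M lborel)"
    unfolding Complex_eq by measurable
  fix l u :: complex
  assume lu: "\<And>b. b \<in> Basis \<Longrightarrow> l \<bullet> b \<le> u \<bullet> b"
  have l1: "Re l \<le> Re u" "Im l \<le> Im u" using lu[of 1] lu[of \<i>] by (auto simp: Basis_complex_def)
  have vim: "(\<lambda>(x, y). Complex x y) -` box l u \<inter> space (lborel \<Otimes>\<^sub>M lborel)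
      = {Re l<..<Re u} \<times> {Im l<..<Im u}"
    by (auto simp: box_def Basis_complex_def space_pair_measure)
  have "emeasure (distr (lborel \<Otimes>\<^sub>M lborel) borel (\<lambda>(x, y). Complex x y)) (box l u)
      = emeasure (lborel \<Otimes>\<^sub>M lborel) ({Re l<..<Re u} \<times> {Im l<..<Im u})"
    by (subst emeasure_distr[OF meas]) (auto simp: vim)
  also have "\<dots> = ennreal (Re u - Re l) * ennreal (Im u - Im l)"
    using l1 by (subst lborel.emeasure_pair_measure_Times) auto
  also have "\<dots> = ennreal (\<Prod>b\<in>Basis. (u - l) \<bullet> b)"
    using l1 by (simp add: Basis_complex_def ennreal_mult inner_diff_left)
  finally show "emeasure (distr (lborel \<Otimes>\<^sub>M lborel) borel (\<lambda>(x, y). Complex x y)) (box l u)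
    = ennreal (\<Prod>b\<in>Basis. (u - l) \<bullet> b)" .
qed simp

lemma measurable_Complex_pair [measurable]:
  "(\<lambda>(x, y). Complex x y) \<in> borel_measurable (lborel \<Otimes>\<^sub>M lborel)"
  unfolding Complex_eq by measurable

lemma
  fixes f :: "complex \<Rightarrow> complex"
  assumes "integrable lborel f"
  shows integral_complex_Im_Re: "(\<integral>z. f z \<partial>lborel) = (\<integral>y. (\<integral>x. f (Complex x y) \<partial>lborel) \<partial>lborel)"
    and integral_complex_Re_Im: "(\<integral>z. f z \<partial>lborel) = (\<integral>x. (\<integral>y. f (Complex x y) \<partial>lborel) \<partial>lborel)"
proof -
  have fm: "f \<in> borel_measurable borel" using assms by auto
  have int: "integrable (lborel \<Otimes>\<^sub>M lborel) (\<lambda>(x, y). f (Complex x y))"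
    using assms fm unfolding distr_Complex_lborel[symmetric]
    by (subst (asm) integrable_distr_eq) (auto simp: case_prod_unfold)
  have eq: "(\<integral>z. f z \<partial>lborel) = (\<integral>p. (case p of (x, y) \<Rightarrow> f (Complex x y)) \<partial>(lborel \<Otimes>\<^sub>M lborel))"
    using fm by (subst distr_Complex_lborel[symmetric], subst integral_distr)
      (auto simp: case_prod_unfold)
  show "(\<integral>z. f z \<partial>lborel) = (\<integral>y. (\<integral>x. f (Complex x y) \<partial>lborel) \<partial>lborel)"
    unfolding eq by (rule lborel_pair.integral_snd[symmetric, OF int])
  show "(\<integral>z. f z \<partial>lborel) = (\<integral>x. (\<integral>y. f (Complex x y) \<partial>lborel) \<partial>lborel)"
    unfolding eq by (rule lborel_pair.integral_fst'[symmetric, OF int, simplified])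
qed

lemma c_lambda_pos: "0 \<le> lam \<Longrightarrow> 0 < c_lambda lam"
  unfolding c_lambda_def by (intro divide_pos_pos mult_pos_pos Gamma_real_pos) auto

lemma sets_sigma_lambda [simp, measurable_cong]: "sets (sigma_lambda lam) = sets borel"
  by (simp add: sigma_lambda_def)

lemma space_sigma_lambda [simp]: "space (sigma_lambda lam) = UNIV"
  by (simp add: sigma_lambda_def)

lemma borel_measurable_sigma [simp]:
  "borel_measurable (sigma_lambda lam) = borel_measurable borel"
  by (rule measurable_cong_sets) auto

lemma weight_measurable [measurable]:
  "(\<lambda>z. \<bar>Im z\<bar> powr a) \<in> borel_measurable borel"
  by measurable

lemma integral_sigma:
  fixes f :: "complex \<Rightarrow> complex"
  assumes "0 \<le> lam" "f \<in> borel_measurable borel"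
  shows "(\<integral>z. f z \<partial>sigma_lambda lam)
       = of_real (c_lambda lam) * (\<integral>z. of_real (\<bar>Im z\<bar> powr (2*lam)) * f z \<partial>lborel)"
proof -
  have "(\<integral>z. f z \<partial>sigma_lambda lam)
      = (\<integral>z. (c_lambda lam * \<bar>Im z\<bar> powr (2 * lam)) *\<^sub>R f z \<partial>lborel)"
    unfolding sigma_lambda_def using assms c_lambda_pos[of lam]
    by (subst integral_density) auto
  also have "\<dots> = (\<integral>z. of_real (c_lambda lam) * (of_real (\<bar>Im z\<bar> powr (2*lam)) * f z) \<partial>lborel)"
    by (simp add: scaleR_conv_of_real mult_ac)
  finally show ?thesis by simp
qed

lemma AE_Im_nonzero: "AE z in lborel. Im z \<noteq> 0"
proof -
  have "negligible {z::complex. \<i> \<bullet> z = 0}" by (rule negligible_hyperplane) auto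
  moreover have "{z::complex. \<i> \<bullet> z = 0} = {z. Im z = 0}" by (auto simp: inner_complex_def)
  ultimately have n: "negligible {z::complex. Im z = 0}" by simp
  have "{z::complex. Im z = 0} \<in> sets borel" by measurable
  hence "{z::complex. Im z = 0} \<in> null_sets lborel"
    using n by (simp add: negligible_iff_null_sets null_sets_def)
  thus ?thesis by (rule AE_I') auto
qed

text \<open>
  The density vanishes only on the real axis, so the weighted measure has the null sets of Lebesgue measure.
\<close>

lemma AE_sigma_iff:
  assumes "0 \<le> lam"
  shows "(AE z in sigma_lambda lam. P z) \<longleftrightarrow> (AE z in lborel. P z)"
proof -
  have "(AE z in sigma_lambda lam. P z)
      \<longleftrightarrow> (AE z in lborel. 0 < ennreal (c_lambda lam * \<bar>Im z\<bar> powr (2 * lam)) \<longrightarrow> P z)"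
    unfolding sigma_lambda_def by (subst AE_density) auto
  also have "\<dots> \<longleftrightarrow> (AE z in lborel. P z)"
  proof
    assume "AE z in lborel. 0 < ennreal (c_lambda lam * \<bar>Im z\<bar> powr (2 * lam)) \<longrightarrow> P z"
    with AE_Im_nonzero show "AE z in lborel. P z"
      by eventually_elim (use c_lambda_pos[OF assms] in \<open>auto simp: ennreal_less_zero_iff\<close>)
  qed auto
  finally show ?thesis .
qed

lemma sigma_ball_finite:
  assumes "0 \<le> lam"
  shows "emeasure (sigma_lambda lam) (cball 0 R) < \<infinity>"
proof -
  have "emeasure (sigma_lambda lam) (cball 0 R)
      = (\<integral>\<^sup>+z. ennreal (c_lambda lam * \<bar>Im z\<bar> powr (2 * lam)) * indicator (cball 0 R) z \<partial>lborel)"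
    unfolding sigma_lambda_def by (subst emeasure_density) auto
  also have "\<dots> \<le> (\<integral>\<^sup>+z. ennreal (c_lambda lam * R powr (2 * lam)) * indicator (cball (0::complex) R) z \<partial>lborel)"
  proof (rule nn_integral_mono)
    fix z :: complex
    show "ennreal (c_lambda lam * \<bar>Im z\<bar> powr (2 * lam)) * indicator (cball 0 R) z
       \<le> ennreal (c_lambda lam * R powr (2 * lam)) * indicator (cball 0 R) z"
    proof (cases "z \<in> cball 0 R")
      case True
      hence "\<bar>Im z\<bar> \<le> R" using abs_Im_le_cmod[of z] by auto
      hence "\<bar>Im z\<bar> powr (2 * lam) \<le> R powr (2 * lam)" using assms by (intro powr_mono2) auto
      thus ?thesis using c_lambda_pos[OF assms]
        by (intro mult_right_mono ennreal_leI mult_left_mono) auto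
    qed auto
  qed
  also have "\<dots> = ennreal (c_lambda lam * R powr (2 * lam)) * emeasure lborel (cball (0::complex) R)"
    by (subst nn_integral_cmult_indicator) auto
  also have "\<dots> < \<infinity>"
    using emeasure_bounded_finite[of "cball (0::complex) R"]
    by (auto simp: ennreal_mult_less_top)
  finally show ?thesis .
qed

lemma integrable_sigma_bounded:
  fixes f :: "complex \<Rightarrow> 'b::{banach, second_countable_topology}"
  assumes "0 \<le> lam" "f \<in> borel_measurable borel"
    and "\<And>z. norm (f z) \<le> B" "\<And>z. norm z > R \<Longrightarrow> f z = 0"
  shows "integrable (sigma_lambda lam) f"
proof (rule Bochner_Integration.integrable_bound)
  show "integrable (sigma_lambda lam) (\<lambda>z. B * indicat_real (cball 0 R) z)"
    using sigma_ball_finite[OF assms(1), of R] by (intro integrable_mult_right) auto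
  show "AE z in sigma_lambda lam. norm (f z) \<le> norm (B * indicat_real (cball 0 R) z)"
  proof (rule AE_I2)
    fix z
    show "norm (f z) \<le> norm (B * indicat_real (cball 0 R) z)"
      using assms(3)[of z] assms(4)[of z] by (cases "norm z \<le> R") auto
  qed
qed (use assms in auto)

lemma integrable_lborel_bounded:
  fixes f :: "'a::euclidean_space \<Rightarrow> 'b::{banach, second_countable_topology}"
  assumes "f \<in> borel_measurable borel"
    and "\<And>z. norm (f z) \<le> B" "\<And>z. norm z > R \<Longrightarrow> f z = 0"
  shows "integrable lborel f"
proof (rule Bochner_Integration.integrable_bound)
  show "integrable lborel (\<lambda>z::'a. B * indicat_real (cball 0 R) z)"
    using emeasure_bounded_finite[of "cball (0::'a) R"] by (intro integrable_mult_right) auto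
  show "AE z in lborel. norm (f z) \<le> norm (B * indicat_real (cball 0 R) z)"
  proof (rule AE_I2)
    fix z
    show "norm (f z) \<le> norm (B * indicat_real (cball 0 R) z)"
      using assms(2)[of z] assms(3)[of z] by (cases "norm z \<le> R") auto
  qed
qed (use assms in auto)

lemma continuous_integrable_sigma:
  fixes f :: "complex \<Rightarrow> 'b::{banach, second_countable_topology}"
  assumes "0 \<le> lam" "compact K" "continuous_on K f"
  shows "integrable (sigma_lambda lam) (\<lambda>z. indicat_real K z *\<^sub>R f z)"
proof -
  obtain B where B: "B \<ge> 0" "\<And>z. z \<in> K \<Longrightarrow> norm (f z) \<le> B"
    using continuous_on_compact_bound[OF assms(2,3)] by blast
  obtain R where R: "\<And>z. z \<in> K \<Longrightarrow> norm z \<le> R"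
    using compact_imp_bounded[OF assms(2)] by (auto simp: bounded_iff)
  show ?thesis
  proof (rule integrable_sigma_bounded[OF assms(1), where B = B and R = R])
    show "(\<lambda>z. indicat_real K z *\<^sub>R f z) \<in> borel_measurable borel"
      using assms by (intro borel_measurable_continuous_on_indicator) (auto simp: compact_imp_closed)
    show "norm (indicat_real K z *\<^sub>R f z) \<le> B" for z
      using B by (cases "z \<in> K") auto
    show "indicat_real K z *\<^sub>R f z = 0" if "norm z > R" for z
      using R[of z] that by (cases "z \<in> K") auto
  qed
qed

lemma integrable_times_continuous:
  fixes u :: "complex \<Rightarrow> complex" and \<phi> :: "complex \<Rightarrow> real"
  assumes lam: "0 \<le> lam" and [measurable]: "u \<in> borel_measurable borel"
    and u: "\<And>w. norm (u w) \<le> B" "\<And>w. norm w > R \<Longrightarrow> u w = 0" and c: "continuous_on UNIV \<phi>"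
  shows "integrable (sigma_lambda lam) (\<lambda>w. u w * of_real (\<phi> w))"
proof -
  obtain b where b: "b \<ge> 0" "\<And>w. w \<in> cball 0 R \<Longrightarrow> norm (\<phi> w) \<le> b"
    using continuous_on_compact_bound[OF compact_cball continuous_on_subset[OF c subset_UNIV]] by blast
  have B: "0 \<le> B" using order_trans[OF norm_ge_zero u(1)] .
  have [measurable]: "\<phi> \<in> borel_measurable borel" using c by (rule borel_measurable_continuous_onI)
  show ?thesis
  proof (rule integrable_sigma_bounded[OF lam, where B = "B * b" and R = R])
    show "norm (u w * of_real (\<phi> w)) \<le> B * b" for w
    proof (cases "norm w \<le> R")
      case True
      have "norm (u w) * \<bar>\<phi> w\<bar> \<le> B * b" using u(1)[of w] b(2)[of w] True B by (intro mult_mono) auto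
      thus ?thesis by (simp add: norm_mult)
    qed (use u B b in auto)
  qed (use u in auto)
qed

lemma continuous_AE_zero_imp_zero:
  fixes f :: "complex \<Rightarrow> real"
  assumes "open S" "continuous_on S f" "AE z in lborel. z \<in> S \<longrightarrow> f z = 0" "w \<in> S"
  shows "f w = 0"
proof (rule ccontr)
  assume nz: "f w \<noteq> 0"
  let ?U = "{z \<in> S. f z \<noteq> 0}"
  have op: "open ?U"
  proof -
    have "?U = S \<inter> f -` (- {0})" by auto
    thus ?thesis using continuous_open_preimage[OF assms(2,1), of "- {0}"] by auto
  qed
  have "AE z in lborel. z \<notin> ?U" using assms(3) by eventually_elim auto
  hence "?U \<in> null_sets lborel"
    using op by (subst (asm) AE_iff_null_sets[symmetric]) auto
  hence "negligible ?U" by (simp add: negligible_iff_null_sets null_sets_completionI)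
  with op nz assms(4) show False using open_not_negligible[of ?U] by auto
qed

section \<open>The divergence theorem for the Dunkl operator\<close>

text \<open>
  Folding the line at the origin pairs \<open>y\<close> with \<open>-y\<close>, the two points that the Dunkl operator couples.
\<close>

lemma integral_lborel_fold:
  fixes f :: "real \<Rightarrow> complex"
  assumes "integrable lborel f"
  shows "(\<integral>y. f y \<partial>lborel) = (\<integral>y. indicat_real {0..} y *\<^sub>R (f y + f (- y)) \<partial>lborel)"
proof -
  have i1: "integrable lborel (\<lambda>y. indicat_real {0..} y *\<^sub>R f y)"
    using integrable_mult_indicator[of "{0..}" lborel f] assms by simp
  have i2: "integrable lborel (\<lambda>y. indicat_real {..0} y *\<^sub>R f y)"
    using integrable_mult_indicator[of "{..0}" lborel f] assms by simp
  have r: "(\<integral>y. indicat_real {..0} y *\<^sub>R f y \<partial>lborel) = (\<integral>y. indicat_real {0..} y *\<^sub>R f (- y) \<partial>lborel)"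
    by (subst lborel_integral_real_affine[where c = "-1" and t = 0]) (auto simp: indicator_def)
  have i3: "integrable lborel (\<lambda>y. indicat_real {0..} y *\<^sub>R f (- y))"
  proof -
    have "integrable lborel (\<lambda>y. indicat_real {..0} (0 + (-1) * y) *\<^sub>R f (0 + (-1) * y))"
      by (rule lborel_integrable_real_affine[OF i2]) auto
    thus ?thesis by (simp add: indicator_def)
  qed
  have "(\<integral>y. f y \<partial>lborel) = (\<integral>y. indicat_real {0..} y *\<^sub>R f y + indicat_real {..0} y *\<^sub>R f y \<partial>lborel)"
  proof (rule integral_cong_AE)
    have "AE y in lborel. y \<noteq> (0::real)" by (rule AE_lborel_singleton)
    thus "AE y in lborel. f y = indicat_real {0..} y *\<^sub>R f y + indicat_real {..0} y *\<^sub>R f y"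
      by eventually_elim (auto simp: indicator_def)
  qed (use assms i1 i2 in auto)
  also have "\<dots> = (\<integral>y. indicat_real {0..} y *\<^sub>R f y \<partial>lborel) + (\<integral>y. indicat_real {0..} y *\<^sub>R f (-y) \<partial>lborel)"
    using i1 i2 r by simp
  also have "\<dots> = (\<integral>y. indicat_real {0..} y *\<^sub>R (f y + f (- y)) \<partial>lborel)"
    using i1 i3 by (simp add: scaleR_add_right)
  finally show ?thesis .
qed

lemma integral_derivative_compact_support:
  fixes g g' :: "real \<Rightarrow> complex"
  assumes "\<And>x. (g has_vector_derivative g' x) (at x)" "continuous_on UNIV g'"
    and "\<And>x. \<bar>x\<bar> \<ge> R \<Longrightarrow> g x = 0" "\<And>x. \<bar>x\<bar> \<ge> R \<Longrightarrow> g' x = 0"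
  shows "(\<integral>x. g' x \<partial>lborel) = 0"
proof -
  define a where "a = \<bar>R\<bar>"
  have "(\<integral>x. g' x \<partial>lborel) = (\<integral>x. indicat_real {-a..a} x *\<^sub>R g' x \<partial>lborel)"
    using assms(4) by (intro Bochner_Integration.integral_cong) (auto simp: indicator_def a_def)
  also have "\<dots> = g a - g (- a)"
    by (rule integral_FTC_Icc)
      (use assms(1,2) in \<open>auto simp: a_def intro: has_vector_derivative_at_within continuous_on_subset\<close>)
  also have "\<dots> = 0" using assms(3) by (auto simp: a_def)
  finally show ?thesis .
qed

text \<open>
  On the line the Dunkl operator \<open>g' + (\<lambda>/y)(g(y) - g(-y))\<close> is, after folding, a total derivative for
  the weight \<open>|y|\<^sup>2\<^sup>\<lambda>\<close>: weight times the sum of its values at \<open>y\<close> and \<open>-y\<close> is the derivative of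
  \<open>y\<^sup>2\<^sup>\<lambda> (g(y) - g(-y))\<close>, which vanishes at both ends.
\<close>

lemma integral_dunkl_line:
  fixes g g' :: "real \<Rightarrow> complex"
  assumes lam: "0 \<le> lam"
    and der: "\<And>x. (g has_vector_derivative g' x) (at x)" and cont: "continuous_on UNIV g'"
    and g0: "\<And>x. \<bar>x\<bar> \<ge> R \<Longrightarrow> g x = 0" and g'0: "\<And>x. \<bar>x\<bar> \<ge> R \<Longrightarrow> g' x = 0"
    and int: "integrable lborel (\<lambda>y. of_real (\<bar>y\<bar> powr (2*lam)) * (g' y + of_real (lam / y) * (g y - g (- y))))"
  shows "(\<integral>y. of_real (\<bar>y\<bar> powr (2*lam)) * (g' y + of_real (lam / y) * (g y - g (- y))) \<partial>lborel) = 0"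
proof -
  let ?f = "\<lambda>y. of_real (\<bar>y\<bar> powr (2*lam)) * (g' y + of_real (lam / y) * (g y - g (- y)))"
  define a where "a = \<bar>R\<bar>"
  define H where "H = (\<lambda>y::real. of_real (y powr (2*lam)) * (g y - g (- y)))"
  have gc: "continuous_on S g" for S
    by (intro continuous_at_imp_continuous_on ballI) (use der in \<open>auto intro: has_vector_derivative_continuous\<close>)
  have derm: "((\<lambda>y. g (- y)) has_vector_derivative (- g' (- y))) (at y)" for y
  proof -
    have "((g \<circ> (\<lambda>y. - y)) has_vector_derivative (-1) *\<^sub>R g' (- y)) (at y)"
      by (rule vector_diff_chain_at) (auto intro!: derivative_eq_intros der)
    thus ?thesis by (simp add: o_def)
  qed
  have fold: "(\<integral>y. ?f y \<partial>lborel) = (\<integral>y. indicat_real {0..} y *\<^sub>R (?f y + ?f (- y)) \<partial>lborel)"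
    by (rule integral_lborel_fold[OF int])
  also have "\<dots> = (LINT y:{0..a}|lborel. (?f y + ?f (- y)))"
    unfolding set_lebesgue_integral_def
    by (rule Bochner_Integration.integral_cong) (use g0 g'0 in \<open>auto simp: indicator_def a_def\<close>)
  also have "\<dots> = integral {0..a} (\<lambda>y. ?f y + ?f (- y))"
  proof (rule set_borel_integral_eq_integral)
    have "integrable lborel (\<lambda>y. ?f (0 + (-1) * y))"
      by (rule lborel_integrable_real_affine[OF int]) auto
    hence "integrable lborel (\<lambda>y. ?f (- y))" by simp
    hence "integrable lborel (\<lambda>y. ?f y + ?f (- y))" using int by (intro Bochner_Integration.integrable_add)
    thus "set_integrable lborel {0..a} (\<lambda>y. ?f y + ?f (- y))"
      unfolding set_integrable_def by (intro integrable_mult_indicator) auto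
  qed
  also have "((\<lambda>y. ?f y + ?f (- y)) has_integral (H a - H 0)) {0..a}"
  proof (rule fundamental_theorem_of_calculus_interior)
    show "0 \<le> a" by (simp add: a_def)
    (* 0 powr 0 = 0, so for lam = 0 the power is not continuous at the origin, but its product with
       the odd difference is *)
    show "continuous_on {0..a} H"
    proof (cases "lam = 0")
      case True
      have "H = (\<lambda>y. g y - g (- y))" by (auto simp: H_def True)
      moreover have "continuous_on {0..a} (\<lambda>y. g y - g (- y))"
        by (intro continuous_intros gc continuous_on_compose2[OF gc]) auto
      ultimately show ?thesis by simp
    next
      case False
      hence "continuous_on {0..a} (\<lambda>y::real. y powr (2 * lam))"
        using lam by (intro continuous_on_powr') (auto intro!: continuous_intros)
      thus ?thesis unfolding H_def
        by (intro continuous_on_mult continuous_on_of_real continuous_on_diff gc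
            continuous_on_compose2[OF gc] continuous_on_minus continuous_on_id) auto
    qed
    fix y assume y: "y \<in> {0<..<a}"
    have p: "((\<lambda>y. complex_of_real (y powr (2*lam))) has_vector_derivative of_real (2*lam * y powr (2*lam - 1))) (at y)"
      by (rule has_vector_derivative_of_real)
        (use y in \<open>auto intro!: derivative_eq_intros simp flip: has_real_derivative_iff_has_vector_derivative\<close>)
    have "(H has_vector_derivative (of_real (y powr (2*lam)) * (g' y - - g' (- y))
        + of_real (2*lam * y powr (2*lam - 1)) * (g y - g (- y)))) (at y)"
      unfolding H_def
      by (rule has_vector_derivative_mult[OF p has_vector_derivative_diff[OF der derm]])
    moreover have "of_real (y powr (2*lam)) * (g' y - - g' (- y))
        + of_real (2*lam * y powr (2*lam - 1)) * (g y - g (- y)) = ?f y + ?f (- y)"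
      using y by (simp add: powr_diff field_simps)
    ultimately show "(H has_vector_derivative (?f y + ?f (- y))) (at y)" by simp
  qed
  hence "integral {0..a} (\<lambda>y. ?f y + ?f (- y)) = H a - H 0" by (rule integral_unique)
  also have "\<dots> = 0" using g0[of a] g0[of "-a"] by (simp add: H_def a_def)
  finally show ?thesis .
qed

text \<open>The real-linear map with the values \<open>a\<close> at \<open>1\<close> and \<open>b\<close> at \<open>\<i>\<close>: the total derivative of a
  function with partial derivatives \<open>a\<close> and \<open>b\<close>.\<close>

abbreviation real_linear :: "complex \<Rightarrow> complex \<Rightarrow> complex \<Rightarrow> complex" where
  "real_linear a b \<equiv> (\<lambda>h. of_real (Re h) * a + of_real (Im h) * b)"

text \<open>Twice the Dunkl operator off the real axis; the functions \<open>fx\<close> and \<open>fy\<close> stand for the partial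
  derivatives of \<open>f\<close>, and \<open>z - cnj z = 2 \<i> Im z\<close> has been inserted into the difference quotient.\<close>

abbreviation dunkl_E ::
  "real \<Rightarrow> (complex \<Rightarrow> complex) \<Rightarrow> (complex \<Rightarrow> complex) \<Rightarrow> (complex \<Rightarrow> complex) \<Rightarrow> complex \<Rightarrow> complex" where
  "dunkl_E lam f fx fy z \<equiv> fx z + \<i> * (fy z + of_real (lam / Im z) * (f z - f (cnj z)))"

lemma has_derivative_Complex_partials:
  assumes "(G has_derivative (real_linear Gx Gy)) (at (Complex x y))"
  shows "((\<lambda>x. G (Complex x y)) has_vector_derivative Gx) (at x)"
    and "((\<lambda>y. G (Complex x y)) has_vector_derivative Gy) (at y)"
proof -
  have dx: "((\<lambda>x. Complex x y) has_derivative (\<lambda>h. of_real h)) (at x)"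
    unfolding Complex_eq by (auto intro!: derivative_eq_intros)
  have dy: "((\<lambda>y. Complex x y) has_derivative (\<lambda>h. \<i> * of_real h)) (at y)"
    unfolding Complex_eq by (auto intro!: derivative_eq_intros)
  show "((\<lambda>x. G (Complex x y)) has_vector_derivative Gx) (at x)"
    using has_derivative_compose[OF dx assms]
    by (simp add: has_vector_derivative_def scaleR_conv_of_real)
  show "((\<lambda>y. G (Complex x y)) has_vector_derivative Gy) (at y)"
    using has_derivative_compose[OF dy assms]
    by (simp add: has_vector_derivative_def scaleR_conv_of_real)
qed

lemma continuous_compact_support_bounded:
  fixes f :: "complex \<Rightarrow> complex"
  assumes "continuous_on UNIV f" "\<And>z. norm z \<ge> R \<Longrightarrow> f z = 0"
  obtains B where "B \<ge> 0" "\<And>z. norm (f z) \<le> B"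
proof -
  obtain B where B: "B \<ge> 0" "\<And>z. z \<in> cball 0 R \<Longrightarrow> norm (f z) \<le> B"
    using continuous_on_compact_bound[OF compact_cball continuous_on_subset[OF assms(1) subset_UNIV]] by blast
  have "norm (f z) \<le> B" for z
    using B assms(2)[of z] by (cases "norm z \<le> R") auto
  thus ?thesis using that B(1) by blast
qed

text \<open>
  The derivative in \<open>x\<close> integrates to zero along horizontal lines and the Dunkl operator in \<open>y\<close> along
  vertical lines. The difference quotient in the latter is bounded because \<open>G\<close> is Lipschitz, so both
  orders of integration are available.
\<close>

theorem dunkl_divergence:
  fixes G Gx Gy :: "complex \<Rightarrow> complex"
  assumes lam: "0 \<le> lam"
    and der: "\<And>z. (G has_derivative (real_linear (Gx z) (Gy z))) (at z)"
    and cx: "continuous_on UNIV Gx" and cy: "continuous_on UNIV Gy"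
    and z: "\<And>z. norm z \<ge> R \<Longrightarrow> G z = 0" "\<And>z. norm z \<ge> R \<Longrightarrow> Gx z = 0"
           "\<And>z. norm z \<ge> R \<Longrightarrow> Gy z = 0"
  shows "integrable (sigma_lambda lam) (\<lambda>z. dunkl_E lam G Gx Gy z)"
    and "(\<integral>z. dunkl_E lam G Gx Gy z \<partial>sigma_lambda lam) = 0"
proof -
  obtain B1 where B1: "B1 \<ge> 0" "\<And>z. norm (Gx z) \<le> B1"
    using continuous_compact_support_bounded[OF cx z(2)] by blast
  obtain B2 where B2: "B2 \<ge> 0" "\<And>z. norm (Gy z) \<le> B2"
    using continuous_compact_support_bounded[OF cy z(3)] by blast
  define L where "L = B1 + B2"
  have Lip: "norm (G u - G v) \<le> L * norm (u - v)" for u v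
  proof (rule differentiable_bound[of UNIV G "\<lambda>z h. of_real (Re h) * Gx z + of_real (Im h) * Gy z"])
    show "onorm (real_linear (Gx z) (Gy z)) \<le> L" for z
    proof (rule onorm_bound)
      fix h :: complex
      have "norm (of_real (Re h) * Gx z + of_real (Im h) * Gy z) \<le> \<bar>Re h\<bar> * norm (Gx z) + \<bar>Im h\<bar> * norm (Gy z)"
        by (rule order_trans[OF norm_triangle_ineq]) (simp add: norm_mult)
      also have "\<dots> \<le> norm h * B1 + norm h * B2"
        using B1 B2 abs_Re_le_cmod abs_Im_le_cmod by (intro add_mono mult_mono) auto
      finally show "norm (of_real (Re h) * Gx z + of_real (Im h) * Gy z) \<le> L * norm h"
        by (simp add: L_def algebra_simps)
    qed (use B1 B2 in \<open>auto simp: L_def\<close>)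
  qed (use der in auto)
  have gc: "continuous_on UNIV G"
    by (intro continuous_at_imp_continuous_on ballI has_derivative_continuous[OF der])
  have meas [measurable]: "G \<in> borel_measurable borel" "Gx \<in> borel_measurable borel" "Gy \<in> borel_measurable borel"
    using gc cx cy by (auto intro: borel_measurable_continuous_onI)
  have mcnj [measurable]: "cnj \<in> borel_measurable borel"
    by (intro borel_measurable_continuous_onI) (auto intro: continuous_intros)
  define T where "T = (\<lambda>z. Gy z + of_real (lam / Im z) * (G z - G (cnj z)))"
  have Tm [measurable]: "T \<in> borel_measurable borel" unfolding T_def by measurable
  have Tb: "norm (T z) \<le> B2 + 2 * lam * L" for z
  proof -
    have "norm (of_real (lam / Im z) * (G z - G (cnj z))) \<le> (lam / \<bar>Im z\<bar>) * (L * (2 * \<bar>Im z\<bar>))"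
      unfolding norm_mult norm_of_real using Lip[of z "cnj z"] lam
      by (intro mult_mono) (auto simp: complex_diff_cnj norm_mult)
    also have "\<dots> \<le> 2 * lam * L" using lam B1(1) B2(1) by (cases "Im z = 0") (auto simp: L_def algebra_simps)
    finally show ?thesis unfolding T_def
      using B2(2)[of z] norm_triangle_ineq[of "Gy z" "of_real (lam / Im z) * (G z - G (cnj z))"] by linarith
  qed
  have Tz: "T z = 0" if "norm z \<ge> R" for z using that z by (simp add: T_def)
  have all: "dunkl_E lam G Gx Gy z = Gx z + \<i> * T z" for z
    by (simp add: T_def)
  show "integrable (sigma_lambda lam) (\<lambda>z. dunkl_E lam G Gx Gy z)"
    unfolding all
    by (intro Bochner_Integration.integrable_add integrable_mult_right
          integrable_sigma_bounded[OF lam _ B1(2), where R = R]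
          integrable_sigma_bounded[OF lam _ Tb, where R = R]) (use z Tz in auto)
  define w where "w = (\<lambda>y::real. \<bar>y\<bar> powr (2*lam))"
  have wm [measurable]: "w \<in> borel_measurable borel" unfolding w_def by measurable
  have wb: "w y \<le> \<bar>R\<bar> powr (2*lam)" if "\<bar>y\<bar> \<le> R" for y
    unfolding w_def using that lam by (intro powr_mono2) auto
  have w0: "w y \<ge> 0" for y by (simp add: w_def)
  have b: "norm (of_real (w (Im z)) * F z) \<le> \<bar>R\<bar> powr (2*lam) * B"
    if "\<And>z. norm (F z) \<le> B" "\<And>z. norm z \<ge> R \<Longrightarrow> F z = 0" for F :: "complex \<Rightarrow> complex" and B and z :: complex
  proof (cases "norm z \<ge> R")
    case True
    have "0 \<le> B" using that(1)[of 0] by (meson norm_ge_zero order_trans)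
    with True that(2) show ?thesis by simp
  next
    case False
    have "w (Im z) * norm (F z) \<le> \<bar>R\<bar> powr (2*lam) * B"
      using False abs_Im_le_cmod[of z] w0 that(1) by (intro mult_mono wb) auto
    thus ?thesis using w0 by (simp add: norm_mult)
  qed
  have i1: "integrable lborel (\<lambda>z. of_real (w (Im z)) * Gx z)"
    by (rule integrable_lborel_bounded[OF _ b[OF B1(2) z(2)], where R = R]) (use z in auto)
  have i2: "integrable lborel (\<lambda>z. of_real (w (Im z)) * T z)"
    by (rule integrable_lborel_bounded[OF _ b[OF Tb Tz], where R = R]) (use Tz in auto)
  have n1: "norm (Complex x y) \<ge> R" if "\<bar>x\<bar> \<ge> R" for x y
    using that abs_Re_le_cmod[of "Complex x y"] by simp
  have n2: "norm (Complex x y) \<ge> R" if "\<bar>y\<bar> \<ge> R" for x y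
    using that abs_Im_le_cmod[of "Complex x y"] by simp
  have Cc: "continuous_on S (\<lambda>x. Complex x y)" "continuous_on S (\<lambda>y. Complex x y)" for S x y
    unfolding Complex_eq by (intro continuous_intros)+
  have e1: "(\<integral>z. of_real (w (Im z)) * Gx z \<partial>lborel) = 0"
  proof -
    have "(\<integral>x. Gx (Complex x y) \<partial>lborel) = 0" for y
    proof (rule integral_derivative_compact_support[where R = R, OF has_derivative_Complex_partials(1)[OF der]])
      show "continuous_on UNIV (\<lambda>x. Gx (Complex x y))"
        by (rule continuous_on_compose2[OF cx Cc(1)]) simp
    qed (simp_all only: z n1)
    thus ?thesis by (subst integral_complex_Im_Re[OF i1]) simp
  qed
  have e2: "(\<integral>z. of_real (w (Im z)) * T z \<partial>lborel) = 0"
  proof -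
    have "(\<integral>y. of_real (w y) * T (Complex x y) \<partial>lborel) = 0" for x
    proof -
      let ?g = "\<lambda>y. of_real (\<bar>y\<bar> powr (2*lam)) * (Gy (Complex x y) + of_real (lam / y) * (G (Complex x y) - G (Complex x (- y))))"
      have eq: "(\<lambda>y. of_real (w y) * T (Complex x y)) = ?g"
        by (auto simp: w_def T_def complex_cnj)
      have Cm [measurable]: "(\<lambda>y. Complex x y) \<in> borel_measurable borel"
        by (intro borel_measurable_continuous_onI Cc)
      have int: "integrable lborel (\<lambda>y. of_real (w y) * T (Complex x y))"
      proof (rule integrable_lborel_bounded[where R = R])
        show "norm (of_real (w y) * T (Complex x y)) \<le> \<bar>R\<bar> powr (2*lam) * (B2 + 2 * lam * L)" for y
          using b[of T, OF Tb Tz, where z = "Complex x y"] by simp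
        show "of_real (w y) * T (Complex x y) = 0" if "norm y > R" for y
          using Tz[OF n2[of y x]] that by auto
      qed measurable
      show ?thesis unfolding eq
      proof (rule integral_dunkl_line[OF lam has_derivative_Complex_partials(2)[OF der], where R = R])
        show "continuous_on UNIV (\<lambda>y. Gy (Complex x y))"
          by (rule continuous_on_compose2[OF cy Cc(2)]) simp
        show "integrable lborel ?g" using int unfolding eq .
      qed (simp_all only: z n2)
    qed
    thus ?thesis by (subst integral_complex_Re_Im[OF i2]) simp
  qed
  have "(\<integral>z. Gx z + \<i> * T z \<partial>sigma_lambda lam)
      = of_real (c_lambda lam) * (\<integral>z. of_real (w (Im z)) * Gx z + \<i> * (of_real (w (Im z)) * T z) \<partial>lborel)"
    unfolding w_def by (subst integral_sigma[OF lam]) (auto simp: algebra_simps)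
  also have "\<dots> = 0" using i1 i2 e1 e2 by simp
  finally show "(\<integral>z. dunkl_E lam G Gx Gy z \<partial>sigma_lambda lam) = 0"
    unfolding all .
qed


section \<open>The weak form and the Cauchy-Pompeiu formula on the real axis\<close>

text \<open>
  The class in which the integral formulas are proved. It asks for one derivative only, and for the
  equation only off the real axis; on the axis the equation follows by continuity.
\<close>

definition dunkl_holomorphic :: "real \<Rightarrow> complex set \<Rightarrow> (complex \<Rightarrow> complex) \<Rightarrow> bool" where
  "dunkl_holomorphic lam S f \<longleftrightarrow> (\<exists>fx fy. continuous_on S fx \<and> continuous_on S fy \<and>
     (\<forall>z\<in>S. (f has_derivative (real_linear (fx z) (fy z))) (at z)) \<and>
     (\<forall>z\<in>S. Im z \<noteq> 0 \<longrightarrow> dunkl_E lam f fx fy z = 0))"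

lemma dunkl_holomorphic_continuous_on:
  assumes "dunkl_holomorphic lam S f" shows "continuous_on S f"
  using assms unfolding dunkl_holomorphic_def
  by (auto intro!: continuous_at_imp_continuous_on intro: has_derivative_continuous)

lemma dunkl_holomorphic_subset:
  "dunkl_holomorphic lam S f \<Longrightarrow> T \<subseteq> S \<Longrightarrow> dunkl_holomorphic lam T f"
  unfolding dunkl_holomorphic_def by (meson continuous_on_subset subsetD)

lemma cnj_measurable [measurable]: "cnj \<in> borel_measurable borel"
  by (intro borel_measurable_continuous_onI) (auto intro: continuous_intros)

lemma distr_cnj_lborel: "distr lborel borel cnj = lborel"
proof (rule lborel_eqI[symmetric])
  fix l u :: complex
  assume lu: "\<And>b. b \<in> Basis \<Longrightarrow> l \<bullet> b \<le> u \<bullet> b"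
  have l1: "Re l \<le> Re u" "Im l \<le> Im u" using lu[of 1] lu[of \<i>] by (auto simp: Basis_complex_def)
  have v: "cnj -` box l u = box (Complex (Re l) (- Im u)) (Complex (Re u) (- Im l))"
    by (auto simp: box_def Basis_complex_def)
  show "emeasure (distr lborel borel cnj) (box l u) = ennreal (\<Prod>b\<in>Basis. (u - l) \<bullet> b)"
  proof -
    have "emeasure lborel (box (Complex (Re l) (- Im u)) (Complex (Re u) (- Im l)))
        = ennreal (\<Prod>b\<in>Basis. (Complex (Re u) (- Im l) - Complex (Re l) (- Im u)) \<bullet> b)"
      by (rule emeasure_lborel_box) (use l1 in \<open>auto simp: Basis_complex_def\<close>)
    thus ?thesis
      by (subst emeasure_distr) (use l1 in \<open>auto simp: v Basis_complex_def inner_diff_left\<close>)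
  qed
qed simp

lemma integral_sigma_cnj:
  fixes f :: "complex \<Rightarrow> complex"
  assumes "0 \<le> lam" and [measurable]: "f \<in> borel_measurable borel"
  shows "(\<integral>z. f (cnj z) \<partial>sigma_lambda lam) = (\<integral>z. f z \<partial>sigma_lambda lam)"
proof -
  have "(\<integral>z. of_real (\<bar>Im z\<bar> powr (2*lam)) * f z \<partial>lborel)
      = (\<integral>z. of_real (\<bar>Im z\<bar> powr (2*lam)) * f z \<partial>distr lborel borel cnj)"
    by (simp add: distr_cnj_lborel)
  also have "\<dots> = (\<integral>z. of_real (\<bar>Im (cnj z)\<bar> powr (2*lam)) * f (cnj z) \<partial>lborel)"
    by (rule integral_distr) measurable
  finally show ?thesis
    by (simp add: integral_sigma[OF assms(1)])
qed

lemma integrable_sigma_cnj: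
  fixes f :: "complex \<Rightarrow> complex"
  assumes "0 \<le> lam" and [measurable]: "f \<in> borel_measurable borel" and f: "integrable (sigma_lambda lam) f"
  shows "integrable (sigma_lambda lam) (\<lambda>z. f (cnj z))"
proof -
  let ?w = "\<lambda>z. c_lambda lam * \<bar>Im z\<bar> powr (2 * lam)"
  have iff: "integrable (sigma_lambda lam) g \<longleftrightarrow> integrable lborel (\<lambda>z. ?w z *\<^sub>R g z)"
    if [measurable]: "g \<in> borel_measurable borel" for g :: "complex \<Rightarrow> complex"
    unfolding sigma_lambda_def using c_lambda_pos[OF assms(1)] by (subst integrable_density) auto
  have "integrable (distr lborel borel cnj) (\<lambda>z. ?w z *\<^sub>R f z)"
    using f iff by (simp add: distr_cnj_lborel)
  hence "integrable lborel (\<lambda>z. ?w (cnj z) *\<^sub>R f (cnj z))" by (subst (asm) integrable_distr_eq) auto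
  thus ?thesis by (subst iff) auto
qed

text \<open>
  This keeps the difference quotient of the Dunkl operator bounded up to the real axis.
\<close>

lemma vertical_difference_bound:
  fixes G :: "complex \<Rightarrow> complex"
  assumes der: "\<And>z. (G has_derivative (real_linear (Gx z) (Gy z))) (at z)"
    and b: "\<And>z. norm (Gy z) \<le> B"
  shows "norm (G z - G (cnj z)) \<le> 2 * B * \<bar>Im z\<bar>"
proof -
  have "norm (G (Complex (Re z) (Im z)) - G (Complex (Re z) (- Im z))) \<le> B * norm (Im z - (- Im z))"
  proof (rule differentiable_bound[of UNIV "\<lambda>y. G (Complex (Re z) y)" "\<lambda>y h. h *\<^sub>R Gy (Complex (Re z) y)"])
    show "((\<lambda>y. G (Complex (Re z) y)) has_derivative (\<lambda>h. h *\<^sub>R Gy (Complex (Re z) y))) (at y within UNIV)" for y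
      using has_derivative_Complex_partials(2)[OF der] by (simp add: has_vector_derivative_def)
    show "onorm (\<lambda>h. h *\<^sub>R Gy (Complex (Re z) y)) \<le> B" for y
    proof (rule onorm_bound)
      show "0 \<le> B" using b[of 0] by (meson norm_ge_zero order_trans)
      show "norm (h *\<^sub>R Gy (Complex (Re z) y)) \<le> B * norm h" for h
        using mult_left_mono[OF b[of "Complex (Re z) y"], of "\<bar>h\<bar>"] by (simp add: mult.commute)
    qed
  qed auto
  moreover have "Complex (Re z) (- Im z) = cnj z" by (simp add: complex_eq_iff)
  ultimately show ?thesis by simp
qed

text \<open>
  Skew-symmetry of \<open>E\<close>. Apply the divergence theorem to the product \<open>f \<psi>\<close>. The product rule fails by a
  term with the reflected value \<open>f(cnj z)\<close>; the symmetry \<open>z \<mapsto> cnj z\<close> of the measure turns this term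
  into the difference quotient of \<open>\<psi>\<close>.
\<close>

theorem dunkl_weak:
  fixes f psi px py :: "complex \<Rightarrow> complex"
  assumes lam: "0 \<le> lam" and f: "dunkl_holomorphic lam (ball 0 R) f"
    and der: "\<And>z. (psi has_derivative (real_linear (px z) (py z))) (at z)"
    and cx: "continuous_on UNIV px" and cy: "continuous_on UNIV py"
    and rR: "r < R" and z: "\<And>z. norm z \<ge> r \<Longrightarrow> psi z = 0" "\<And>z. norm z \<ge> r \<Longrightarrow> px z = 0"
           "\<And>z. norm z \<ge> r \<Longrightarrow> py z = 0"
  shows "(\<integral>z. f z * (dunkl_E lam psi px py z) \<partial>sigma_lambda lam) = 0"
proof -
  obtain fx fy where fx: "continuous_on (ball 0 R) fx" and fy: "continuous_on (ball 0 R) fy"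
    and fd: "\<And>z. z \<in> ball 0 R \<Longrightarrow> (f has_derivative (real_linear (fx z) (fy z))) (at z)"
    and fe: "\<And>z. z \<in> ball 0 R \<Longrightarrow> Im z \<noteq> 0 \<Longrightarrow> dunkl_E lam f fx fy z = 0"
    using f unfolding dunkl_holomorphic_def by blast
  have fc: "continuous_on (ball 0 R) f" by (rule dunkl_holomorphic_continuous_on[OF f])
  have pc: "continuous_on UNIV psi"
    by (intro continuous_at_imp_continuous_on ballI has_derivative_continuous[OF der])
  define cut where "cut = (\<lambda>F (z::complex). if norm z < R then F z else (0::complex))"
  have cutc: "continuous_on UNIV (cut F)" if "continuous_on (ball 0 R) F" "\<And>z. norm z \<ge> r \<Longrightarrow> F z = 0" for F
  proof -
    have "continuous_on (ball 0 R) (cut F)"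
      by (rule continuous_on_eq[OF that(1)]) (auto simp: cut_def)
    moreover have "continuous_on (- cball 0 r) (cut F)"
      by (rule continuous_on_eq[OF continuous_on_const[of _ 0]]) (use that(2) in \<open>auto simp: cut_def\<close>)
    ultimately have "continuous_on (ball 0 R \<union> - cball 0 r) (cut F)"
      by (intro continuous_on_open_Un) auto
    moreover have "ball 0 R \<union> - cball 0 r = (UNIV :: complex set)" using rR by auto
    ultimately show ?thesis by metis
  qed
  let ?G = "cut (\<lambda>z. f z * psi z)"
  let ?Gx = "cut (\<lambda>z. f z * px z + fx z * psi z)"
  let ?Gy = "cut (\<lambda>z. f z * py z + fy z * psi z)"
  have pcs: "continuous_on S psi" "continuous_on S px" "continuous_on S py" for S
    using pc cx cy by (auto intro: continuous_on_subset)
  have Gx: "continuous_on UNIV ?Gx" and Gy: "continuous_on UNIV ?Gy"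
    by (intro cutc continuous_intros fx fy fc pcs; simp add: z)+
  have Gd: "(?G has_derivative (real_linear (?Gx w) (?Gy w))) (at w)" for w
  proof (cases "norm w < R")
    case True
    have "((\<lambda>z. f z * psi z) has_derivative
        (\<lambda>h. f w * (of_real (Re h) * px w + of_real (Im h) * py w) + (of_real (Re h) * fx w + of_real (Im h) * fy w) * psi w)) (at w)"
      by (rule has_derivative_mult[OF fd der]) (use True in auto)
    hence "(?G has_derivative
        (\<lambda>h. f w * (of_real (Re h) * px w + of_real (Im h) * py w) + (of_real (Re h) * fx w + of_real (Im h) * fy w) * psi w)) (at w)"
      by (rule has_derivative_transform_within_open[of _ _ _ _ "ball 0 R"]) (use True in \<open>auto simp: cut_def\<close>)
    thus ?thesis using True by (simp add: cut_def algebra_simps)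
  next
    case False
    have "((\<lambda>z. 0) has_derivative (\<lambda>h. 0)) (at w)" by simp
    hence "(?G has_derivative (\<lambda>h. 0)) (at w)"
      by (rule has_derivative_transform_within_open[of _ _ _ _ "- cball 0 r"])
        (use False rR z in \<open>auto simp: cut_def\<close>)
    thus ?thesis using False by (simp add: cut_def)
  qed
  have GR: "?G w = 0" "?Gx w = 0" "?Gy w = 0" if "norm w \<ge> R" for w
    using that by (auto simp: cut_def)
  let ?I = "\<lambda>z. ?Gx z + \<i> * (?Gy z + of_real (lam / Im z) * (?G z - ?G (cnj z)))"
  have int0: "(\<integral>z. ?I z \<partial>sigma_lambda lam) = 0"
    by (rule dunkl_divergence(2)[OF lam Gd Gx Gy GR])
  \<comment> \<open>the term that the reflection moves\<close>
  define F where "F = (\<lambda>z. cut f z * (\<i> * of_real (lam / Im z)) * (psi z - psi (cnj z)))"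
  have cutf: "cut f \<in> borel_measurable borel"
  proof -
    have "(\<lambda>z. indicator (ball 0 R) z *\<^sub>R f z) \<in> borel_measurable borel"
      by (rule borel_measurable_continuous_on_indicator[OF _ fc]) simp
    moreover have "(\<lambda>z. indicator (ball 0 R) z *\<^sub>R f z) = cut f" by (auto simp: cut_def indicator_def)
    ultimately show ?thesis by simp
  qed
  have [measurable]: "psi \<in> borel_measurable borel" "px \<in> borel_measurable borel" "py \<in> borel_measurable borel"
    using pc cx cy by (auto intro: borel_measurable_continuous_onI)
  note cutf [measurable]
  have Fm [measurable]: "F \<in> borel_measurable borel" unfolding F_def by measurable
  obtain B1 where B1: "B1 \<ge> 0" "\<And>z. norm (py z) \<le> B1"
    using continuous_compact_support_bounded[OF cy z(3)] by blast
  obtain B2 where B2: "B2 \<ge> 0" "\<And>z. z \<in> cball 0 r \<Longrightarrow> norm (f z) \<le> B2"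
    using continuous_on_compact_bound[OF compact_cball, of 0 r f] continuous_on_subset[OF fc, of "cball 0 r"] rR
    by (auto simp: cball_subset_ball_iff)
  have Fz: "F w = 0" if "norm w \<ge> r" for w using that z(1) by (simp add: F_def)
  have Fb: "norm (F w) \<le> B2 * lam * (2 * B1)" for w
  proof (cases "norm w \<le> r")
    case True
    have "norm (F w) = norm (f w) * (lam / \<bar>Im w\<bar>) * norm (psi w - psi (cnj w))"
      using True rR lam by (simp add: F_def cut_def norm_mult norm_divide)
    also have "\<dots> \<le> B2 * (lam / \<bar>Im w\<bar>) * (2 * B1 * \<bar>Im w\<bar>)"
      using B2 True lam B1 vertical_difference_bound[OF der B1(2), of w]
      by (intro mult_mono) auto
    also have "\<dots> \<le> B2 * lam * (2 * B1)" using lam B1(1) B2(1) by (cases "Im w = 0") auto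
    finally show ?thesis .
  qed (use Fz lam B1 B2(1) in auto)
  have iF: "integrable (sigma_lambda lam) F"
    by (rule integrable_sigma_bounded[OF lam Fm Fb, of r]) (use Fz in auto)
  have iFc: "integrable (sigma_lambda lam) (\<lambda>z. F (cnj z))"
    by (rule integrable_sigma_cnj[OF lam Fm iF])
  define H where "H = (\<lambda>z. cut f z * (px z + \<i> * py z))"
  have Hm [measurable]: "H \<in> borel_measurable borel" unfolding H_def by measurable
  have iH: "integrable (sigma_lambda lam) H"
  proof -
    have "continuous_on UNIV (cut (\<lambda>z. f z * (px z + \<i> * py z)))"
      by (intro cutc continuous_intros fc pcs) (simp add: z)
    moreover have "cut (\<lambda>z. f z * (px z + \<i> * py z)) = H" by (auto simp: H_def cut_def)
    ultimately have "continuous_on UNIV H" by simp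
    moreover have "\<And>z. norm z \<ge> r \<Longrightarrow> H z = 0" using z by (simp add: H_def)
    ultimately obtain B where B: "\<And>w. norm (H w) \<le> B"
      using continuous_compact_support_bounded[of H r] by blast
    show ?thesis by (rule integrable_sigma_bounded[OF lam Hm B, of r]) (use z in \<open>auto simp: H_def\<close>)
  qed
  have "(\<integral>z. H z + F (cnj z) \<partial>sigma_lambda lam) = (\<integral>z. ?I z \<partial>sigma_lambda lam)"
  proof (rule integral_cong_AE)
    have "AE z in sigma_lambda lam. Im z \<noteq> 0" by (simp add: AE_sigma_iff[OF lam] AE_Im_nonzero)
    thus "AE z in sigma_lambda lam. H z + F (cnj z) = ?I z"
    proof eventually_elim
      case (elim w)
      show ?case
      proof (cases "norm w < R")
        case True
        have "fx w = - (\<i> * (fy w + of_real (lam / Im w) * (f w - f (cnj w))))"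
          using fe[of w] True elim by (simp add: eq_neg_iff_add_eq_0)
        moreover have "fw * (p1 + \<i> * p2) + fc * (\<i> * (- k)) * (pc - pw)
            = (fw * p1 + fxw * pw) + \<i> * ((fw * p2 + fyw * pw) + k * (fw * pw - fc * pc))"
          if "fxw = - (\<i> * (fyw + k * (fw - fc)))" for fxw fyw fw fc pw pc k p1 p2
          unfolding that by (simp add: algebra_simps)
        ultimately have "f w * (px w + \<i> * py w) + f (cnj w) * (\<i> * (- of_real (lam / Im w))) * (psi (cnj w) - psi w)
            = (f w * px w + fx w * psi w) + \<i> * ((f w * py w + fy w * psi w)
               + of_real (lam / Im w) * (f w * psi w - f (cnj w) * psi (cnj w)))"
          by blast
        thus ?thesis using True by (simp add: H_def F_def cut_def)
      qed (simp add: H_def F_def cut_def)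
    qed
    have [measurable]: "?Gx \<in> borel_measurable borel" "?Gy \<in> borel_measurable borel"
      using Gx Gy by (auto intro: borel_measurable_continuous_onI)
    have "continuous_on UNIV ?G"
      by (intro continuous_at_imp_continuous_on ballI has_derivative_continuous[OF Gd])
    hence [measurable]: "?G \<in> borel_measurable borel" by (auto intro: borel_measurable_continuous_onI)
    show "?I \<in> borel_measurable (sigma_lambda lam)" by measurable
  qed measurable
  hence "0 = (\<integral>z. H z \<partial>sigma_lambda lam) + (\<integral>z. F (cnj z) \<partial>sigma_lambda lam)"
    using int0 iH iFc by simp
  also have "\<dots> = (\<integral>z. H z + F z \<partial>sigma_lambda lam)"
    using iH iF by (simp add: integral_sigma_cnj[OF lam Fm])
  also have "\<dots> = (\<integral>z. f z * (dunkl_E lam psi px py z) \<partial>sigma_lambda lam)"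
  proof (rule Bochner_Integration.integral_cong)
    fix w
    show "H w + F w = f w * (dunkl_E lam psi px py w)"
    proof (cases "norm w < R")
      case True thus ?thesis by (simp add: H_def F_def cut_def algebra_simps)
    next
      case False thus ?thesis using z rR by (simp add: H_def F_def cut_def)
    qed
  qed simp
  finally show ?thesis by simp
qed


text \<open>
  The Cauchy kernel of the Dunkl equation with its pole at the real point \<open>x\<close>, made smooth by adding
  \<open>e > 0\<close> to the squared distance; \<open>e = 0\<close> gives the kernel itself. The operator \<open>E\<close> maps it to the
  positive radial density \<open>pole_mass\<close>, which concentrates at the pole as \<open>e\<close> tends to zero.
\<close>

definition reg_kernel :: "real \<Rightarrow> real \<Rightarrow> real \<Rightarrow> complex \<Rightarrow> complex" where
  "reg_kernel lam e x w = cnj (w - of_real x) * of_real (((norm (w - of_real x))\<^sup>2 + e) powr (- lam - 1))"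

definition pole_mass :: "real \<Rightarrow> real \<Rightarrow> complex \<Rightarrow> real" where
  "pole_mass lam e w = 2 * (lam + 1) * e * ((norm w)\<^sup>2 + e) powr (- lam - 2)"

lemma norm_sq_has_derivative:
  "((\<lambda>w. (norm (w - a))\<^sup>2) has_derivative
      (\<lambda>h. 2 * (Re h * Re (w - a) + Im h * Im (w - a)))) (at w)" for w a :: complex
proof -
  have eq: "(\<lambda>w. (norm (w - a))\<^sup>2) = (\<lambda>w. (Re w - Re a)\<^sup>2 + (Im w - Im a)\<^sup>2)"
    by (auto simp: cmod_power2)
  show ?thesis unfolding eq
    by (auto intro!: derivative_eq_intros simp: fun_eq_iff algebra_simps)
qed

lemma reg_kernel_has_derivative:
  fixes lam x e :: real
  assumes "0 < e"
  defines "q \<equiv> \<lambda>w. ((norm (w - of_real x))\<^sup>2 + e) powr (- lam - 1)"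
    and "Q \<equiv> \<lambda>w. ((norm (w - of_real x))\<^sup>2 + e) powr (- lam - 2)"
  shows "(reg_kernel lam e x has_derivative (\<lambda>h.
      of_real (Re h) * (of_real (q w) - cnj (w - of_real x) * of_real (2 * (lam + 1) * Q w * (Re w - x)))
    + of_real (Im h) * (- \<i> * of_real (q w) - cnj (w - of_real x) * of_real (2 * (lam + 1) * Q w * Im w)))) (at w)"
proof -
  have pos: "0 < (norm (w - of_real x))\<^sup>2 + e" using assms by (simp add: add_nonneg_pos)
  have "((\<lambda>w. (norm (w - of_real x))\<^sup>2 + e) has_derivative
      (\<lambda>h. 2 * (Re h * Re (w - of_real x) + Im h * Im (w - of_real x)))) (at w)"
    by (rule has_derivative_add_const[OF norm_sq_has_derivative])
  moreover have "((\<lambda>t. t powr (- lam - 1)) has_derivative (*) ((- lam - 1) * ((norm (w - of_real x))\<^sup>2 + e) powr (- lam - 1 - 1)))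
      (at ((norm (w - of_real x))\<^sup>2 + e))"
    using has_real_derivative_powr[OF pos, of "- lam - 1"] by (simp only: has_field_derivative_def)
  ultimately have q: "(q has_derivative (\<lambda>h. ((- lam - 1) * Q w) * (2 * (Re h * (Re w - x) + Im h * Im w)))) (at w)"
    using has_derivative_compose[of "\<lambda>w. (norm (w - of_real x))\<^sup>2 + e" _ w UNIV "\<lambda>t. t powr (- lam - 1)"]
    unfolding q_def Q_def by (simp add: diff_diff_eq)
  have "((\<lambda>w. cnj (w - of_real x)) has_derivative (\<lambda>h. cnj h)) (at w)"
    by (intro derivative_eq_intros refl | simp)+
  from has_derivative_mult[OF this has_derivative_of_real[OF q]]
  have "((\<lambda>w. cnj (w - of_real x) * of_real (q w)) has_derivative
     (\<lambda>h. cnj (w - of_real x) * of_real (((- lam - 1) * Q w) * (2 * (Re h * (Re w - x) + Im h * Im w))) + cnj h * of_real (q w))) (at w)" .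
  moreover have "(\<lambda>w. cnj (w - of_real x) * of_real (q w)) = reg_kernel lam e x"
    by (auto simp: reg_kernel_def q_def)
  ultimately show ?thesis
    by (simp, elim has_derivative_eq_rhs) (auto simp: fun_eq_iff complex_eq_iff algebra_simps)
qed

lemma integrable_cauchy_density: "integrable lborel (\<lambda>x::real. inverse (1 + x\<^sup>2))"
proof -
  let ?f = "\<lambda>x::real. inverse (1 + x\<^sup>2)"
  have "(\<integral>\<^sup>+x. ennreal (?f x) * indicator {0..} x \<partial>lborel) = ennreal (pi/2 - arctan 0)"
    by (rule nn_integral_FTC_atLeast)
      (auto intro!: derivative_eq_intros tendsto_arctan_at_top simp: add_nonneg_eq_0_iff)
  hence "set_integrable lborel {0..} ?f"
    unfolding set_integrable_def
    by (intro integrableI_bounded) (auto simp: ennreal_indicator ennreal_mult' mult_ac top.not_eq_extremum simp flip: ennreal_indicator)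
  hence i: "integrable lborel (\<lambda>x. indicat_real {0..} x * ?f x)" by (simp add: set_integrable_def)
  have "integrable lborel (\<lambda>x. indicat_real {0..} (0 + (-1) * x) * ?f (0 + (-1) * x))"
    by (rule lborel_integrable_real_affine[OF i]) auto
  with i have "integrable lborel (\<lambda>x. indicat_real {0..} x * ?f x + indicat_real {0..} (- x) * ?f x)"
    by (intro Bochner_Integration.integrable_add) auto
  thus ?thesis
    by (rule Bochner_Integration.integrable_bound) (auto simp: indicator_def add_nonneg_nonneg)
qed

text \<open>
  Comparison with a product of two Cauchy densities: \<open>(1 + |v|\<^sup>2)\<^sup>2 \<ge> (1 + (Re v)\<^sup>2) (1 + (Im v)\<^sup>2)\<close>.
\<close>

lemma integrable_lborel_decay: "integrable lborel (\<lambda>v::complex. inverse ((1 + (norm v)\<^sup>2)\<^sup>2))"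
proof (rule Bochner_Integration.integrable_bound)
  have "integrable (lborel \<Otimes>\<^sub>M lborel) (\<lambda>(x::real, y::real). inverse (1 + x\<^sup>2) * inverse (1 + y\<^sup>2))"
    by (rule lborel_pair.Fubini_integrable)
      (auto simp: abs_mult add_nonneg_nonneg intro!: integrable_mult_right integrable_mult_left integrable_cauchy_density)
  thus "integrable lborel (\<lambda>v. inverse (1 + (Re v)\<^sup>2) * inverse (1 + (Im v)\<^sup>2))"
    unfolding distr_Complex_lborel[symmetric]
    by (subst integrable_distr_eq) (auto simp: case_prod_unfold)
  show "AE v in lborel. norm (inverse ((1 + (norm v)\<^sup>2)\<^sup>2)) \<le> norm (inverse (1 + (Re v)\<^sup>2) * inverse (1 + (Im v)\<^sup>2))"
  proof (rule AE_I2)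
    fix v :: complex
    have "(1 + (Re v)\<^sup>2) * (1 + (Im v)\<^sup>2) \<le> (1 + (norm v)\<^sup>2)\<^sup>2"
      unfolding cmod_power2 power2_eq_square[of "1 + _"] by (intro mult_mono) auto
    hence "inverse ((1 + (norm v)\<^sup>2)\<^sup>2) \<le> inverse ((1 + (Re v)\<^sup>2) * (1 + (Im v)\<^sup>2))"
      by (intro le_imp_inverse_le mult_pos_pos) (auto simp: add_pos_nonneg)
    thus "norm (inverse ((1 + (norm v)\<^sup>2)\<^sup>2)) \<le> norm (inverse (1 + (Re v)\<^sup>2) * inverse (1 + (Im v)\<^sup>2))"
      by (simp add: add_nonneg_nonneg abs_mult)
  qed
qed measurable

lemma integral_lborel_rescale:
  fixes f :: "complex \<Rightarrow> complex"
  assumes [measurable]: "f \<in> borel_measurable borel" and "0 < c"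
  shows "(\<integral>z. f z \<partial>lborel) = of_real (c\<^sup>2) * (\<integral>v. f (a + of_real c * v) \<partial>lborel)"
proof -
  have "(\<integral>z. f z \<partial>lborel) = (\<integral>z. f z \<partial>density (distr lborel borel (\<lambda>x. a + c *\<^sub>R x)) (\<lambda>_. \<bar>c\<bar> ^ DIM(complex)))"
    using lborel_affine[of c a] assms by simp
  also have "\<dots> = (\<integral>z. (\<bar>c\<bar> ^ DIM(complex)) *\<^sub>R f z \<partial>distr lborel borel (\<lambda>x. a + c *\<^sub>R x))"
    by (rule integral_density) auto
  also have "\<dots> = (\<integral>v. (\<bar>c\<bar> ^ DIM(complex)) *\<^sub>R f (a + c *\<^sub>R v) \<partial>lborel)"
    by (rule integral_distr) auto
  also have "\<dots> = of_real (c\<^sup>2) * (\<integral>v. f (a + of_real c * v) \<partial>lborel)"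
    by (simp add: scaleR_conv_of_real)
  finally show ?thesis .
qed


text \<open>
  A direct computation. Writing \<open>q\<close> for the power in the kernel, the derivatives contribute
  \<open>2 q - 2 (\<lambda> + 1) Q |w - x|\<^sup>2\<close> and the difference quotient \<open>2 \<lambda> q\<close>; since \<open>q = Q (|w - x|\<^sup>2 + e)\<close>, only the
  term with \<open>e\<close> survives.
\<close>

lemma pole_mass_E:
  fixes lam x e :: real and w :: complex
  assumes e: "0 < e" and w: "Im w \<noteq> 0"
  defines "q \<equiv> ((norm (w - of_real x))\<^sup>2 + e) powr (- lam - 1)"
    and "Q \<equiv> ((norm (w - of_real x))\<^sup>2 + e) powr (- lam - 2)"
  shows "(of_real q - cnj (w - of_real x) * of_real (2 * (lam + 1) * Q * (Re w - x)))
      + \<i> * ((- \<i> * of_real q - cnj (w - of_real x) * of_real (2 * (lam + 1) * Q * Im w))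
         + of_real (lam / Im w) * (reg_kernel lam e x w - reg_kernel lam e x (cnj w)))
      = of_real (pole_mass lam e (w - of_real x))"
proof -
  let ?n = "(norm (w - of_real x))\<^sup>2"
  have pos: "0 < ?n + e" using e by (simp add: add_nonneg_pos)
  have qQ: "q = Q * (?n + e)"
  proof -
    have "- lam - 1 = (- lam - 2) + 1" by simp
    thus ?thesis unfolding q_def Q_def using pos by (simp only: powr_add) simp
  qed
  have n: "?n = (Re w - x)\<^sup>2 + (Im w)\<^sup>2" by (simp add: cmod_power2)
  have nc: "norm (cnj w - of_real x) = norm (w - of_real x)"
    by (metis complex_cnj_complex_of_real complex_cnj_diff complex_mod_cnj)
  have k: "reg_kernel lam e x w - reg_kernel lam e x (cnj w) = - 2 * \<i> * of_real (Im w * q)"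
    unfolding reg_kernel_def nc q_def by (simp add: complex_eq_iff algebra_simps)
  have "\<i> * (of_real (lam / Im w) * (reg_kernel lam e x w - reg_kernel lam e x (cnj w))) = of_real (2 * lam * q)"
    unfolding k using w by (simp add: field_simps)
  moreover have "(of_real q - cnj (w - of_real x) * of_real (2 * (lam + 1) * Q * (Re w - x)))
      + \<i> * (- \<i> * of_real q - cnj (w - of_real x) * of_real (2 * (lam + 1) * Q * Im w))
      = of_real (2 * q - 2 * (lam + 1) * Q * ?n)"
    unfolding n by (simp add: complex_eq_iff algebra_simps power2_eq_square)
  moreover have "(2 * q - 2 * (lam + 1) * Q * ?n) + 2 * lam * q = pole_mass lam e (w - of_real x)"
  proof -
    have "pole_mass lam e (w - of_real x) = 2 * (lam + 1) * e * Q" by (simp add: pole_mass_def Q_def)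
    thus ?thesis by (simp add: qQ algebra_simps)
  qed
  ultimately show ?thesis
    by (metis (no_types, lifting) add.assoc distrib_left of_real_add)
qed

lemma reg_kernel_continuous: "0 < e \<Longrightarrow> continuous_on S (reg_kernel lam e x)"
  unfolding reg_kernel_def
  by (intro continuous_intros) (auto simp: add_nonneg_eq_0_iff)

lemma pole_mass_continuous: "0 < e \<Longrightarrow> continuous_on S (pole_mass lam e)"
  unfolding pole_mass_def
  by (intro continuous_intros) (auto simp: add_nonneg_eq_0_iff)

text \<open>
  The weak form with the regularised kernel times a radial cut-off about a real point. Such a cut-off is
  even in \<open>y\<close>, so \<open>E\<close> obeys the product rule for it. The gradient of the cut-off,
  \<open>2 (w - c) h'(|w - c|\<^sup>2)\<close>, is written in complex form.
\<close>

lemma dunkl_weak_radial: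
  fixes f :: "complex \<Rightarrow> complex" and h h' :: "real \<Rightarrow> real" and c x :: real
  assumes lam: "0 \<le> lam" and f: "dunkl_holomorphic lam (ball 0 R) f" and fm [measurable]: "f \<in> borel_measurable borel"
    and h: "\<And>t. (h has_real_derivative h' t) (at t)" and h'c: "continuous_on UNIV h'"
    and hT: "\<And>t. t \<ge> T \<Longrightarrow> h t = 0" "\<And>t. t \<ge> T \<Longrightarrow> h' t = 0" and T: "0 \<le> T" "\<bar>c\<bar> + sqrt T < R"
    and e: "0 < e"
  shows "(\<integral>w. f w * (reg_kernel lam e x w * (2 * (w - of_real c) * of_real (h' ((norm (w - of_real c))\<^sup>2)))
            + of_real (pole_mass lam e (w - of_real x) * h ((norm (w - of_real c))\<^sup>2))) \<partial>sigma_lambda lam) = 0"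
proof -
  define q where "q = (\<lambda>w::complex. ((norm (w - of_real x))\<^sup>2 + e) powr (- lam - 1))"
  define Q where "Q = (\<lambda>w::complex. ((norm (w - of_real x))\<^sup>2 + e) powr (- lam - 2))"
  define gx where "gx = (\<lambda>w. of_real (q w) - cnj (w - of_real x) * of_real (2 * (lam + 1) * Q w * (Re w - x)))"
  define gy where "gy = (\<lambda>w. - \<i> * of_real (q w) - cnj (w - of_real x) * of_real (2 * (lam + 1) * Q w * Im w))"
  let ?g = "reg_kernel lam e x"
  define n where "n = (\<lambda>w::complex. (norm (w - of_real c))\<^sup>2)"
  define psi where "psi = (\<lambda>w. ?g w * of_real (h (n w)))"
  define px where "px = (\<lambda>w. ?g w * of_real (h' (n w) * (2 * (Re w - c))) + gx w * of_real (h (n w)))"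
  define py where "py = (\<lambda>w. ?g w * of_real (h' (n w) * (2 * Im w)) + gy w * of_real (h (n w)))"
  have gd: "(?g has_derivative (real_linear (gx w) (gy w))) (at w)" for w
    using reg_kernel_has_derivative[OF e, of lam x w] by (simp add: gx_def gy_def q_def Q_def)
  have hc: "continuous_on UNIV h"
    by (intro continuous_at_imp_continuous_on ballI) (use h DERIV_isCont in blast)
  have nc: "continuous_on S n" for S unfolding n_def by (intro continuous_intros)
  have hn: "continuous_on S (\<lambda>w. h (n w))" "continuous_on S (\<lambda>w. h' (n w))" for S
    by (auto intro: continuous_on_compose2[OF hc nc] continuous_on_compose2[OF h'c nc])
  have pos: "(norm (w - of_real x))\<^sup>2 + e \<noteq> 0" for w :: complex
    using e by (auto simp: add_nonneg_eq_0_iff)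
  have qc: "continuous_on S q" "continuous_on S Q" for S
    unfolding q_def Q_def by (intro continuous_intros; use pos in blast)+
  have gc: "continuous_on S ?g" "continuous_on S gx" "continuous_on S gy" for S
    unfolding gx_def gy_def by (intro continuous_intros qc reg_kernel_continuous e)+
  have nd: "(n has_derivative (\<lambda>k. 2 * (Re k * (Re w - c) + Im k * Im w))) (at w)" for w
    using norm_sq_has_derivative[of "of_real c" w] by (simp add: n_def)
  have hnd: "((\<lambda>w. h (n w)) has_derivative (\<lambda>k. h' (n w) * (2 * (Re k * (Re w - c) + Im k * Im w)))) (at w)" for w
    using has_derivative_compose[OF nd, of h "(*) (h' (n w))"] h[of "n w"] by (simp add: has_field_derivative_def)
  have pd: "(psi has_derivative (real_linear (px w) (py w))) (at w)" for w
  proof -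
    have "(psi has_derivative (\<lambda>k. ?g w * of_real (h' (n w) * (2 * (Re k * (Re w - c) + Im k * Im w)))
        + (of_real (Re k) * gx w + of_real (Im k) * gy w) * of_real (h (n w)))) (at w)"
      unfolding psi_def by (rule has_derivative_mult[OF gd has_derivative_of_real[OF hnd]])
    thus ?thesis by (elim has_derivative_eq_rhs) (simp add: px_def py_def algebra_simps)
  qed
  have big: "T \<le> n w" if "norm w \<ge> \<bar>c\<bar> + sqrt T" for w
  proof -
    have "sqrt T \<le> norm (w - of_real c)" using that norm_triangle_ineq2[of w "of_real c"] by simp
    hence "(sqrt T)\<^sup>2 \<le> n w" unfolding n_def by (rule power_mono) (use T in auto)
    thus ?thesis using T by simp
  qed
  have z: "psi w = 0" "px w = 0" "py w = 0" if "norm w \<ge> \<bar>c\<bar> + sqrt T" for w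
    using big[OF that] hT by (auto simp: psi_def px_def py_def)
  have pxc: "continuous_on UNIV px" and pyc: "continuous_on UNIV py"
    unfolding px_def py_def by (intro continuous_intros gc hn)+
  have pc: "continuous_on UNIV psi"
    unfolding psi_def by (intro continuous_intros gc hn)
  have [measurable]: "psi \<in> borel_measurable borel" "px \<in> borel_measurable borel" "py \<in> borel_measurable borel"
    using pc pxc pyc by (auto intro: borel_measurable_continuous_onI)
  have "(\<integral>w. f w * (dunkl_E lam psi px py w) \<partial>sigma_lambda lam) = 0"
    by (rule dunkl_weak[OF lam f pd pxc pyc T(2) z])
  moreover have "(\<integral>w. f w * (dunkl_E lam psi px py w) \<partial>sigma_lambda lam)
     = (\<integral>w. f w * (?g w * (2 * (w - of_real c) * of_real (h' (n w)))
            + of_real (pole_mass lam e (w - of_real x) * h (n w))) \<partial>sigma_lambda lam)"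
  proof (rule integral_cong_AE)
    have "AE z in sigma_lambda lam. Im z \<noteq> 0" by (simp add: AE_sigma_iff[OF lam] AE_Im_nonzero)
    thus "AE w in sigma_lambda lam. f w * (dunkl_E lam psi px py w)
       = f w * (?g w * (2 * (w - of_real c) * of_real (h' (n w)))
            + of_real (pole_mass lam e (w - of_real x) * h (n w)))"
    proof eventually_elim
      case (elim w)
      have ncnj: "n (cnj w) = n w"
        unfolding n_def by (metis complex_cnj_complex_of_real complex_cnj_diff complex_mod_cnj)
      have E: "dunkl_E lam ?g gx gy w = of_real (pole_mass lam e (w - of_real x))"
        unfolding gx_def gy_def q_def Q_def by (rule pole_mass_E[OF e elim])
      have w: "w = of_real (Re w) + \<i> * of_real (Im w)" by (rule complex_eq)
      have "dunkl_E lam psi px py w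
        = ?g w * of_real (h' (n w)) * (2 * (of_real (Re w) + \<i> * of_real (Im w) - of_real c))
         + of_real (h (n w)) * (dunkl_E lam ?g gx gy w)"
        unfolding px_def py_def psi_def ncnj by (simp add: algebra_simps)
      also have "\<dots> = ?g w * (2 * (w - of_real c) * of_real (h' (n w)))
            + of_real (pole_mass lam e (w - of_real x) * h (n w))"
        unfolding E w[symmetric] by simp
      finally show ?case by simp
    qed
    have [measurable]: "h \<in> borel_measurable borel" "h' \<in> borel_measurable borel" "n \<in> borel_measurable borel"
      "?g \<in> borel_measurable borel" "pole_mass lam e \<in> borel_measurable borel"
      using hc h'c nc gc pole_mass_continuous[OF e] by (auto intro: borel_measurable_continuous_onI)
    show "(\<lambda>w. f w * (dunkl_E lam psi px py w)) \<in> borel_measurable (sigma_lambda lam)"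
      "(\<lambda>w. f w * (?g w * (2 * (w - of_real c) * of_real (h' (n w)))
            + of_real (pole_mass lam e (w - of_real x) * h (n w)))) \<in> borel_measurable (sigma_lambda lam)"
      by measurable
  qed
  ultimately show ?thesis by (simp add: n_def)
qed

definition pole_constant :: "real \<Rightarrow> real" where
  "pole_constant lam = (\<integral>v. pole_mass lam 1 v \<partial>sigma_lambda lam)"

lemma pole_mass_integrable:
  assumes lam: "0 \<le> lam"
  shows "integrable (sigma_lambda lam) (pole_mass lam 1)"
proof -
  have [measurable]: "pole_mass lam 1 \<in> borel_measurable borel"
    using pole_mass_continuous[of 1 UNIV lam] by (auto intro: borel_measurable_continuous_onI)
  have "integrable lborel (\<lambda>z. (c_lambda lam * \<bar>Im z\<bar> powr (2 * lam)) *\<^sub>R pole_mass lam 1 z)"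
  proof (rule Bochner_Integration.integrable_bound)
    show "integrable lborel (\<lambda>v::complex. (c_lambda lam * (2 * (lam + 1))) * inverse ((1 + (norm v)\<^sup>2)\<^sup>2))"
      by (intro integrable_mult_right integrable_lborel_decay)
    show "AE z in lborel. norm ((c_lambda lam * \<bar>Im z\<bar> powr (2 * lam)) *\<^sub>R pole_mass lam 1 z)
        \<le> norm ((c_lambda lam * (2 * (lam + 1))) * inverse ((1 + (norm z)\<^sup>2)\<^sup>2))"
    proof (rule AE_I2)
      fix z :: complex
      let ?m = "(norm z)\<^sup>2 + 1"
      have m: "?m > 0" by (simp add: add_nonneg_pos)
      have "\<bar>Im z\<bar> powr (2 * lam) = (\<bar>Im z\<bar> powr 2) powr lam" by (simp only: powr_powr)
      also have "\<dots> \<le> ?m powr lam"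
      proof (rule powr_mono2[OF lam])
        have "\<bar>Im z\<bar> powr 2 = (Im z)\<^sup>2" by (cases "Im z = 0") auto
        thus "\<bar>Im z\<bar> powr 2 \<le> ?m" by (simp add: cmod_power2)
      qed simp
      finally have "\<bar>Im z\<bar> powr (2 * lam) * ?m powr (- lam - 2) \<le> ?m powr lam * ?m powr (- lam - 2)"
        by (intro mult_right_mono) auto
      also have "\<dots> = ?m powr (- 2)" by (simp flip: powr_add)
      also have "\<dots> = inverse (?m\<^sup>2)" using m by (simp add: powr_minus)
      finally have "\<bar>Im z\<bar> powr (2 * lam) * ?m powr (- lam - 2) \<le> inverse (?m\<^sup>2)" .
      hence "c_lambda lam * (2 * (lam + 1)) * (\<bar>Im z\<bar> powr (2 * lam) * ?m powr (- lam - 2))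
         \<le> c_lambda lam * (2 * (lam + 1)) * inverse (?m\<^sup>2)"
        using c_lambda_pos[OF lam] lam by (intro mult_left_mono) auto
      thus "norm ((c_lambda lam * \<bar>Im z\<bar> powr (2 * lam)) *\<^sub>R pole_mass lam 1 z)
        \<le> norm ((c_lambda lam * (2 * (lam + 1))) * inverse ((1 + (norm z)\<^sup>2)\<^sup>2))"
        using c_lambda_pos[OF lam] lam by (simp add: pole_mass_def abs_mult mult_ac add.commute)
    qed
  qed measurable
  thus ?thesis unfolding sigma_lambda_def
    using c_lambda_pos[OF lam] by (subst integrable_density) auto
qed

lemma pole_constant_pos:
  assumes lam: "0 \<le> lam" shows "0 < pole_constant lam"
proof -
  have p: "pole_mass lam 1 z > 0" for z
    using lam add_nonneg_pos[of "(norm z)\<^sup>2" 1] by (simp add: pole_mass_def)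
  have "pole_constant lam \<noteq> 0"
  proof
    assume "pole_constant lam = 0"
    hence "AE z in sigma_lambda lam. pole_mass lam 1 z = 0"
      unfolding pole_constant_def
      using integral_nonneg_eq_0_iff_AE[OF pole_mass_integrable[OF lam]] p by (simp add: less_imp_le)
    hence "AE z in lborel. z \<in> UNIV \<longrightarrow> pole_mass lam 1 z = 0" by (simp add: AE_sigma_iff[OF lam])
    from continuous_AE_zero_imp_zero[OF open_UNIV _ this, of 0] p[of 0]
    show False using pole_mass_continuous[of 1 UNIV lam] by auto
  qed
  moreover have "pole_constant lam \<ge> 0"
    unfolding pole_constant_def using p by (intro Bochner_Integration.integral_nonneg) (auto simp: less_imp_le)
  ultimately show ?thesis by simp
qed

text \<open>
  Under \<open>w = x + \<epsilon> v\<close> the weight contributes \<open>\<epsilon>\<^sup>2\<^sup>\<lambda>\<close>, the area \<open>\<epsilon>\<^sup>2\<close> and the density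
  \<open>\<epsilon>\<^sup>-\<^sup>2\<^sup>\<lambda>\<^sup>-\<^sup>2\<close>. The powers cancel: \<open>pole_mass\<close> is an approximate identity of constant mass.
\<close>

lemma pole_mass_rescale:
  fixes F :: "complex \<Rightarrow> complex"
  assumes lam: "0 \<le> lam" and [measurable]: "F \<in> borel_measurable borel" and eps: "0 < eps"
  shows "(\<integral>w. F w * of_real (pole_mass lam (eps\<^sup>2) (w - of_real x)) \<partial>sigma_lambda lam)
       = (\<integral>v. F (of_real x + of_real eps * v) * of_real (pole_mass lam 1 v) \<partial>sigma_lambda lam)"
proof -
  have [measurable]: "pole_mass lam e \<in> borel_measurable borel" if "0 < e" for e
    using pole_mass_continuous[OF that, of UNIV lam] by (auto intro: borel_measurable_continuous_onI)
  have m2 [measurable]: "pole_mass lam (eps\<^sup>2) \<in> borel_measurable borel" "pole_mass lam 1 \<in> borel_measurable borel"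
    using eps by auto
  have s: "of_real (eps\<^sup>2) * (of_real (\<bar>Im (of_real x + of_real eps * v)\<bar> powr (2*lam)) *
       (F (of_real x + of_real eps * v) * of_real (pole_mass lam (eps\<^sup>2) ((of_real x + of_real eps * v) - of_real x))))
     = of_real (\<bar>Im v\<bar> powr (2*lam)) * (F (of_real x + of_real eps * v) * of_real (pole_mass lam 1 v))" for v
  proof -
    have "(norm (of_real eps * v))\<^sup>2 + eps\<^sup>2 = eps\<^sup>2 * ((norm v)\<^sup>2 + 1)"
      using eps by (simp add: norm_mult power_mult_distrib algebra_simps)
    hence "((norm (of_real eps * v))\<^sup>2 + eps\<^sup>2) powr (- lam - 2) = (eps powr 2) powr (- lam - 2) * ((norm v)\<^sup>2 + 1) powr (- lam - 2)"
      using eps by (simp add: powr_mult)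
    moreover have "\<bar>Im (of_real x + of_real eps * v)\<bar> powr (2*lam) = eps powr (2*lam) * \<bar>Im v\<bar> powr (2*lam)"
      using eps by (simp add: abs_mult powr_mult)
    moreover have "eps\<^sup>2 * (eps powr (2*lam) * (eps\<^sup>2 * (eps powr 2) powr (- lam - 2))) = 1"
    proof -
      have "eps\<^sup>2 * (eps powr (2*lam) * (eps\<^sup>2 * (eps powr 2) powr (- lam - 2)))
         = eps powr 2 * (eps powr (2*lam) * (eps powr 2 * eps powr (2 * (- lam - 2))))"
      proof -
        have "eps\<^sup>2 = eps powr 2" using eps by simp
        thus ?thesis by (simp only: powr_powr)
      qed
      also have "\<dots> = eps powr (2 + (2*lam + (2 + 2 * (- lam - 2))))" by (simp only: powr_add)
      also have "\<dots> = 1" using eps by simp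
      finally show ?thesis .
    qed
    moreover have "e * ((b0 * b1) * (2 * (lam + 1) * e * (a0 * a1))) = (e * (b0 * (e * a0))) * (b1 * (2 * (lam + 1) * 1 * a1))"
      for e a0 a1 b0 b1 :: real by (simp only: mult_ac mult_1)
    ultimately have "eps\<^sup>2 * (\<bar>Im (of_real x + of_real eps * v)\<bar> powr (2*lam) * pole_mass lam (eps\<^sup>2) (of_real eps * v))
       = \<bar>Im v\<bar> powr (2*lam) * pole_mass lam 1 v"
      unfolding pole_mass_def by simp
    from arg_cong[OF this, of complex_of_real] show ?thesis
      by (simp add: mult_ac)
  qed
  have "(\<integral>w. of_real (\<bar>Im w\<bar> powr (2*lam)) * (F w * of_real (pole_mass lam (eps\<^sup>2) (w - of_real x))) \<partial>lborel)
     = of_real (eps\<^sup>2) * (\<integral>v. of_real (\<bar>Im (of_real x + of_real eps * v)\<bar> powr (2*lam)) *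
       (F (of_real x + of_real eps * v) * of_real (pole_mass lam (eps\<^sup>2) ((of_real x + of_real eps * v) - of_real x))) \<partial>lborel)"
    by (rule integral_lborel_rescale[OF _ eps]) measurable
  also have "\<dots> = (\<integral>v. of_real (\<bar>Im v\<bar> powr (2*lam)) * (F (of_real x + of_real eps * v) * of_real (pole_mass lam 1 v)) \<partial>lborel)"
    unfolding s[symmetric] by simp
  finally show ?thesis by (simp add: integral_sigma[OF lam])
qed


lemma pole_mass_le:
  assumes "0 \<le> lam" "0 < e"
  shows "0 \<le> pole_mass lam e w" "pole_mass lam e w \<le> 2 * (lam + 1) * e * e powr (- lam - 2)"
proof -
  have "((norm w)\<^sup>2 + e) powr (- lam - 2) \<le> e powr (- lam - 2)"
    using assms by (intro powr_mono2') auto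
  thus "pole_mass lam e w \<le> 2 * (lam + 1) * e * e powr (- lam - 2)"
    unfolding pole_mass_def using assms by (intro mult_left_mono) auto
  show "0 \<le> pole_mass lam e w" using assms by (simp add: pole_mass_def)
qed

text \<open>
  The bound does not depend on \<open>e\<close>, so it dominates the kernels in the limit \<open>e \<rightarrow> 0\<close>.
\<close>

lemma reg_kernel_norm_le:
  assumes "0 \<le> e" "0 \<le> lam"
  shows "norm (reg_kernel lam e x w) * norm (w - of_real x) powr (2 * lam + 1) \<le> 1"
proof (cases "w = of_real x")
  case False
  let ?d = "norm (w - of_real x)"
  have d: "?d > 0" using False by simp
  have nc: "norm (cnj w - of_real x) = ?d"
    by (metis complex_cnj_complex_of_real complex_cnj_diff complex_mod_cnj)
  have "norm (reg_kernel lam e x w) * ?d powr (2 * lam + 1)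
     = (?d * ?d powr (2 * lam + 1)) * (?d\<^sup>2 + e) powr (- lam - 1)"
    by (simp add: reg_kernel_def norm_mult nc)
  also have "\<dots> \<le> (?d * ?d powr (2 * lam + 1)) * (?d\<^sup>2) powr (- lam - 1)"
    using assms d by (intro mult_left_mono powr_mono2') auto
  also have "(?d\<^sup>2) powr (- lam - 1) = ?d powr (- 2 * lam - 2)"
  proof -
    have "?d\<^sup>2 = ?d powr 2" using d by simp
    thus ?thesis by (simp only: powr_powr) (simp add: algebra_simps)
  qed
  also have "?d * ?d powr (2 * lam + 1) = ?d powr (2 * lam + 2)"
    using d powr_add[of ?d 1 "2 * lam + 1"] by (simp add: add.commute)
  also have "?d powr (2 * lam + 2) * ?d powr (- 2 * lam - 2) = 1"
    using d by (simp flip: powr_add)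
  finally show ?thesis .
qed (simp add: reg_kernel_def)

text \<open>
  Cauchy-Pompeiu formula on the real axis, the limit \<open>e \<rightarrow> 0\<close> of the weak form with the regularised
  kernel. Assumption \<open>bd\<close> keeps the product of the kernel and the gradient of the cut-off bounded. It
  allows both kinds of cut-off that are needed: those that are constant near the pole, and those
  centred at the pole whose profile has a derivative that vanishes there to the order \<open>\<lambda>\<close>.
\<close>

theorem pompeiu_real_axis:
  fixes f :: "complex \<Rightarrow> complex" and h h' :: "real \<Rightarrow> real" and c x :: real
  assumes lam: "0 \<le> lam" and f0: "dunkl_holomorphic lam (ball 0 R) f"
    and h: "\<And>t. (h has_real_derivative h' t) (at t)" and h'c: "continuous_on UNIV h'"
    and hT: "\<And>t. t \<ge> T \<Longrightarrow> h t = 0" "\<And>t. t \<ge> T \<Longrightarrow> h' t = 0" and T: "0 \<le> T" "\<bar>c\<bar> + sqrt T < R"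
    and bd: "\<And>w::complex. norm (w - of_real c) * \<bar>h' ((norm (w - of_real c))\<^sup>2)\<bar> \<le> C * norm (w - of_real x) powr (2 * lam + 1)"
  shows "of_real (pole_constant lam * h ((x - c)\<^sup>2)) * f (of_real x)
     = - (\<integral>w. f w * (reg_kernel lam 0 x w * (2 * (w - of_real c) * of_real (h' ((norm (w - of_real c))\<^sup>2)))) \<partial>sigma_lambda lam)"
proof -
  \<comment> \<open>the cut-off hides the values of \<open>f\<close> outside the disk; replacing them by zero makes \<open>f\<close> measurable\<close>
  define F where "F = (\<lambda>w. indicat_real (ball 0 R) w *\<^sub>R f w)"
  define n where "n = (\<lambda>w::complex. (norm (w - of_real c))\<^sup>2)"
  define r where "r = \<bar>c\<bar> + sqrt T"
  have rR: "r < R" using T by (simp add: r_def)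
  have F_eq: "F w = f w" if "norm w < R" for w using that by (simp add: F_def)
  have fc: "continuous_on (ball 0 R) f" by (rule dunkl_holomorphic_continuous_on[OF f0])
  have Fm [measurable]: "F \<in> borel_measurable borel"
    unfolding F_def by (rule borel_measurable_continuous_on_indicator[OF _ fc]) simp
  have Fh: "dunkl_holomorphic lam (ball 0 R) F"
  proof -
    obtain fx fy where fx: "continuous_on (ball 0 R) fx" and fy: "continuous_on (ball 0 R) fy"
      and fd: "\<And>z. z \<in> ball 0 R \<Longrightarrow> (f has_derivative (real_linear (fx z) (fy z))) (at z)"
      and fe: "\<And>z. z \<in> ball 0 R \<Longrightarrow> Im z \<noteq> 0 \<Longrightarrow> dunkl_E lam f fx fy z = 0"
      using f0 unfolding dunkl_holomorphic_def by blast
    have "(F has_derivative (real_linear (fx z) (fy z))) (at z)" if "z \<in> ball 0 R" for z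
      by (rule has_derivative_transform_within_open[OF fd[OF that], of "ball 0 R"]) (use that F_eq in auto)
    moreover have "dunkl_E lam F fx fy z = 0" if "z \<in> ball 0 R" "Im z \<noteq> 0" for z
      using fe[OF that] that by (simp add: F_eq)
    ultimately show ?thesis unfolding dunkl_holomorphic_def using fx fy by blast
  qed
  have big: "T \<le> n w" if "norm w \<ge> r" for w
  proof -
    have "sqrt T \<le> norm (w - of_real c)" using that norm_triangle_ineq2[of w "of_real c"] by (simp add: r_def)
    hence "(sqrt T)\<^sup>2 \<le> n w" unfolding n_def by (rule power_mono) (use T in auto)
    thus ?thesis using T by simp
  qed
  have hc: "continuous_on UNIV h"
    by (intro continuous_at_imp_continuous_on ballI) (use h DERIV_isCont in blast)
  have nc: "continuous_on S n" for S unfolding n_def by (intro continuous_intros)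
  have hn: "continuous_on S (\<lambda>w. h (n w))" "continuous_on S (\<lambda>w. h' (n w))" for S
    by (auto intro: continuous_on_compose2[OF hc nc] continuous_on_compose2[OF h'c nc])
  have hnz: "h (n w) = 0" "h' (n w) = 0" if "norm w \<ge> r" for w using big[OF that] hT by auto
  have [measurable]: "h \<in> borel_measurable borel" "h' \<in> borel_measurable borel" "n \<in> borel_measurable borel"
    using hc h'c nc by (auto intro: borel_measurable_continuous_onI)
  have km [measurable]: "reg_kernel lam e x \<in> borel_measurable borel" for e
    unfolding reg_kernel_def by measurable
  have pm [measurable]: "pole_mass lam e \<in> borel_measurable borel" for e
    unfolding pole_mass_def by measurable
  have "continuous_on (cball 0 r) f" by (rule continuous_on_subset[OF fc]) (use rR in auto)
  then obtain B where "B \<ge> 0" "\<And>z. z \<in> cball 0 r \<Longrightarrow> norm (f z) \<le> B"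
    using continuous_on_compact_bound[OF compact_cball] by blast
  hence B: "B \<ge> 0" "\<And>z. norm z \<le> r \<Longrightarrow> norm (F z) \<le> B" using rR F_eq by auto
  have C: "C \<ge> 0"
  proof (rule ccontr)
    assume "\<not> C \<ge> 0"
    moreover have "0 \<le> C * norm ((of_real x + 1) - complex_of_real x) powr (2 * lam + 1)"
      by (rule order_trans[OF _ bd]) simp
    ultimately show False by simp
  qed
  define A where "A = (\<lambda>e w. F w * (reg_kernel lam e x w * (2 * (w - of_real c) * of_real (h' (n w)))))"
  have Am [measurable]: "A e \<in> borel_measurable borel" for e unfolding A_def by measurable
  have Az: "A e w = 0" if "norm w > r" for e w using hnz[of w] that by (simp add: A_def)
  have Ab: "norm (A e w) \<le> B * (2 * C)" if "0 \<le> e" for e w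
  proof (cases "norm w \<le> r")
    case True
    have "norm (A e w) = norm (F w) * (2 * (norm (reg_kernel lam e x w) * (norm (w - of_real c) * \<bar>h' (n w)\<bar>)))"
      by (simp add: A_def norm_mult del: right_diff_distrib_numeral)
    also have "\<dots> \<le> B * (2 * (norm (reg_kernel lam e x w) * (C * norm (w - of_real x) powr (2 * lam + 1))))"
    proof (rule mult_mono)
      have "norm (reg_kernel lam e x w) * (norm (w - of_real c) * \<bar>h' (n w)\<bar>)
          \<le> norm (reg_kernel lam e x w) * (C * norm (w - of_real x) powr (2 * lam + 1))"
        using bd[of w] unfolding n_def by (rule mult_left_mono) simp
      thus "2 * (norm (reg_kernel lam e x w) * (norm (w - of_real c) * \<bar>h' (n w)\<bar>))
          \<le> 2 * (norm (reg_kernel lam e x w) * (C * norm (w - of_real x) powr (2 * lam + 1)))"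
        by (rule mult_left_mono) simp
    qed (use B True in auto)
    also have "\<dots> = B * (2 * (C * (norm (reg_kernel lam e x w) * norm (w - of_real x) powr (2 * lam + 1))))"
      by (simp only: mult_ac)
    also have "\<dots> \<le> B * (2 * (C * 1))"
      using reg_kernel_norm_le[OF that lam] C B(1) by (intro mult_left_mono) auto
    finally show ?thesis by simp
  qed (use Az C B(1) in auto)
  have Ai: "integrable (sigma_lambda lam) (A e)" if "0 \<le> e" for e
    by (rule integrable_sigma_bounded[OF lam Am Ab[OF that]]) (use Az in auto)
  define G where "G = (\<lambda>w. F w * of_real (h (n w)))"
  have Gm [measurable]: "G \<in> borel_measurable borel" unfolding G_def by measurable
  have Gz: "G w = 0" if "norm w \<ge> r" for w using hnz[OF that] by (simp add: G_def)
  have Gc: "continuous_on UNIV G"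
  proof -
    have "continuous_on (ball 0 R) G"
      by (rule continuous_on_eq[of _ "\<lambda>w. f w * of_real (h (n w))"])
        (auto intro!: continuous_intros fc hn simp: G_def F_eq)
    moreover have "continuous_on (- cball 0 r) G"
      by (rule continuous_on_eq[OF continuous_on_const[of _ 0]]) (use Gz in auto)
    ultimately have "continuous_on (ball 0 R \<union> - cball 0 r) G" by (intro continuous_on_open_Un) auto
    moreover have "ball 0 R \<union> - cball 0 r = (UNIV :: complex set)" using rR by auto
    ultimately show ?thesis by metis
  qed
  obtain M where M: "\<And>w. norm (G w) \<le> M"
    using continuous_compact_support_bounded[OF Gc Gz] by blast
  have split: "(\<integral>w. A (eps\<^sup>2) w \<partial>sigma_lambda lam)
      = - (\<integral>v. G (of_real x + of_real eps * v) * of_real (pole_mass lam 1 v) \<partial>sigma_lambda lam)" if eps: "0 < eps" for eps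
  proof -
    have e: "0 < eps\<^sup>2" using eps by simp
    have "norm (G w * of_real (pole_mass lam (eps\<^sup>2) (w - of_real x))) \<le> M * (2 * (lam + 1) * eps\<^sup>2 * (eps\<^sup>2) powr (- lam - 2))" for w
      unfolding norm_mult norm_of_real
      using pole_mass_le[OF lam e, of "w - of_real x"] M[of w] order_trans[OF norm_ge_zero M[of w]]
      by (intro mult_mono) (auto simp: abs_of_nonneg)
    hence Bi: "integrable (sigma_lambda lam) (\<lambda>w. G w * of_real (pole_mass lam (eps\<^sup>2) (w - of_real x)))"
      by (intro integrable_sigma_bounded[OF lam, where R = r]) (use Gz in auto)
    have "0 = (\<integral>w. A (eps\<^sup>2) w + G w * of_real (pole_mass lam (eps\<^sup>2) (w - of_real x)) \<partial>sigma_lambda lam)"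
      using dunkl_weak_radial[OF lam Fh Fm h h'c hT T e, of x]
      by (simp add: A_def G_def n_def algebra_simps)
    also have "\<dots> = (\<integral>w. A (eps\<^sup>2) w \<partial>sigma_lambda lam) + (\<integral>w. G w * of_real (pole_mass lam (eps\<^sup>2) (w - of_real x)) \<partial>sigma_lambda lam)"
      using Ai[of "eps\<^sup>2"] Bi by simp
    finally show ?thesis
      unfolding pole_mass_rescale[OF lam Gm eps] by (simp add: eq_neg_iff_add_eq_0)
  qed
  define eps where "eps = (\<lambda>k::nat. inverse (real (Suc k)))"
  have epos: "0 < eps k" for k by (simp add: eps_def)
  have e0: "eps \<longlonglongrightarrow> 0" unfolding eps_def by (rule LIMSEQ_inverse_real_of_nat)
  have lim1: "(\<lambda>k. \<integral>w. A ((eps k)\<^sup>2) w \<partial>sigma_lambda lam) \<longlonglongrightarrow> (\<integral>w. A 0 w \<partial>sigma_lambda lam)"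
  proof (rule integral_dominated_convergence[where w = "\<lambda>w. indicat_real (cball 0 r) w *\<^sub>R (B * (2 * C))"])
    show "integrable (sigma_lambda lam) (\<lambda>w. indicat_real (cball 0 r) w *\<^sub>R (B * (2 * C)))"
      by (rule continuous_integrable_sigma[OF lam]) auto
    show "AE w in sigma_lambda lam. (\<lambda>k. A ((eps k)\<^sup>2) w) \<longlonglongrightarrow> A 0 w"
    proof (rule AE_I2)
      fix w :: complex
      have l: "(\<lambda>k. (norm (w - of_real x))\<^sup>2 + (eps k)\<^sup>2) \<longlonglongrightarrow> (norm (w - of_real x))\<^sup>2 + 0\<^sup>2"
        by (intro tendsto_intros e0)
      show "(\<lambda>k. A ((eps k)\<^sup>2) w) \<longlonglongrightarrow> A 0 w"
      proof (cases "w = of_real x")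
        case True thus ?thesis by (simp add: A_def reg_kernel_def)
      next
        case False
        have "(\<lambda>k. reg_kernel lam ((eps k)\<^sup>2) x w) \<longlonglongrightarrow> reg_kernel lam 0 x w"
          unfolding reg_kernel_def
          by (intro tendsto_intros tendsto_powr) (use e0 False in auto)
        thus ?thesis unfolding A_def by (intro tendsto_intros)
      qed
    qed
    show "AE w in sigma_lambda lam. norm (A ((eps k)\<^sup>2) w) \<le> indicat_real (cball 0 r) w *\<^sub>R (B * (2 * C))" for k
      using Ab Az by (intro AE_I2) (auto simp: indicator_def)
  qed auto
  have lim2: "(\<lambda>k. \<integral>v. G (of_real x + of_real (eps k) * v) * of_real (pole_mass lam 1 v) \<partial>sigma_lambda lam)
      \<longlonglongrightarrow> (\<integral>v. G (of_real x) * of_real (pole_mass lam 1 v) \<partial>sigma_lambda lam)"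
  proof (rule integral_dominated_convergence[where w = "\<lambda>v. M * pole_mass lam 1 v"])
    show "integrable (sigma_lambda lam) (\<lambda>v. M * pole_mass lam 1 v)"
      by (intro integrable_mult_right pole_mass_integrable lam)
    show "AE v in sigma_lambda lam. (\<lambda>k. G (of_real x + of_real (eps k) * v) * of_real (pole_mass lam 1 v))
       \<longlonglongrightarrow> G (of_real x) * of_real (pole_mass lam 1 v)"
    proof (intro AE_I2 tendsto_mult tendsto_const)
      fix v :: complex
      have "(\<lambda>k. of_real x + of_real (eps k) * v) \<longlonglongrightarrow> of_real x + of_real 0 * v"
        by (intro tendsto_intros e0)
      hence "(\<lambda>k. of_real x + of_real (eps k) * v) \<longlonglongrightarrow> of_real x" by simp
      moreover have "isCont G (of_real x)" using Gc by (simp add: continuous_on_eq_continuous_at)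
      ultimately show "(\<lambda>k. G (of_real x + of_real (eps k) * v)) \<longlonglongrightarrow> G (of_real x)"
        by (rule isCont_tendsto_compose[rotated])
    qed
    show "AE v in sigma_lambda lam. norm (G (of_real x + of_real (eps k) * v) * of_real (pole_mass lam 1 v))
       \<le> M * pole_mass lam 1 v" for k
      using M pole_mass_le(1)[OF lam, of 1] by (intro AE_I2) (auto simp: norm_mult intro!: mult_right_mono)
  qed auto
  have "(\<integral>w. A 0 w \<partial>sigma_lambda lam) = - (\<integral>v. G (of_real x) * of_real (pole_mass lam 1 v) \<partial>sigma_lambda lam)"
    using LIMSEQ_unique[OF lim1] tendsto_minus[OF lim2] by (simp add: split[OF epos])
  also have "\<dots> = - (G (of_real x) * of_real (pole_constant lam))"
    by (simp add: pole_constant_def)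
  finally have main: "of_real (pole_constant lam) * G (of_real x) = - (\<integral>w. A 0 w \<partial>sigma_lambda lam)"
    by simp
  have "A 0 w = f w * (reg_kernel lam 0 x w * (2 * (w - of_real c) * of_real (h' ((norm (w - of_real c))\<^sup>2))))" for w
    using F_eq[of w] hnz[of w] rR by (cases "norm w < R") (auto simp: A_def n_def)
  moreover have "G (of_real x) = f (of_real x) * of_real (h ((x - c)\<^sup>2))"
  proof (cases "\<bar>x\<bar> < R")
    case True
    have "n (of_real x) = (x - c)\<^sup>2" unfolding n_def by (simp flip: of_real_diff)
    thus ?thesis using True F_eq[of "of_real x"] by (simp add: G_def)
  next
    case False
    have nx: "n (of_real x) = (x - c)\<^sup>2" unfolding n_def by (simp flip: of_real_diff)
    have "h ((x - c)\<^sup>2) = 0" using hnz(1)[of "of_real x"] False rR by (simp add: nx)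
    thus ?thesis by (simp add: G_def nx)
  qed
  ultimately show ?thesis using main by (simp add: mult_ac)
qed


section \<open>From holomorphic to Dunkl-holomorphic functions\<close>

lemma norm_integral_le:
  fixes f :: "'w \<Rightarrow> 'b::{banach, second_countable_topology}"
  assumes "integrable M f" "integrable M g" "\<And>x. x \<in> space M \<Longrightarrow> norm (f x) \<le> g x"
  shows "norm (\<integral>x. f x \<partial>M) \<le> (\<integral>x. g x \<partial>M)"
  by (rule order_trans[OF integral_norm_bound integral_mono]) (use assms in auto)

text \<open>
  Dominated convergence for the remainders of the difference quotients, along sequences that tend to \<open>z0\<close>.
\<close>

lemma has_derivative_integral_param:
  fixes G :: "'a::real_normed_vector \<Rightarrow> 'w \<Rightarrow> 'b::{banach, second_countable_topology}"
  assumes U: "open U" "z0 \<in> U"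
    and der: "\<And>w. w \<in> space M \<Longrightarrow> ((\<lambda>z. G z w) has_derivative G' w) (at z0)"
    and int: "\<And>z. z \<in> U \<Longrightarrow> integrable M (G z)" and int': "\<And>h. integrable M (\<lambda>w. G' w h)"
    and lip: "\<And>z w. z \<in> U \<Longrightarrow> w \<in> space M \<Longrightarrow> norm (G z w - G z0 w) \<le> B w * norm (z - z0)"
    and bd: "\<And>h w. w \<in> space M \<Longrightarrow> norm (G' w h) \<le> B w * norm h"
    and B: "integrable M B"
  shows "((\<lambda>z. \<integral>w. G z w \<partial>M) has_derivative (\<lambda>h. \<integral>w. G' w h \<partial>M)) (at z0)"
  unfolding has_derivative_at
proof
  have lin: "linear (G' w)" if "w \<in> space M" for w
    using has_derivative_linear[OF der[OF that]] .
  show "bounded_linear (\<lambda>h. \<integral>w. G' w h \<partial>M)"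
  proof (rule bounded_linear_intro)
    fix h k
    have "(\<integral>w. G' w (h + k) \<partial>M) = (\<integral>w. G' w h + G' w k \<partial>M)"
      by (rule Bochner_Integration.integral_cong) (simp_all add: lin linear_add)
    thus "(\<integral>w. G' w (h + k) \<partial>M) = (\<integral>w. G' w h \<partial>M) + (\<integral>w. G' w k \<partial>M)"
      using int' by simp
  next
    fix r h
    have "(\<integral>w. G' w (r *\<^sub>R h) \<partial>M) = (\<integral>w. r *\<^sub>R G' w h \<partial>M)"
      by (rule Bochner_Integration.integral_cong) (simp_all add: lin linear_scale)
    thus "(\<integral>w. G' w (r *\<^sub>R h) \<partial>M) = r *\<^sub>R (\<integral>w. G' w h \<partial>M)" by simp
  next
    fix h
    have "norm (\<integral>w. G' w h \<partial>M) \<le> (\<integral>w. B w * norm h \<partial>M)"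
      using bd by (intro norm_integral_le int' integrable_mult_left B) auto
    thus "norm (\<integral>w. G' w h \<partial>M) \<le> norm h * (\<integral>w. B w \<partial>M)" by (simp add: mult.commute)
  qed
  show "(\<lambda>h. norm ((\<integral>w. G (z0 + h) w \<partial>M) - (\<integral>w. G z0 w \<partial>M) - (\<integral>w. G' w h \<partial>M)) / norm h) \<midarrow>0\<rightarrow> 0"
    unfolding tendsto_at_iff_sequentially
  proof (intro allI impI)
    fix X :: "nat \<Rightarrow> 'a" assume X0: "\<forall>i. X i \<in> UNIV - {0}" and X: "X \<longlonglongrightarrow> 0"
    have "eventually (\<lambda>h. z0 + h \<in> U) (nhds 0)"
    proof -
      have "open ((\<lambda>h. z0 + h) -` U)" by (intro open_vimage U continuous_intros)
      thus ?thesis unfolding eventually_nhds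
        using U(2) by (intro exI[of _ "(\<lambda>h. z0 + h) -` U"]) simp
    qed
    hence "eventually (\<lambda>i. z0 + X i \<in> U) sequentially" using X by (rule eventually_compose_filterlim)
    then obtain N where N: "\<And>i. i \<ge> N \<Longrightarrow> z0 + X i \<in> U" by (auto simp: eventually_sequentially)
    define Y where "Y = (\<lambda>i. X (i + N))"
    have Y0: "Y i \<noteq> 0" and YU: "z0 + Y i \<in> U" for i using X0 N by (auto simp: Y_def)
    have Y: "Y \<longlonglongrightarrow> 0" unfolding Y_def by (rule LIMSEQ_ignore_initial_segment[OF X])
    define Q where "Q = (\<lambda>i w. (1 / norm (Y i)) *\<^sub>R (G (z0 + Y i) w - G z0 w - G' w (Y i)))"
    have Qi: "integrable M (Q i)" for i
      unfolding Q_def by (intro integrable_scaleR_right Bochner_Integration.integrable_diff int int' YU U(2))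
    have "(\<lambda>i. \<integral>w. Q i w \<partial>M) \<longlonglongrightarrow> (\<integral>w. 0 \<partial>M)"
    proof (rule integral_dominated_convergence[where w = "\<lambda>w. 2 * B w"])
      show "AE w in M. (\<lambda>i. Q i w) \<longlonglongrightarrow> 0"
      proof (rule AE_I2)
        fix w assume w: "w \<in> space M"
        have "((\<lambda>h. norm (G (z0 + h) w - G z0 w - G' w h) / norm h) \<longlongrightarrow> 0) (at 0)"
          using der[OF w] unfolding has_derivative_at by blast
        hence "(\<lambda>i. norm (G (z0 + Y i) w - G z0 w - G' w (Y i)) / norm (Y i)) \<longlonglongrightarrow> 0"
          using Y Y0 unfolding tendsto_at_iff_sequentially by (auto simp: o_def)
        hence "(\<lambda>i. norm (Q i w)) \<longlonglongrightarrow> 0" by (simp add: Q_def)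
        thus "(\<lambda>i. Q i w) \<longlonglongrightarrow> 0" by (rule tendsto_norm_zero_cancel)
      qed
      show "AE w in M. norm (Q i w) \<le> 2 * B w" for i
      proof (rule AE_I2)
        fix w assume w: "w \<in> space M"
        have "norm (G (z0 + Y i) w - G z0 w - G' w (Y i)) \<le> B w * norm (Y i) + B w * norm (Y i)"
          using lip[OF YU w, of i] bd[OF w, of "Y i"] by (intro order_trans[OF norm_triangle_ineq4]) auto
        hence "norm (G (z0 + Y i) w - G z0 w - G' w (Y i)) / norm (Y i) \<le> (2 * B w * norm (Y i)) / norm (Y i)"
          by (intro divide_right_mono) auto
        thus "norm (Q i w) \<le> 2 * B w" unfolding Q_def norm_scaleR using Y0[of i] by simp
      qed
      show "Q i \<in> borel_measurable M" for i using Qi by auto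
    qed (use B in auto)
    hence "(\<lambda>i. norm (\<integral>w. Q i w \<partial>M)) \<longlonglongrightarrow> 0" by (simp add: tendsto_norm_zero)
    moreover have "norm (\<integral>w. Q i w \<partial>M)
        = norm ((\<integral>w. G (z0 + Y i) w \<partial>M) - (\<integral>w. G z0 w \<partial>M) - (\<integral>w. G' w (Y i) \<partial>M)) / norm (Y i)" for i
      unfolding Q_def using int[OF YU] int[OF U(2)] int' by simp
    ultimately have "(\<lambda>i. norm ((\<integral>w. G (z0 + X (i + N)) w \<partial>M) - (\<integral>w. G z0 w \<partial>M) - (\<integral>w. G' w (X (i + N)) \<partial>M)) / norm (X (i + N))) \<longlonglongrightarrow> 0"
      by (simp add: Y_def)
    thus "((\<lambda>h. norm ((\<integral>w. G (z0 + h) w \<partial>M) - (\<integral>w. G z0 w \<partial>M) - (\<integral>w. G' w h \<partial>M)) / norm h) \<circ> X) \<longlonglongrightarrow> 0"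
      unfolding o_def by (rule LIMSEQ_offset[of _ N])
  qed
qed

definition beta_density :: "real \<Rightarrow> real \<Rightarrow> real" where
  "beta_density lam s = s powr lam * (1 - s) powr (lam - 1) / Beta (lam + 1) lam"

text \<open>
  The measure lives on the space \<open>{0..1}\<close>, so statements about its points need no exceptional sets. As
  \<open>\<lambda>\<close> tends to zero the Beta distribution with parameters \<open>\<lambda> + 1\<close> and \<open>\<lambda>\<close> tends to the point mass at
  \<open>1\<close>, which is therefore the measure for \<open>\<lambda> = 0\<close>.
\<close>

definition beta_measure :: "real \<Rightarrow> real measure" where
  "beta_measure lam = (if lam = 0 then distr (count_space {()}) (restrict_space borel {0..1}) (\<lambda>_. 1)
     else density (restrict_space lborel {0..1}) (\<lambda>s. ennreal (beta_density lam s)))"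

lemma space_beta_measure [simp]: "space (beta_measure lam) = {0..1}"
  by (simp add: beta_measure_def space_restrict_space)

lemma sets_beta_measure [measurable_cong]: "sets (beta_measure lam) = sets (restrict_space borel {0..1})"
  by (simp add: beta_measure_def sets_restrict_space)

lemma Beta_real_pos: "0 < a \<Longrightarrow> 0 < b \<Longrightarrow> 0 < Beta a (b::real)"
  unfolding Beta_def by (intro divide_pos_pos mult_pos_pos Gamma_real_pos) auto

lemma beta_density_nonneg: "0 < lam \<Longrightarrow> 0 \<le> beta_density lam s"
  unfolding beta_density_def using Beta_real_pos[of "lam + 1" lam] by simp

lemma beta_density_measurable [measurable]: "beta_density lam \<in> borel_measurable borel"
  unfolding beta_density_def by measurable

lemma beta_density_nn_integral:
  assumes "0 < lam"
  shows "(\<integral>\<^sup>+s. ennreal (indicat_real {0..1} s * beta_density lam s) \<partial>lborel) = 1"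
proof -
  have "((\<lambda>s. s powr (lam + 1 - 1) * (1 - s) powr (lam - 1)) has_integral Beta (lam + 1) lam) {0..1}"
    by (rule has_integral_Beta_real) (use assms in auto)
  from has_integral_divide[OF this, of "Beta (lam + 1) lam"]
  have "(beta_density lam has_integral 1) {0..1}"
    using Beta_real_pos[of "lam + 1" lam] assms by (simp add: beta_density_def[abs_def])
  from nn_integral_has_integral_lebesgue[OF beta_density_nonneg[OF assms] this]
  show ?thesis by simp
qed

lemma prob_space_beta_measure:
  assumes "0 \<le> lam" shows "emeasure (beta_measure lam) {0..1} = 1"
proof (cases "lam = 0")
  case True
  have "(\<lambda>_::unit. 1::real) -` {0..1} \<inter> {()} = {()}" by auto
  thus ?thesis using True
    by (simp add: beta_measure_def emeasure_distr sets_restrict_space_iff measurable_count_space_eq1 space_restrict_space)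
next
  case False
  hence lam: "0 < lam" using assms by simp
  have "emeasure (beta_measure lam) {0..1}
     = (\<integral>\<^sup>+s. ennreal (beta_density lam s) * indicator {0..1} s \<partial>restrict_space lborel {0..1})"
    using False by (simp add: beta_measure_def emeasure_density sets_restrict_space_iff measurable_restrict_space1)
  also have "\<dots> = (\<integral>\<^sup>+s. ennreal (indicat_real {0..1} s * beta_density lam s) \<partial>lborel)"
    by (subst nn_integral_restrict_space) (auto intro!: nn_integral_cong simp: indicator_def)
  finally show ?thesis using beta_density_nn_integral[OF lam] by simp
qed

lemma finite_measure_beta: "0 \<le> lam \<Longrightarrow> finite_measure (beta_measure lam)"
  using prob_space_beta_measure by (intro finite_measureI) simp

lemma measure_beta: "0 \<le> lam \<Longrightarrow> measure (beta_measure lam) {0..1} = 1"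
  using prob_space_beta_measure by (simp add: measure_def)

lemma continuous_integrable_beta:
  fixes f :: "real \<Rightarrow> 'b::{banach, second_countable_topology}"
  assumes "0 \<le> lam" "continuous_on {0..1} f"
  shows "integrable (beta_measure lam) f"
proof -
  interpret finite_measure "beta_measure lam" by (rule finite_measure_beta[OF assms(1)])
  obtain B where "\<And>s. s \<in> {0..1} \<Longrightarrow> norm (f s) \<le> B"
    using continuous_on_compact_bound[OF compact_Icc assms(2)] by blast
  hence "AE s in beta_measure lam. norm (f s) \<le> B" by (intro AE_I2) simp
  moreover have "f \<in> borel_measurable (beta_measure lam)"
    using borel_measurable_continuous_on_restrict[OF assms(2)]
    by (simp cong: measurable_cong_sets add: sets_beta_measure measurable_cong_sets[OF sets_beta_measure refl])
  ultimately show ?thesis by (rule integrable_const_bound)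
qed

lemma integral_beta_measure:
  fixes f :: "real \<Rightarrow> complex"
  assumes lam: "0 < lam" and f: "continuous_on {0..1} f"
  shows "integrable lborel (\<lambda>s. (indicat_real {0..1} s * beta_density lam s) *\<^sub>R f s)"
    and "(\<integral>s. f s \<partial>beta_measure lam) = (\<integral>s. (indicat_real {0..1} s * beta_density lam s) *\<^sub>R f s \<partial>lborel)"
proof -
  have fm: "f \<in> borel_measurable (restrict_space lborel {0..1})"
    using borel_measurable_continuous_on_restrict[OF f]
    by (simp add: measurable_cong_sets[OF sets_restrict_space_cong[OF sets_lborel] refl])
  have bm: "beta_density lam \<in> borel_measurable (restrict_space lborel {0..1})"
    by (rule measurable_restrict_space1) simp
  have e: "beta_measure lam = density (restrict_space lborel {0..1}) (\<lambda>s. ennreal (beta_density lam s))"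
    using lam by (simp add: beta_measure_def)
  have "integrable (beta_measure lam) f" by (rule continuous_integrable_beta[OF _ f]) (use lam in simp)
  hence "integrable (restrict_space lborel {0..1}) (\<lambda>s. beta_density lam s *\<^sub>R f s)"
    unfolding e by (subst (asm) integrable_density) (use fm bm beta_density_nonneg[OF lam] in auto)
  thus "integrable lborel (\<lambda>s. (indicat_real {0..1} s * beta_density lam s) *\<^sub>R f s)"
    by (subst (asm) integrable_restrict_space) (auto simp: set_integrable_def)
  have "(\<integral>s. f s \<partial>beta_measure lam) = (\<integral>s. beta_density lam s *\<^sub>R f s \<partial>restrict_space lborel {0..1})"
    unfolding e by (subst integral_density) (use fm bm beta_density_nonneg[OF lam] in auto)
  also have "\<dots> = (\<integral>s. (indicat_real {0..1} s * beta_density lam s) *\<^sub>R f s \<partial>lborel)"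
    by (subst integral_restrict_space) (auto simp: set_lebesgue_integral_def)
  finally show "(\<integral>s. f s \<partial>beta_measure lam) = (\<integral>s. (indicat_real {0..1} s * beta_density lam s) *\<^sub>R f s \<partial>lborel)" .
qed

text \<open>
  Integration by parts with \<open>s\<^sup>\<lambda> (1 - s)\<^sup>\<lambda>\<close>, which is \<open>1 - s\<close> times the density up to a constant. Its
  derivative is a multiple of the difference between the reflected density and the density; the
  reflection \<open>s \<mapsto> 1 - s\<close> is complex conjugation on the segments below. This identity is what turns
  holomorphic functions into solutions of the Dunkl equation.
\<close>

lemma beta_measure_by_parts:
  fixes h h' :: "real \<Rightarrow> complex"
  assumes lam: "0 \<le> lam" and h: "\<And>s. s \<in> {0..1} \<Longrightarrow> (h has_vector_derivative h' s) (at s within {0..1})"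
    and h': "continuous_on {0..1} h'"
  shows "(\<integral>s. of_real (1 - s) * h' s \<partial>beta_measure lam) = of_real lam * (\<integral>s. h s - h (1 - s) \<partial>beta_measure lam)"
proof (cases "lam = 0")
  case True
  have "(\<lambda>s. of_real (1 - s) * h' s) \<in> borel_measurable (restrict_space borel {0..1})"
    by (rule borel_measurable_continuous_on_restrict) (intro continuous_intros h')
  thus ?thesis using True
    by (simp add: beta_measure_def integral_distr measurable_count_space_eq1 space_restrict_space lebesgue_integral_count_space_finite)
next
  case False
  hence l: "0 < lam" using lam by simp
  have hc: "continuous_on {0..1} h" by (rule continuous_on_vector_derivative[OF h])
  have hr: "continuous_on {0..1} (\<lambda>s. h (1 - s))"
    by (rule continuous_on_compose2[OF hc]) (auto intro: continuous_intros)
  define b where "b = (\<lambda>s. indicat_real {0..1} s * beta_density lam s)"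
  define K where "K = Beta (lam + 1) lam"
  have K: "K > 0" unfolding K_def by (rule Beta_real_pos) (use l in auto)
  define W where "W = (\<lambda>s::real. s powr lam * (1 - s) powr lam / K)"
  have i1: "integrable lborel (\<lambda>s. b s *\<^sub>R (of_real (1 - s) * h' s))"
    unfolding b_def by (intro integral_beta_measure(1)[OF l] continuous_intros h')
  have i2: "integrable lborel (\<lambda>s. b s *\<^sub>R h s)"
    unfolding b_def by (rule integral_beta_measure(1)[OF l hc])
  have i3: "integrable lborel (\<lambda>s. b s *\<^sub>R h (1 - s))"
    unfolding b_def by (rule integral_beta_measure(1)[OF l hr])
  have i3': "integrable lborel (\<lambda>s. b (1 - s) *\<^sub>R h s)"
    using lborel_integrable_real_affine[OF i3, of "-1" 1] by simp
  have e3: "(\<integral>s. b (1 - s) *\<^sub>R h s \<partial>lborel) = (\<integral>s. b s *\<^sub>R h (1 - s) \<partial>lborel)"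
    by (subst lborel_integral_real_affine[where c = "-1" and t = 1]) auto
  define D where "D = (\<lambda>s. b s *\<^sub>R (of_real (1 - s) * h' s) + of_real lam * (b (1 - s) *\<^sub>R h s - b s *\<^sub>R h s))"
  have Di: "integrable lborel D"
    unfolding D_def using i1 i2 i3' by (intro Bochner_Integration.integrable_add integrable_mult_right Bochner_Integration.integrable_diff)
  have "(D has_integral (of_real (W 1) * h 1 - of_real (W 0) * h 0)) {0..1}"
  proof (rule fundamental_theorem_of_calculus_interior)
    show "continuous_on {0..1} (\<lambda>s. of_real (W s) * h s)"
      unfolding W_def using l K
      by (intro continuous_intros hc continuous_on_powr') auto
    fix s :: real assume s: "s \<in> {0<..<1}"
    have hd: "(h has_vector_derivative h' s) (at s)"
      using h[of s] s by (auto simp: at_within_Icc_at)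
    have "(W has_real_derivative (lam * s powr (lam - 1) * (1 - s) powr lam - s powr lam * (lam * (1 - s) powr (lam - 1))) / K) (at s)"
      unfolding W_def using s K
      by (auto intro!: derivative_eq_intros)
    hence Wd: "((\<lambda>s. complex_of_real (W s)) has_vector_derivative of_real ((lam * s powr (lam - 1) * (1 - s) powr lam - s powr lam * (lam * (1 - s) powr (lam - 1))) / K)) (at s)"
      by (intro has_vector_derivative_of_real) (simp add: has_real_derivative_iff_has_vector_derivative)
    have WE: "W s = b s * (1 - s)"
      using s by (simp add: W_def b_def beta_density_def K_def powr_diff)
    have XE: "(lam * s powr (lam - 1) * (1 - s) powr lam - s powr lam * (lam * (1 - s) powr (lam - 1))) / K
       = lam * (b (1 - s) - b s)"
      using s by (simp add: b_def beta_density_def K_def algebra_simps diff_divide_distrib)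
    have "((\<lambda>s. of_real (W s) * h s) has_vector_derivative
       (of_real (W s) * h' s + of_real ((lam * s powr (lam - 1) * (1 - s) powr lam - s powr lam * (lam * (1 - s) powr (lam - 1))) / K) * h s)) (at s)"
      by (rule has_vector_derivative_mult[OF Wd hd])
    moreover have "of_real (W s) * h' s + of_real ((lam * s powr (lam - 1) * (1 - s) powr lam - s powr lam * (lam * (1 - s) powr (lam - 1))) / K) * h s = D s"
      unfolding WE XE D_def by (simp add: scaleR_conv_of_real algebra_simps)
    ultimately show "((\<lambda>s. of_real (W s) * h s) has_vector_derivative D s) (at s)" by simp
  qed auto
  hence z: "(D has_integral 0) {0..1}" using l by (simp add: W_def)
  have "(\<integral>s. D s \<partial>lborel) = (LINT s:{0..1}|lborel. D s)"
    unfolding set_lebesgue_integral_def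
    by (rule Bochner_Integration.integral_cong) (auto simp: D_def b_def indicator_def)
  also have "\<dots> = integral {0..1} D"
    by (rule set_borel_integral_eq_integral) (use Di in \<open>auto simp: set_integrable_def intro: integrable_mult_indicator\<close>)
  also have "\<dots> = 0" using z by (rule integral_unique)
  finally have D0: "(\<integral>s. D s \<partial>lborel) = 0" .
  have "(\<integral>s. D s \<partial>lborel) = (\<integral>s. b s *\<^sub>R (of_real (1 - s) * h' s) \<partial>lborel)
      + of_real lam * ((\<integral>s. b (1 - s) *\<^sub>R h s \<partial>lborel) - (\<integral>s. b s *\<^sub>R h s \<partial>lborel))"
    unfolding D_def
    by (simp only: Bochner_Integration.integral_add[OF i1 integrable_mult_right[OF Bochner_Integration.integrable_diff[OF i3' i2]]]
        integral_mult_right_zero Bochner_Integration.integral_diff[OF i3' i2])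
  moreover have "a = l * (b - c)" if "a + l * (c - b) = 0" for a l b c :: complex
  proof -
    have "a - l * (b - c) = a + l * (c - b)" by (simp add: algebra_simps)
    thus ?thesis using that by simp
  qed
  ultimately have "(\<integral>s. b s *\<^sub>R (of_real (1 - s) * h' s) \<partial>lborel)
      = of_real lam * ((\<integral>s. b s *\<^sub>R h s \<partial>lborel) - (\<integral>s. b (1 - s) *\<^sub>R h s \<partial>lborel))"
    using D0 by simp
  also have "\<dots> = of_real lam * (\<integral>s. b s *\<^sub>R (h s - h (1 - s)) \<partial>lborel)"
    unfolding e3 using i2 i3 by (simp add: scaleR_diff_right)
  finally show ?thesis
    using integral_beta_measure(2)[OF l, of "\<lambda>s. of_real (1 - s) * h' s"]
      integral_beta_measure(2)[OF l, of "\<lambda>s. h s - h (1 - s)"]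
    by (simp add: b_def hc hr h' continuous_on_diff continuous_on_mult continuous_on_of_real continuous_on_id)
qed


text \<open>
  The intertwining operator averages a holomorphic function over the vertical segment that \<open>seg\<close>
  parametrises from \<open>cnj z\<close> to \<open>z\<close>. The additional weight \<open>m\<close> in \<open>wavg\<close> makes the class of averages closed
  under partial derivatives.
\<close>

definition seg :: "real \<Rightarrow> complex \<Rightarrow> complex" where
  "seg s z = Complex (Re z) ((2 * s - 1) * Im z)"

definition wavg :: "real \<Rightarrow> (real \<Rightarrow> complex) \<Rightarrow> (complex \<Rightarrow> complex) \<Rightarrow> complex \<Rightarrow> complex" where
  "wavg lam m g z = (\<integral>s. m s * g (seg s z) \<partial>beta_measure lam)"

definition intertwine :: "real \<Rightarrow> (complex \<Rightarrow> complex) \<Rightarrow> complex \<Rightarrow> complex" where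
  "intertwine lam g = wavg lam (\<lambda>_. 1) g"

lemma seg_eq: "seg s z = of_real (Re z) + \<i> * of_real ((2 * s - 1) * Im z)"
  by (simp add: seg_def complex_eq_iff)

lemma norm_seg_le: "s \<in> {0..1} \<Longrightarrow> norm (seg s z) \<le> norm z"
proof -
  assume "s \<in> {0..1}"
  hence "\<bar>(2 * s - 1) * Im z\<bar> \<le> 1 * \<bar>Im z\<bar>" unfolding abs_mult by (intro mult_right_mono) auto
  hence "((2 * s - 1) * Im z)\<^sup>2 \<le> (Im z)\<^sup>2" by (simp add: abs_le_square_iff)
  thus ?thesis by (simp add: seg_def cmod_def)
qed

lemma seg_cnj: "seg s (cnj z) = seg (1 - s) z"
  by (simp add: seg_def complex_eq_iff algebra_simps)

lemma seg_diff: "seg s z - seg s w = seg s (z - w)"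
  by (simp add: seg_def complex_eq_iff algebra_simps)

lemma continuous_seg: "continuous_on S (\<lambda>s. seg s z)" "continuous_on S (seg s)"
  unfolding seg_eq by (intro continuous_intros)+

lemma seg_real: "seg s (of_real x) = of_real x"
  by (simp add: seg_def complex_eq_iff)

lemma wavg_integrable:
  fixes m :: "real \<Rightarrow> complex" and g :: "complex \<Rightarrow> complex"
  assumes "0 \<le> lam" "continuous_on {0..1} m" "continuous_on (ball 0 r) g" "z \<in> ball 0 r"
  shows "integrable (beta_measure lam) (\<lambda>s. m s * g (seg s z))"
proof (rule continuous_integrable_beta[OF assms(1)])
  have "continuous_on {0..1} (\<lambda>s. g (seg s z))"
    by (rule continuous_on_compose2[OF assms(3) continuous_seg(1)])
      (use assms(4) norm_seg_le[of _ z] in \<open>fastforce simp: subset_iff\<close>)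
  thus "continuous_on {0..1} (\<lambda>s. m s * g (seg s z))" by (intro continuous_intros assms(2))
qed

lemma wavg_has_derivative:
  assumes lam: "0 \<le> lam" and m: "continuous_on {0..1} m" and g: "g holomorphic_on ball 0 r" and z: "z0 \<in> ball 0 r"
  shows "(wavg lam m g has_derivative (real_linear (wavg lam m (deriv g) z0)
      (wavg lam (\<lambda>s. m s * (\<i> * of_real (2 * s - 1))) (deriv g) z0))) (at z0)"
proof -
  define r' where "r' = (norm z0 + r) / 2"
  have r': "norm z0 < r'" "r' < r" using z by (auto simp: r'_def)
  have g': "deriv g holomorphic_on ball 0 r" by (rule holomorphic_deriv[OF g]) simp
  have gc: "continuous_on (ball 0 r) g" and g'c: "continuous_on (ball 0 r) (deriv g)"
    using g g' by (auto intro: holomorphic_on_imp_continuous_on)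
  have "continuous_on (cball 0 r') (deriv g)" by (rule continuous_on_subset[OF g'c]) (use r' in auto)
  then obtain L where L0: "0 \<le> L" and "\<And>w. w \<in> cball 0 r' \<Longrightarrow> norm (deriv g w) \<le> L"
    using continuous_on_compact_bound[OF compact_cball] by blast
  hence L: "norm (deriv g w) \<le> L" if "norm w \<le> r'" for w using that by simp
  obtain K where K0: "0 \<le> K" and K: "\<And>s. s \<in> {0..1} \<Longrightarrow> norm (m s) \<le> K"
    using continuous_on_compact_bound[OF compact_Icc m] by blast
  have gl: "norm (g u - g v) \<le> L * norm (u - v)" if "norm u \<le> r'" "norm v \<le> r'" for u v
  proof (rule field_differentiable_bound[of "cball 0 r'" g "deriv g"])
    show "(g has_field_derivative deriv g w) (at w within cball 0 r')" if "w \<in> cball 0 r'" for w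
      by (rule has_field_derivative_at_within, rule holomorphic_derivI[OF g]) (use that r' in auto)
  qed (use L that in auto)
  have der: "((\<lambda>z. m s * g (seg s z)) has_derivative (\<lambda>h. m s * (seg s h * deriv g (seg s z0)))) (at z0)" if s: "s \<in> {0..1}" for s
  proof -
    have "(g has_derivative (\<lambda>h. h * deriv g (seg s z0))) (at (seg s z0))"
    proof -
      have "(g has_field_derivative deriv g (seg s z0)) (at (seg s z0))"
        by (rule holomorphic_derivI[OF g]) (use norm_seg_le[OF s, of z0] z in auto)
      thus ?thesis unfolding has_field_derivative_def
        by (rule has_derivative_eq_rhs) (auto simp: fun_eq_iff mult.commute)
    qed
    moreover have "(seg s has_derivative seg s) (at z0)"
      unfolding seg_eq[abs_def] by (auto intro!: derivative_eq_intros)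
    ultimately have "((\<lambda>z. g (seg s z)) has_derivative (\<lambda>h. seg s h * deriv g (seg s z0))) (at z0)"
      using has_derivative_compose by blast
    thus ?thesis by (rule has_derivative_mult_right)
  qed
  have w1: "integrable (beta_measure lam) (\<lambda>s. m s * deriv g (seg s z0))"
    by (rule wavg_integrable[OF lam m g'c z])
  have w2: "integrable (beta_measure lam) (\<lambda>s. m s * (\<i> * of_real (2 * s - 1)) * deriv g (seg s z0))"
    by (rule wavg_integrable[OF lam _ g'c z]) (intro continuous_intros m)
  have eq: "m s * (seg s h * deriv g (seg s z0)) = of_real (Re h) * (m s * deriv g (seg s z0))
     + of_real (Im h) * (m s * (\<i> * of_real (2 * s - 1)) * deriv g (seg s z0))" for s h
    by (simp add: seg_eq algebra_simps)
  have "((\<lambda>z. \<integral>s. m s * g (seg s z) \<partial>beta_measure lam) has_derivative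
      (\<lambda>h. \<integral>s. m s * (seg s h * deriv g (seg s z0)) \<partial>beta_measure lam)) (at z0)"
  proof (rule has_derivative_integral_param[where U = "ball 0 r'" and B = "\<lambda>_. K * L"])
    interpret finite_measure "beta_measure lam" by (rule finite_measure_beta[OF lam])
    show "integrable (beta_measure lam) (\<lambda>_. K * L)" by simp
    show "integrable (beta_measure lam) (\<lambda>s. m s * g (seg s z))" if "z \<in> ball 0 r'" for z
      by (rule wavg_integrable[OF lam m gc]) (use that r' in auto)
    show "integrable (beta_measure lam) (\<lambda>s. m s * (seg s h * deriv g (seg s z0)))" for h
      unfolding eq by (intro Bochner_Integration.integrable_add integrable_mult_right w1 w2)
    fix s assume "s \<in> space (beta_measure lam)"
    hence s: "s \<in> {0..1}" by simp
    show "((\<lambda>z. m s * g (seg s z)) has_derivative (\<lambda>h. m s * (seg s h * deriv g (seg s z0)))) (at z0)"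
      by (rule der[OF s])
    show "norm (m s * (seg s h * deriv g (seg s z0))) \<le> K * L * norm h" for h
    proof -
      have "norm (deriv g (seg s z0)) \<le> L" by (rule L) (use norm_seg_le[OF s, of z0] r' in linarith)
      hence "norm (m s) * (norm (seg s h) * norm (deriv g (seg s z0))) \<le> K * (norm h * L)"
        using K[OF s] norm_seg_le[OF s, of h] K0 L0 by (intro mult_mono) auto
      thus ?thesis by (simp add: norm_mult mult_ac)
    qed
    show "norm (m s * g (seg s z) - m s * g (seg s z0)) \<le> K * L * norm (z - z0)" if "z \<in> ball 0 r'" for z
    proof -
      have "norm (g (seg s z) - g (seg s z0)) \<le> L * norm (seg s z - seg s z0)"
        using norm_seg_le[OF s, of z] norm_seg_le[OF s, of z0] that r' by (intro gl) auto
      also have "\<dots> \<le> L * norm (z - z0)"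
        unfolding seg_diff by (intro mult_left_mono norm_seg_le[OF s] L0)
      finally have "norm (m s) * norm (g (seg s z) - g (seg s z0)) \<le> K * (L * norm (z - z0))"
        using K[OF s] K0 by (intro mult_mono) auto
      thus ?thesis by (simp add: norm_mult mult_ac flip: right_diff_distrib)
    qed
  qed (use r' in auto)
  moreover have "(\<lambda>h. \<integral>s. m s * (seg s h * deriv g (seg s z0)) \<partial>beta_measure lam)
    = (real_linear (wavg lam m (deriv g) z0)
      (wavg lam (\<lambda>s. m s * (\<i> * of_real (2 * s - 1))) (deriv g) z0))"
    unfolding eq wavg_def using w1 w2 by (auto simp: fun_eq_iff)
  ultimately show ?thesis by (simp add: wavg_def[abs_def])
qed

lemma wavg_continuous_on:
  assumes "0 \<le> lam" "continuous_on {0..1} m" "g holomorphic_on ball 0 r"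
  shows "continuous_on (ball 0 r) (wavg lam m g)"
  by (intro continuous_at_imp_continuous_on ballI has_derivative_continuous[OF wavg_has_derivative[OF assms]])

lemma intertwine_real: "0 \<le> lam \<Longrightarrow> intertwine lam g (of_real x) = g (of_real x)"
  by (simp add: intertwine_def wavg_def seg_real measure_beta)

lemma intertwine_norm_le:
  assumes "0 \<le> lam" "continuous_on (ball 0 r) g" "z \<in> ball 0 r" "\<And>w. norm w \<le> norm z \<Longrightarrow> norm (g w) \<le> B"
  shows "norm (intertwine lam g z) \<le> B"
proof -
  interpret finite_measure "beta_measure lam" by (rule finite_measure_beta[OF assms(1)])
  have i: "integrable (beta_measure lam) (\<lambda>s. 1 * g (seg s z))"
    by (rule wavg_integrable[OF assms(1) _ assms(2,3)]) simp
  have "norm (intertwine lam g z) \<le> (\<integral>s. B \<partial>beta_measure lam)"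
    unfolding intertwine_def wavg_def
    by (rule norm_integral_le[OF i])
      (use assms(4) norm_seg_le[of _ z] in auto)
  thus ?thesis using measure_beta[OF assms(1)] by simp
qed

lemma intertwine_diff:
  assumes "0 \<le> lam" "continuous_on (ball 0 r) f" "continuous_on (ball 0 r) g" "z \<in> ball 0 r"
  shows "intertwine lam (\<lambda>w. f w - g w) z = intertwine lam f z - intertwine lam g z"
  using wavg_integrable[OF assms(1) continuous_on_const[of _ 1] assms(2,4)]
    wavg_integrable[OF assms(1) continuous_on_const[of _ 1] assms(3,4)]
  by (simp add: intertwine_def wavg_def)


text \<open>
  The real-linear map of \<open>real_linear\<close> as a bounded operator, with values in any normed space so that it
  can be iterated. Bounded linearity in the pair reduces \<open>C\<^sup>2\<close> to statements about partial derivatives.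
\<close>

definition rlin :: "'b::real_normed_vector \<times> 'b \<Rightarrow> complex \<Rightarrow>\<^sub>L 'b" where
  "rlin p = Blinfun (\<lambda>h. Re h *\<^sub>R fst p + Im h *\<^sub>R snd p)"

lemma rlin_apply: "blinfun_apply (rlin p) h = Re h *\<^sub>R fst p + Im h *\<^sub>R snd p"
proof -
  have "bounded_linear (\<lambda>h::complex. Re h *\<^sub>R fst p + Im h *\<^sub>R snd p)"
    by (intro bounded_linear_add bounded_linear_compose[OF bounded_linear_scaleR_left] bounded_linear_Re bounded_linear_Im)
  thus ?thesis unfolding rlin_def by (simp add: bounded_linear_Blinfun_apply)
qed

lemma bounded_linear_rlin: "bounded_linear rlin"
proof (rule bounded_linear_intro)
  fix p q :: "'a \<times> 'a"
  show "rlin (p + q) = rlin p + rlin q"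
    by (rule blinfun_eqI) (simp add: rlin_apply blinfun.bilinear_simps algebra_simps)
  show "rlin (r *\<^sub>R p) = r *\<^sub>R rlin p" for r
    by (rule blinfun_eqI) (simp add: rlin_apply blinfun.bilinear_simps algebra_simps)
  show "norm (rlin p) \<le> norm p * 2"
  proof (rule norm_blinfun_bound)
    fix h :: complex
    have "norm (rlin p h) \<le> \<bar>Re h\<bar> * norm (fst p) + \<bar>Im h\<bar> * norm (snd p)"
      unfolding rlin_apply by (rule order_trans[OF norm_triangle_ineq]) simp
    also have "\<dots> \<le> norm h * norm p + norm h * norm p"
      using abs_Re_le_cmod abs_Im_le_cmod norm_fst_le[of "fst p" "snd p"] norm_snd_le[of "snd p" "fst p"] by (intro add_mono mult_mono) auto
    finally show "norm (rlin p h) \<le> norm p * 2 * norm h" by (simp add: algebra_simps)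
  qed simp
qed

lemma C2_on_partials:
  fixes f fx fy :: "complex \<Rightarrow> complex"
  assumes "\<And>z. z \<in> S \<Longrightarrow> (f has_derivative (real_linear (fx z) (fy z))) (at z)"
    and "\<And>z. z \<in> S \<Longrightarrow> (fx has_derivative (real_linear (fxx z) (fxy z))) (at z)"
    and "\<And>z. z \<in> S \<Longrightarrow> (fy has_derivative (real_linear (fyx z) (fyy z))) (at z)"
    and "continuous_on S fxx" "continuous_on S fxy" "continuous_on S fyx" "continuous_on S fyy"
  shows "C2_on S f"
  unfolding C2_on_def
proof (intro exI conjI ballI)
  let ?F' = "\<lambda>z. rlin (fx z, fy z)"
  let ?F'' = "\<lambda>z. rlin (rlin (fxx z, fyx z), rlin (fxy z, fyy z))"
  show "(f has_derivative blinfun_apply (?F' z)) (at z)" if "z \<in> S" for z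
    using assms(1)[OF that] by (rule has_derivative_eq_rhs) (simp add: rlin_apply[abs_def] scaleR_conv_of_real fun_eq_iff)
  show "(?F' has_derivative blinfun_apply (?F'' z)) (at z)" if "z \<in> S" for z
  proof -
    have "((\<lambda>z. (fx z, fy z)) has_derivative (\<lambda>h. (of_real (Re h) * fxx z + of_real (Im h) * fxy z, of_real (Re h) * fyx z + of_real (Im h) * fyy z))) (at z)"
      by (intro has_derivative_Pair assms that)
    from bounded_linear.has_derivative[OF bounded_linear_rlin this]
    have "(?F' has_derivative (\<lambda>h. rlin (of_real (Re h) * fxx z + of_real (Im h) * fxy z, of_real (Re h) * fyx z + of_real (Im h) * fyy z))) (at z)" .
    moreover have "rlin (of_real (Re h) * fxx z + of_real (Im h) * fxy z, of_real (Re h) * fyx z + of_real (Im h) * fyy z) = ?F'' z h" for h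
      by (rule blinfun_eqI) (simp add: rlin_apply blinfun.bilinear_simps scaleR_conv_of_real algebra_simps)
    ultimately show ?thesis by simp
  qed
  show "continuous_on S ?F''"
    by (intro bounded_linear.continuous_on[OF bounded_linear_rlin] continuous_on_Pair assms)
qed

lemma partials_eq:
  assumes "(f has_derivative (real_linear a b)) (at z)"
  shows "partial_x f z = a" "partial_y f z = b"
proof -
  have "((\<lambda>t. z + complex_of_real t) has_derivative (\<lambda>h. of_real h)) (at 0)"
    by (auto intro!: derivative_eq_intros)
  from has_derivative_compose[OF this, of f] assms
  have "((\<lambda>t. f (z + complex_of_real t)) has_derivative (\<lambda>h. of_real h * a)) (at 0)"
    by fastforce
  thus "partial_x f z = a" unfolding partial_x_def
    by (intro vector_derivative_at) (simp add: has_vector_derivative_def scaleR_conv_of_real)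
  have "((\<lambda>t. z + \<i> * complex_of_real t) has_derivative (\<lambda>h. \<i> * of_real h)) (at 0)"
    by (auto intro!: derivative_eq_intros)
  from has_derivative_compose[OF this, of f] assms
  have "((\<lambda>t. f (z + \<i> * complex_of_real t)) has_derivative (\<lambda>h. of_real h * b)) (at 0)"
    by fastforce
  thus "partial_y f z = b" unfolding partial_y_def
    by (intro vector_derivative_at) (simp add: has_vector_derivative_def scaleR_conv_of_real)
qed

text \<open>
  Off the axis, integrate by parts along the segment with \<open>h(s) = g(seg s z)\<close>, whose derivative is
  \<open>2 \<i> y g'(seg s z)\<close>. On the axis the segment is a point and only the first moment of the Beta
  distribution enters, which is the case \<open>h(s) = s\<close>.
\<close>

lemma intertwine_Dunkl_equation:
  assumes lam: "0 \<le> lam" and g: "g holomorphic_on ball 0 r" and z: "z \<in> ball 0 r"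
  defines "fx \<equiv> wavg lam (\<lambda>_. 1) (deriv g)" and "fy \<equiv> wavg lam (\<lambda>s. 1 * (\<i> * of_real (2 * s - 1))) (deriv g)"
  shows "Im z \<noteq> 0 \<Longrightarrow> dunkl_E lam (intertwine lam g) fx fy z = 0"
    and "Im z = 0 \<Longrightarrow> fx z + \<i> * fy z + 2 * \<i> * of_real lam * fy z = 0"
proof -
  have g': "deriv g holomorphic_on ball 0 r" by (rule holomorphic_deriv[OF g]) simp
  have gc: "continuous_on (ball 0 r) g" and g'c: "continuous_on (ball 0 r) (deriv g)"
    using g g' by (auto intro: holomorphic_on_imp_continuous_on)
  have cz: "cnj z \<in> ball 0 r" using z by simp
  have i1: "integrable (beta_measure lam) (\<lambda>s. 1 * deriv g (seg s z))"
    by (rule wavg_integrable[OF lam _ g'c z]) simp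
  have i2: "integrable (beta_measure lam) (\<lambda>s. 1 * (\<i> * of_real (2 * s - 1)) * deriv g (seg s z))"
    by (rule wavg_integrable[OF lam _ g'c z]) (intro continuous_intros)
  have sum: "fx z + \<i> * fy z = 2 * (\<integral>s. of_real (1 - s) * deriv g (seg s z) \<partial>beta_measure lam)"
  proof -
    have "fx z + \<i> * fy z = (\<integral>s. 1 * deriv g (seg s z) + \<i> * (1 * (\<i> * of_real (2 * s - 1)) * deriv g (seg s z)) \<partial>beta_measure lam)"
      unfolding fx_def fy_def wavg_def using i1 i2 by (subst Bochner_Integration.integral_add) auto
    also have "\<dots> = (\<integral>s. 2 * (of_real (1 - s) * deriv g (seg s z)) \<partial>beta_measure lam)"
      by (rule Bochner_Integration.integral_cong) (auto simp: algebra_simps)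
    finally show ?thesis by simp
  qed
  {
    assume y: "Im z \<noteq> 0"
    have "(\<integral>s. of_real (1 - s) * (2 * \<i> * of_real (Im z) * deriv g (seg s z)) \<partial>beta_measure lam)
       = of_real lam * (\<integral>s. g (seg s z) - g (seg (1 - s) z) \<partial>beta_measure lam)"
    proof (rule beta_measure_by_parts[OF lam])
      fix s :: real assume s: "s \<in> {0..1}"
      have "((\<lambda>s. seg s z) has_vector_derivative (2 * \<i> * of_real (Im z))) (at s within {0..1})"
        unfolding seg_eq has_vector_derivative_def
        by (auto intro!: derivative_eq_intros simp: scaleR_conv_of_real algebra_simps)
      moreover have "(g has_field_derivative deriv g (seg s z)) (at (seg s z))"
        by (rule holomorphic_derivI[OF g]) (use norm_seg_le[OF s, of z] z in auto)
      hence "(g has_field_derivative deriv g (seg s z)) (at (seg s z) within (\<lambda>s. seg s z) ` {0..1})"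
        by (rule has_field_derivative_at_within)
      ultimately have "((g \<circ> (\<lambda>s. seg s z)) has_vector_derivative (2 * \<i> * of_real (Im z) * deriv g (seg s z))) (at s within {0..1})"
        by (rule field_vector_diff_chain_within)
      thus "((\<lambda>s. g (seg s z)) has_vector_derivative (2 * \<i> * of_real (Im z) * deriv g (seg s z))) (at s within {0..1})"
        by (simp add: o_def)
    next
      have "continuous_on {0..1} (\<lambda>s. deriv g (seg s z))"
        by (rule continuous_on_compose2[OF g'c continuous_seg(1)])
          (use z norm_seg_le[of _ z] in \<open>fastforce simp: subset_iff\<close>)
      thus "continuous_on {0..1} (\<lambda>s. 2 * \<i> * of_real (Im z) * deriv g (seg s z))"
        by (intro continuous_intros)
    qed
    moreover have "(\<integral>s. of_real (1 - s) * (2 * \<i> * of_real (Im z) * deriv g (seg s z)) \<partial>beta_measure lam)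
       = \<i> * of_real (Im z) * (fx z + \<i> * fy z)"
    proof -
      have "(\<integral>s. of_real (1 - s) * (2 * \<i> * of_real (Im z) * deriv g (seg s z)) \<partial>beta_measure lam)
        = (\<integral>s. (2 * \<i> * of_real (Im z)) * (of_real (1 - s) * deriv g (seg s z)) \<partial>beta_measure lam)"
        by (simp only: mult_ac)
      thus ?thesis unfolding sum by simp
    qed
    moreover have "(\<integral>s. g (seg s z) - g (seg (1 - s) z) \<partial>beta_measure lam) = intertwine lam g z - intertwine lam g (cnj z)"
      using wavg_integrable[OF lam continuous_on_const[of _ 1] gc z] wavg_integrable[OF lam continuous_on_const[of _ 1] gc cz]
      by (simp add: intertwine_def wavg_def seg_cnj)
    ultimately have "\<i> * of_real (Im z) * (fx z + \<i> * fy z) = of_real lam * (intertwine lam g z - intertwine lam g (cnj z))"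
      by simp
    moreover have "a + \<i> * (b + of_real (lam / Im z) * c) = 0" if "\<i> * of_real (Im z) * (a + \<i> * b) = of_real lam * c" for a b c
    proof -
      have "\<i> * of_real (Im z) * (a + \<i> * (b + of_real (lam / Im z) * c)) = \<i> * of_real (Im z) * (a + \<i> * b) - of_real lam * c"
        using y by (simp add: field_simps)
      thus ?thesis using that y by simp
    qed
    ultimately show "dunkl_E lam (intertwine lam g) fx fy z = 0"
      by blast
  }
  {
    assume y: "Im z = 0"
    hence zs: "seg s z = z" for s by (simp add: seg_def complex_eq_iff)
    have "(\<integral>s. of_real (1 - s) * 1 \<partial>beta_measure lam) = complex_of_real lam * (\<integral>s. of_real s - of_real (1 - s) \<partial>beta_measure lam)"
      by (rule beta_measure_by_parts[OF lam]) (auto intro!: derivative_eq_intros simp: has_vector_derivative_def scaleR_conv_of_real)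
    moreover have "fx z + \<i> * fy z = 2 * (\<integral>s. of_real (1 - s) \<partial>beta_measure lam) * deriv g z"
      unfolding sum zs by simp
    moreover have "fy z = \<i> * (\<integral>s. of_real s - of_real (1 - s) \<partial>beta_measure lam) * deriv g z"
    proof -
      have "fy z = (\<integral>s. \<i> * (of_real s - of_real (1 - s)) * deriv g z \<partial>beta_measure lam)"
        unfolding fy_def wavg_def zs by (rule Bochner_Integration.integral_cong) (auto simp: algebra_simps)
      thus ?thesis by simp
    qed
    ultimately show "fx z + \<i> * fy z + 2 * \<i> * of_real lam * fy z = 0"
      by (simp add: algebra_simps)
  }
qed

theorem intertwine_lambda_analytic:
  assumes lam: "0 \<le> lam" and g: "g holomorphic_on ball 0 r"
  shows "C2_on (ball 0 r) (intertwine lam g)" "\<And>z. z \<in> ball 0 r \<Longrightarrow> dunkl_dzbar lam (intertwine lam g) z = 0"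
    and "dunkl_holomorphic lam (ball 0 r) (intertwine lam g)"
proof -
  define fx where "fx = wavg lam (\<lambda>_. 1) (deriv g)"
  define fy where "fy = wavg lam (\<lambda>s. 1 * (\<i> * of_real (2 * s - 1))) (deriv g)"
  have g': "deriv g holomorphic_on ball 0 r" by (rule holomorphic_deriv[OF g]) simp
  have g'': "deriv (deriv g) holomorphic_on ball 0 r" by (rule holomorphic_deriv[OF g']) simp
  have c1: "continuous_on {0..1} (\<lambda>_::real. 1::complex)"
    "continuous_on {0..1} (\<lambda>s. 1 * (\<i> * complex_of_real (2 * s - 1)))"
    "continuous_on {0..1} (\<lambda>s. 1 * (\<i> * complex_of_real (2 * s - 1)) * (\<i> * complex_of_real (2 * s - 1)))"
    by (intro continuous_intros)+
  have d: "(intertwine lam g has_derivative (real_linear (fx z) (fy z))) (at z)" if "z \<in> ball 0 r" for z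
    unfolding intertwine_def fx_def fy_def by (rule wavg_has_derivative[OF lam c1(1) g that])
  note dx = wavg_has_derivative[OF lam c1(1) g', folded fx_def]
  note dy = wavg_has_derivative[OF lam c1(2) g', folded fy_def]
  show "C2_on (ball 0 r) (intertwine lam g)"
    by (rule C2_on_partials[OF d dx dy]) (assumption | (rule wavg_continuous_on[OF lam _ g''], rule c1))+
  have E: "Im z \<noteq> 0 \<Longrightarrow> dunkl_E lam (intertwine lam g) fx fy z = 0"
      "Im z = 0 \<Longrightarrow> fx z + \<i> * fy z + 2 * \<i> * of_real lam * fy z = 0" if "z \<in> ball 0 r" for z
    unfolding fx_def fy_def by (rule intertwine_Dunkl_equation[OF lam g that]; assumption)+
  show "dunkl_holomorphic lam (ball 0 r) (intertwine lam g)"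
    unfolding dunkl_holomorphic_def
    using d E(1) wavg_continuous_on[OF lam c1(1) g'] wavg_continuous_on[OF lam c1(2) g']
    unfolding fx_def[symmetric] fy_def[symmetric] by blast
  show "dunkl_dzbar lam (intertwine lam g) z = 0" if z: "z \<in> ball 0 r" for z
  proof (cases "Im z = 0")
    case True
    have "dunkl_dzbar lam (intertwine lam g) z = (fx z + \<i> * fy z + 2 * \<i> * of_real lam * fy z) / 2"
      unfolding dunkl_dzbar_def dzbar_def partials_eq[OF d[OF z]] using True by (simp add: field_simps)
    thus ?thesis using E(2)[OF z True] by simp
  next
    case False
    have zz: "z - cnj z = 2 * \<i> * of_real (Im z)" by (simp add: complex_eq_iff)
    have "dunkl_dzbar lam (intertwine lam g) z
      = (dunkl_E lam (intertwine lam g) fx fy z) / 2"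
      unfolding dunkl_dzbar_def dzbar_def partials_eq[OF d[OF z]] zz using False by (simp add: field_simps)
    thus ?thesis using E(1)[OF z False] by simp
  qed
qed

lemma lambda_analytic_imp_dunkl_holomorphic:
  assumes "lambda_analytic lam f"
  shows "dunkl_holomorphic lam (ball 0 1) f"
proof -
  obtain f' f'' where f': "\<And>z. z \<in> ball 0 1 \<Longrightarrow> (f has_derivative blinfun_apply (f' z)) (at z)"
    and f'': "\<And>z. z \<in> ball 0 1 \<Longrightarrow> (f' has_derivative blinfun_apply (f'' z)) (at z)"
    using assms unfolding lambda_analytic_def C2_on_def by blast
  have eqz: "\<And>z. z \<in> ball 0 1 \<Longrightarrow> dunkl_dzbar lam f z = 0"
    using assms unfolding lambda_analytic_def by blast
  define fx where "fx = (\<lambda>z. blinfun_apply (f' z) 1)"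
  define fy where "fy = (\<lambda>z. blinfun_apply (f' z) \<i>)"
  have f'c: "continuous_on (ball 0 1) f'"
    by (intro continuous_at_imp_continuous_on ballI has_derivative_continuous[OF f''])
  have lin: "blinfun_apply (f' z) h = of_real (Re h) * fx z + of_real (Im h) * fy z" for z h
  proof -
    have "h = Re h *\<^sub>R 1 + Im h *\<^sub>R \<i>" by (simp add: complex_eq_iff)
    hence "blinfun_apply (f' z) h = blinfun_apply (f' z) (Re h *\<^sub>R 1 + Im h *\<^sub>R \<i>)" by simp
    thus ?thesis unfolding blinfun.add_right blinfun.scaleR_right fx_def fy_def by (simp add: scaleR_conv_of_real)
  qed
  have d: "(f has_derivative (real_linear (fx z) (fy z))) (at z)" if "z \<in> ball 0 1" for z
    using f'[OF that] by (rule has_derivative_eq_rhs) (simp add: lin fun_eq_iff)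
  have "dunkl_E lam f fx fy z = 0" if z: "z \<in> ball 0 1" "Im z \<noteq> 0" for z
  proof -
    have zz: "z - cnj z = 2 * \<i> * of_real (Im z)" by (simp add: complex_eq_iff)
    have "dunkl_dzbar lam f z = (dunkl_E lam f fx fy z) / 2"
      unfolding dunkl_dzbar_def dzbar_def partials_eq[OF d[OF z(1)]] zz using z(2) by (simp add: field_simps)
    thus ?thesis using eqz[OF z(1)] by simp
  qed
  moreover have "continuous_on (ball 0 1) fx" "continuous_on (ball 0 1) fy"
    unfolding fx_def fy_def by (intro continuous_intros f'c)+
  ultimately show ?thesis unfolding dunkl_holomorphic_def using d by blast
qed


section \<open>Uniqueness: the values on the real axis determine the function\<close>

text \<open>
  Cut-off profiles are prescribed by their derivative, which is what appears in the integral formulas.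
\<close>

lemma antiderivative_vanishing:
  fixes k :: "real \<Rightarrow> real"
  assumes k: "continuous_on UNIV k" and kT: "\<And>t. t \<ge> T \<Longrightarrow> k t = 0"
  obtains h where "\<And>t. (h has_real_derivative k t) (at t)" "\<And>t. t \<ge> T \<Longrightarrow> h t = 0"
proof -
  have "\<exists>F. \<forall>x. - \<infinity> < ereal x \<longrightarrow> ereal x < \<infinity> \<longrightarrow> (F has_vector_derivative k x) (at x)"
    by (rule einterval_antiderivative) (use k in \<open>auto simp: continuous_on_eq_continuous_at\<close>)
  then obtain F where F: "\<And>x. (F has_real_derivative k x) (at x)"
    by (auto simp: has_real_derivative_iff_has_vector_derivative)
  show ?thesis
  proof (rule that[of "\<lambda>t. F t - F T"])
    show "((\<lambda>t. F t - F T) has_real_derivative k t) (at t)" for t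
      using F[of t] by (auto intro!: derivative_eq_intros)
    show "F t - F T = 0" if "t \<ge> T" for t
    proof (cases "t = T")
      case False
      hence "T < t" using that by simp
      from MVT2[OF this, of F k] F obtain z where "T < z" "F t - F T = (t - T) * k z" by auto
      thus ?thesis using kT[of z] by simp
    qed simp
  qed
qed

lemma axis_kernel_cancel:
  assumes "w \<noteq> of_real x"
  shows "reg_kernel lam 0 x w * (w - of_real x) = of_real (((norm (w - of_real x))\<^sup>2) powr (- lam))"
proof -
  let ?t = "(norm (w - of_real x))\<^sup>2"
  have t: "?t > 0" using assms by simp
  have "cnj (w - of_real x) * (w - of_real x) = of_real ?t"
    using complex_norm_square[of "w - of_real x"] by (simp add: mult.commute)
  hence "reg_kernel lam 0 x w * (w - of_real x) = of_real (?t * ?t powr (- lam - 1))"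
    by (simp add: reg_kernel_def mult_ac)
  also have "?t * ?t powr (- lam - 1) = ?t powr (- lam)"
    using t powr_add[of ?t 1 "- lam - 1"] by simp
  finally show ?thesis .
qed

text \<open>
  The Cauchy-Pompeiu formula with the cut-off centred at the pole. The derivative of the profile,
  \<open>t\<^sup>\<lambda> (T - t)\<^sup>N\<close>, cancels the singular power of the kernel and leaves the mean with density
  \<open>(T - |w - x|\<^sup>2)\<^sup>N\<close>.
\<close>

lemma axis_mean_value_zero:
  fixes u :: "complex \<Rightarrow> complex"
  assumes lam: "0 \<le> lam" and u: "dunkl_holomorphic lam (ball 0 r) u"
    and u0: "u (of_real x) = 0" and T: "0 < T" "\<bar>x\<bar> + sqrt T < r" and N: "0 < N"
  shows "(\<integral>w. u w * of_real (max 0 (T - (norm (w - of_real x))\<^sup>2) ^ N) \<partial>sigma_lambda lam) = 0"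
proof -
  \<comment> \<open>the power \<open>t\<^sup>\<lambda>\<close> as a continuous function; \<open>0 powr 0 = 0\<close> is the wrong value for \<open>\<lambda> = 0\<close>\<close>
  define p where "p = (\<lambda>t::real. if lam = 0 then 1 else max 0 t powr lam)"
  define k where "k = (\<lambda>t. p t * max 0 (T - t) ^ N)"
  have pc: "continuous_on UNIV p"
  proof (cases "lam = 0")
    case False
    hence "continuous_on UNIV (\<lambda>t::real. max 0 t powr lam)" using lam
      by (intro continuous_on_powr') (auto intro!: continuous_intros)
    thus ?thesis using False by (simp add: p_def)
  qed (simp add: p_def)
  have kc: "continuous_on UNIV k" unfolding k_def by (intro continuous_intros pc)
  have kT: "k t = 0" if "t \<ge> T" for t using that N by (simp add: k_def)
  obtain h where h: "\<And>t. (h has_real_derivative k t) (at t)" and hT: "\<And>t. t \<ge> T \<Longrightarrow> h t = 0"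
    using antiderivative_vanishing[OF kc kT] by blast
  have p_eq: "p (d\<^sup>2) = d powr (2 * lam)" if "d > 0" for d
  proof -
    have "d\<^sup>2 = d powr 2" using that by simp
    hence "(d\<^sup>2) powr lam = d powr (2 * lam)" by (simp only: powr_powr)
    thus ?thesis using that by (simp add: p_def)
  qed
  have bd: "norm (w - of_real x) * \<bar>k ((norm (w - of_real x))\<^sup>2)\<bar> \<le> T ^ N * norm (w - of_real x) powr (2 * lam + 1)" for w :: complex
  proof (cases "w = of_real x")
    case False
    let ?d = "norm (w - of_real x)"
    have d: "?d > 0" using False by simp
    have "max 0 (T - ?d\<^sup>2) ^ N \<le> T ^ N" using T by (intro power_mono) auto
    hence "?d * (?d powr (2 * lam) * max 0 (T - ?d\<^sup>2) ^ N) \<le> ?d * (?d powr (2 * lam) * T ^ N)"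
      by (intro mult_left_mono) auto
    also have "\<dots> = T ^ N * ?d powr (2 * lam + 1)" using d by (simp add: powr_add)
    finally show ?thesis using p_eq[OF d] by (simp add: k_def abs_mult)
  qed auto
  have "of_real (pole_constant lam * h ((x - x)\<^sup>2)) * u (of_real x)
     = - (\<integral>w. u w * (reg_kernel lam 0 x w * (2 * (w - of_real x) * of_real (k ((norm (w - of_real x))\<^sup>2)))) \<partial>sigma_lambda lam)"
    by (rule pompeiu_real_axis[OF lam u h kc hT kT _ T(2) bd]) (use T in auto)
  hence z: "(\<integral>w. u w * (reg_kernel lam 0 x w * (2 * (w - of_real x) * of_real (k ((norm (w - of_real x))\<^sup>2)))) \<partial>sigma_lambda lam) = 0"
    using u0 by simp
  define F where "F = (\<lambda>w. indicat_real (ball 0 r) w *\<^sub>R u w)"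
  have Fm [measurable]: "F \<in> borel_measurable borel"
    unfolding F_def by (rule borel_measurable_continuous_on_indicator[OF _ dunkl_holomorphic_continuous_on[OF u]]) simp
  have out: "T \<le> (norm (w - of_real x))\<^sup>2" if "norm w \<ge> r" for w :: complex
  proof -
    have "sqrt T \<le> norm (w - of_real x)" using that T norm_triangle_ineq2[of w "of_real x"] by simp
    hence "(sqrt T)\<^sup>2 \<le> (norm (w - of_real x))\<^sup>2" by (rule power_mono) (use T in auto)
    thus ?thesis using T by simp
  qed
  have Fu: "F w = u w" if "norm w < r" for w using that by (simp add: F_def)
  have km [measurable]: "k \<in> borel_measurable borel" using kc by (rule borel_measurable_continuous_onI)
  have rm [measurable]: "reg_kernel lam 0 x \<in> borel_measurable borel" unfolding reg_kernel_def by measurable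
  have "(\<integral>w. u w * (reg_kernel lam 0 x w * (2 * (w - of_real x) * of_real (k ((norm (w - of_real x))\<^sup>2)))) \<partial>sigma_lambda lam)
      = (\<integral>w. F w * (reg_kernel lam 0 x w * (2 * (w - of_real x) * of_real (k ((norm (w - of_real x))\<^sup>2)))) \<partial>sigma_lambda lam)"
  proof (rule Bochner_Integration.integral_cong)
    fix w show "u w * (reg_kernel lam 0 x w * (2 * (w - of_real x) * of_real (k ((norm (w - of_real x))\<^sup>2))))
      = F w * (reg_kernel lam 0 x w * (2 * (w - of_real x) * of_real (k ((norm (w - of_real x))\<^sup>2))))"
      using kT[OF out[of w]] Fu[of w] by (cases "norm w < r") auto
  qed simp
  also have "\<dots> = (\<integral>w. 2 * (F w * of_real (max 0 (T - (norm (w - of_real x))\<^sup>2) ^ N)) \<partial>sigma_lambda lam)"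
  proof (rule integral_cong_AE)
    have "AE w in lborel. w \<noteq> complex_of_real x" by (rule AE_lborel_singleton)
    hence "AE w in sigma_lambda lam. w \<noteq> complex_of_real x" by (simp add: AE_sigma_iff[OF lam])
    thus "AE w in sigma_lambda lam. F w * (reg_kernel lam 0 x w * (2 * (w - of_real x) * of_real (k ((norm (w - of_real x))\<^sup>2))))
      = 2 * (F w * of_real (max 0 (T - (norm (w - of_real x))\<^sup>2) ^ N))"
    proof eventually_elim
      case (elim w)
      let ?d = "norm (w - of_real x)"
      have d: "?d > 0" using elim by simp
      have "?d\<^sup>2 = ?d powr 2" using d by simp
      hence e: "(?d\<^sup>2) powr (- lam) = ?d powr (2 * (- lam))" by (simp only: powr_powr)
      have one: "(?d\<^sup>2) powr (- lam) * p (?d\<^sup>2) = 1"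
        unfolding e p_eq[OF d] using d by (simp flip: powr_add)
      have "reg_kernel lam 0 x w * (2 * (w - of_real x) * of_real (k (?d\<^sup>2)))
        = 2 * (reg_kernel lam 0 x w * (w - of_real x)) * of_real (k (?d\<^sup>2))" by (simp only: mult_ac)
      also have "\<dots> = 2 * of_real (((?d\<^sup>2) powr (- lam) * p (?d\<^sup>2)) * max 0 (T - ?d\<^sup>2) ^ N)"
        unfolding axis_kernel_cancel[OF elim] by (simp add: k_def mult_ac)
      finally show ?case unfolding one by simp
    qed
  qed measurable
  also have "\<dots> = 2 * (\<integral>w. u w * of_real (max 0 (T - (norm (w - of_real x))\<^sup>2) ^ N) \<partial>sigma_lambda lam)"
  proof -
    have e: "F w * of_real (max 0 (T - (norm (w - of_real x))\<^sup>2) ^ N) = u w * of_real (max 0 (T - (norm (w - of_real x))\<^sup>2) ^ N)" for w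
      using out[of w] Fu[of w] N by (cases "norm w < r") auto
    have "(\<integral>w. F w * of_real (max 0 (T - (norm (w - of_real x))\<^sup>2) ^ N) \<partial>sigma_lambda lam)
        = (\<integral>w. u w * of_real (max 0 (T - (norm (w - of_real x))\<^sup>2) ^ N) \<partial>sigma_lambda lam)"
      by (rule Bochner_Integration.integral_cong) (simp_all only: e)
    thus ?thesis by (simp only: integral_mult_right_zero)
  qed
  finally show ?thesis using z by simp
qed

lemma max_power_has_derivative:
  fixes s :: real assumes "0 < N"
  shows "((\<lambda>s. max 0 s ^ Suc N) has_real_derivative (real (Suc N) * max 0 s ^ N)) (at s)"
proof -
  consider "s > 0" | "s < 0" | "s = 0" by linarith
  thus ?thesis
  proof cases
    case 1
    have "((\<lambda>s. s ^ Suc N) has_real_derivative (real (Suc N) * s ^ N)) (at s)"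
      by (rule DERIV_cong[OF DERIV_pow]) simp
    hence "((\<lambda>s. max 0 s ^ Suc N) has_real_derivative (real (Suc N) * s ^ N)) (at s)"
      by (rule has_field_derivative_transform_within_open[of _ _ _ "{0<..}"]) (use 1 in auto)
    thus ?thesis using 1 by simp
  next
    case 2
    have "((\<lambda>s. 0) has_real_derivative 0) (at s)" by simp
    hence "((\<lambda>s. max 0 s ^ Suc N) has_real_derivative 0) (at s)"
      by (rule has_field_derivative_transform_within_open[of _ _ _ "{..<0}"]) (use 2 in auto)
    thus ?thesis using 2 assms by (simp add: power_0_left)
  next
    case 3
    have "((\<lambda>h. (max 0 (0 + h) ^ Suc N - max 0 0 ^ Suc N) / h) \<longlongrightarrow> 0) (at (0::real))"
    proof (rule Lim_null_comparison)
      show "eventually (\<lambda>h. norm ((max 0 (0 + h) ^ Suc N - max 0 0 ^ Suc N) / h) \<le> \<bar>h\<bar> ^ N) (at (0::real))"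
      proof (rule always_eventually, rule allI)
        fix h :: real
        have "\<bar>max 0 h ^ Suc N / h\<bar> \<le> \<bar>h\<bar> ^ N" by (cases "h > 0") (auto simp: max_def)
        thus "norm ((max 0 (0 + h) ^ Suc N - max 0 0 ^ Suc N) / h) \<le> \<bar>h\<bar> ^ N" by simp
      qed
      have "((\<lambda>h::real. \<bar>h\<bar> ^ N) \<longlongrightarrow> \<bar>0\<bar> ^ N) (at 0)" by (intro tendsto_intros)
      moreover have "\<bar>0::real\<bar> ^ N = 0" using assms by simp
      ultimately show "((\<lambda>h::real. \<bar>h\<bar> ^ N) \<longlongrightarrow> 0) (at 0)" by (simp only:)
    qed
    thus ?thesis using 3 assms by (simp add: DERIV_def power_0_left)
  qed
qed

text \<open>
  The means vanish for all real centres \<open>x\<close> near zero, hence so do their derivatives in \<open>x\<close>. The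
  derivative of the mean with the factors \<open>(Re w - x)\<^sup>m\<close> and \<open>(T - |w - x|\<^sup>2)\<^sup>N\<^sup>+\<^sup>1\<close> contains the one with
  the exponents \<open>m + 1\<close> and \<open>N\<close>, and one with the exponents \<open>m - 1\<close> and \<open>N + 1\<close>, which is zero
  by induction.
\<close>

lemma axis_moments_zero:
  fixes u :: "complex \<Rightarrow> complex"
  assumes lam: "0 \<le> lam" and um [measurable]: "u \<in> borel_measurable borel" and ub: "\<And>w. norm (u w) \<le> B" "\<And>w. norm w > R \<Longrightarrow> u w = 0"
    and mv: "\<And>x N. \<bar>x\<bar> < \<delta> \<Longrightarrow> 0 < N \<Longrightarrow> (\<integral>w. u w * of_real (max 0 (T - (norm (w - of_real x))\<^sup>2) ^ N) \<partial>sigma_lambda lam) = 0"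
  shows "\<bar>x\<bar> < \<delta> \<Longrightarrow> 0 < N \<Longrightarrow>
    (\<integral>w. u w * of_real ((Re w - x) ^ n * max 0 (T - (norm (w - of_real x))\<^sup>2) ^ N) \<partial>sigma_lambda lam) = 0"
proof (induction n arbitrary: x N rule: less_induct)
  case (less n)
  show ?case
  proof (cases n)
    case 0
    thus ?thesis using mv[OF less.prems] by simp
  next
    case (Suc m)
    define M where "M = (\<lambda>y (w::complex). max 0 (T - ((Re w - y)\<^sup>2 + (Im w)\<^sup>2)))"
    have Meq: "max 0 (T - (norm (w - of_real y))\<^sup>2) = M y w" for w y
      by (simp add: M_def cmod_power2)
    define psi where "psi = (\<lambda>y w. (Re w - y) ^ m * M y w ^ Suc N)"
    define dpsi where "dpsi = (\<lambda>y w. 2 * real (Suc N) * ((Re w - y) ^ Suc m * M y w ^ N) - real m * ((Re w - y) ^ (m - 1) * M y w ^ Suc N))"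
    have der: "((\<lambda>y. psi y w) has_real_derivative dpsi y w) (at y)" for y w
    proof -
      have "((\<lambda>y. T - ((Re w - y)\<^sup>2 + (Im w)\<^sup>2)) has_real_derivative (2 * (Re w - y))) (at y)"
        by (auto intro!: derivative_eq_intros)
      from DERIV_chain2[OF max_power_has_derivative[OF less.prems(2)] this]
      have 1: "((\<lambda>y. M y w ^ Suc N) has_real_derivative (real (Suc N) * M y w ^ N * (2 * (Re w - y)))) (at y)"
        unfolding M_def .
      have 2: "((\<lambda>y. (Re w - y) ^ m) has_real_derivative (- (real m * (Re w - y) ^ (m - 1)))) (at y)"
        by (auto intro!: derivative_eq_intros)
      have "((\<lambda>y. (Re w - y) ^ m * M y w ^ Suc N) has_real_derivative
          ((Re w - y) ^ m * (real (Suc N) * M y w ^ N * (2 * (Re w - y))) + - (real m * (Re w - y) ^ (m - 1)) * M y w ^ Suc N)) (at y)"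
        by (rule DERIV_mult'[OF 2 1])
      thus ?thesis unfolding psi_def dpsi_def by (simp add: algebra_simps)
    qed
    define d where "d = (\<bar>x\<bar> + \<delta>) / 2"
    have d: "\<bar>x\<bar> < d" "d < \<delta>" using less.prems(1) by (auto simp: d_def)
    define C where "C = {-d..d} \<times> cball (0::complex) R"
    have cM: "continuous_on S (\<lambda>p. M (fst p) (snd p))" for S unfolding M_def by (intro continuous_intros)
    have "continuous_on C (\<lambda>p. dpsi (fst p) (snd p))"
      unfolding dpsi_def by (intro continuous_intros cM)
    moreover have "compact C" unfolding C_def by (intro compact_Times) auto
    ultimately obtain L where LC: "\<And>p. p \<in> C \<Longrightarrow> norm (dpsi (fst p) (snd p)) \<le> L"
      using continuous_on_compact_bound by blast
    have L: "\<bar>dpsi y w\<bar> \<le> L" if "\<bar>y\<bar> \<le> d" "norm w \<le> R" for y w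
      using LC[of "(y, w)"] that by (auto simp: C_def abs_le_iff)
    have B0: "0 \<le> B" using ub(1)[of 0] norm_ge_zero order_trans by blast
    have Lip: "\<bar>psi y w - psi x w\<bar> \<le> L * \<bar>y - x\<bar>" if "\<bar>y\<bar> < d" "norm w \<le> R" for y w
    proof -
      have "norm (psi y w - psi x w) \<le> L * norm (y - x)"
        by (rule field_differentiable_bound[of "{-d..d}" "\<lambda>y. psi y w" "\<lambda>y. dpsi y w"])
          (use d that L der in \<open>auto intro: has_field_derivative_at_within\<close>)
      thus ?thesis by simp
    qed
    have mM [measurable]: "M y \<in> borel_measurable borel" for y
      by (intro borel_measurable_continuous_onI) (auto simp: M_def intro!: continuous_intros)
    have mpsi [measurable]: "psi y \<in> borel_measurable borel" "dpsi y \<in> borel_measurable borel" for y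
      unfolding psi_def dpsi_def by measurable
    have bdd: "integrable (sigma_lambda lam) (\<lambda>w. u w * of_real (\<phi> w))" if c: "continuous_on UNIV \<phi>" for \<phi>
      by (rule integrable_times_continuous[OF lam um ub(1) _ c, where R = R]) (rule ub(2))
    have cont: "continuous_on UNIV (psi y)" "continuous_on UNIV (dpsi y)" "continuous_on UNIV (M y)" for y
      unfolding psi_def dpsi_def M_def by (intro continuous_intros)+
    have ip: "integrable (sigma_lambda lam) (\<lambda>w. u w * of_real (psi y w))"
      "integrable (sigma_lambda lam) (\<lambda>w. u w * of_real (dpsi y w))" for y
      by (intro bdd cont)+
    have D: "((\<lambda>y. \<integral>w. u w * of_real (psi y w) \<partial>sigma_lambda lam) has_derivative
        (\<lambda>h. \<integral>w. u w * of_real (h * dpsi x w) \<partial>sigma_lambda lam)) (at x)"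
    proof (rule has_derivative_integral_param[where U = "ball 0 d" and B = "\<lambda>w. B * L * indicat_real (cball 0 R) w"])
      show "integrable (sigma_lambda lam) (\<lambda>w. B * L * indicat_real (cball 0 R) w)"
        using sigma_ball_finite[OF lam, of R] by (intro integrable_mult_right) auto
      show "integrable (sigma_lambda lam) (\<lambda>w. u w * of_real (h * dpsi x w))" for h
        by (intro bdd continuous_intros cont)
      show "((\<lambda>y. u w * of_real (psi y w)) has_derivative (\<lambda>h. u w * of_real (h * dpsi x w))) (at x)" for w
      proof -
        have "((\<lambda>y. psi y w) has_derivative (\<lambda>h. h * dpsi x w)) (at x)"
          using der[of w x] unfolding has_field_derivative_def
          by (rule has_derivative_eq_rhs) (auto simp: fun_eq_iff mult.commute)
        thus ?thesis by (intro has_derivative_mult_right has_derivative_of_real)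
      qed
      show "norm (u w * of_real (psi y w) - u w * of_real (psi x w)) \<le> B * L * indicat_real (cball 0 R) w * norm (y - x)"
        if "y \<in> ball 0 d" for y w
      proof (cases "norm w \<le> R")
        case True
        have "norm (u w) * \<bar>psi y w - psi x w\<bar> \<le> B * (L * \<bar>y - x\<bar>)"
          using ub(1)[of w] Lip[of y w] that True B0 by (intro mult_mono) auto
        thus ?thesis using True by (simp add: mult_ac norm_mult flip: right_diff_distrib of_real_diff)
      qed (use ub in auto)
      show "norm (u w * of_real (h * dpsi x w)) \<le> B * L * indicat_real (cball 0 R) w * norm h" for h w
      proof (cases "norm w \<le> R")
        case True
        have "norm (u w) * \<bar>dpsi x w\<bar> \<le> B * L"
          using ub(1)[of w] L[of x w] d True B0 by (intro mult_mono) auto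
        hence "(norm (u w) * \<bar>dpsi x w\<bar>) * \<bar>h\<bar> \<le> (B * L) * \<bar>h\<bar>" by (intro mult_right_mono) auto
        thus ?thesis using True by (simp add: norm_mult mult_ac abs_mult)
      qed (use ub in auto)
    qed (use d ip in auto)
    have Z: "(\<integral>w. u w * of_real (psi y w) \<partial>sigma_lambda lam) = 0" if "\<bar>y\<bar> < \<delta>" for y
      using less.IH[of m y "Suc N"] that Suc unfolding Meq psi_def by simp
    have "((\<lambda>y. \<integral>w. u w * of_real (psi y w) \<partial>sigma_lambda lam) has_derivative (\<lambda>h. 0)) (at x)"
    proof (rule has_derivative_transform_within_open[of "\<lambda>_. 0" _ _ _ "ball 0 \<delta>"])
    qed (use less.prems(1) Z in auto)
    from has_derivative_unique[OF D this]
    have "(\<integral>w. u w * of_real (1 * dpsi x w) \<partial>sigma_lambda lam) = 0" by (rule fun_cong)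
    hence z: "(\<integral>w. u w * of_real (dpsi x w) \<partial>sigma_lambda lam) = 0" by simp
    let ?A = "\<lambda>w. (Re w - x) ^ Suc m * M x w ^ N"
    let ?E = "\<lambda>w. (Re w - x) ^ (m - 1) * M x w ^ Suc N"
    have iA: "integrable (sigma_lambda lam) (\<lambda>w. u w * of_real (?A w))"
      by (intro bdd continuous_intros cont)
    have iE: "integrable (sigma_lambda lam) (\<lambda>w. u w * of_real (?E w))"
      by (intro bdd continuous_intros cont)
    have E0: "of_real (real m) * (\<integral>w. u w * of_real (?E w) \<partial>sigma_lambda lam) = 0"
    proof (cases "m = 0")
      case False
      thus ?thesis using less.IH[of "m - 1" x "Suc N"] less.prems Suc unfolding Meq by simp
    qed simp
    have "(\<integral>w. u w * of_real (dpsi x w) \<partial>sigma_lambda lam)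
      = (\<integral>w. of_real (2 * real (Suc N)) * (u w * of_real (?A w)) - of_real (real m) * (u w * of_real (?E w)) \<partial>sigma_lambda lam)"
      unfolding dpsi_def by (rule Bochner_Integration.integral_cong) (simp_all add: algebra_simps)
    also have "\<dots> = of_real (2 * real (Suc N)) * (\<integral>w. u w * of_real (?A w) \<partial>sigma_lambda lam)
        - of_real (real m) * (\<integral>w. u w * of_real (?E w) \<partial>sigma_lambda lam)"
      by (simp only: Bochner_Integration.integral_diff[OF integrable_mult_right[OF iA] integrable_mult_right[OF iE]] integral_mult_right_zero)
    finally have "of_real (2 * real (Suc N)) * (\<integral>w. u w * of_real (?A w) \<partial>sigma_lambda lam) = 0"
      using z E0 by simp
    hence "(\<integral>w. u w * of_real (?A w) \<partial>sigma_lambda lam) = 0"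
      unfolding mult_eq_0_iff by (simp del: of_nat_Suc)
    thus ?thesis unfolding Meq Suc .
  qed
qed


text \<open>
  Multiplication by \<open>Re w\<close> raises the exponent \<open>n\<close> and multiplication by \<open>T - |w|\<^sup>2\<close> the exponent \<open>N\<close>. So
  the class \<open>Q\<close> of weights for which all moments vanish is stable under both, and therefore under
  multiplication by polynomials in the two.
\<close>

lemma moments_annihilate_polynomials:
  fixes u :: "complex \<Rightarrow> complex"
  assumes lam: "0 \<le> lam" and um [measurable]: "u \<in> borel_measurable borel" and ub: "\<And>w. norm (u w) \<le> B" "\<And>w. norm w > R \<Longrightarrow> u w = 0"
    and mom: "\<And>n N. 0 < N \<Longrightarrow> (\<integral>w. u w * of_real ((Re w) ^ n * max 0 (T - (norm w)\<^sup>2) ^ N) \<partial>sigma_lambda lam) = 0"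
    and p: "real_polynomial_function (p :: real \<times> real \<Rightarrow> real)"
  shows "(\<integral>w. u w * of_real (p (Re w, max 0 (T - (norm w)\<^sup>2)) * max 0 (T - (norm w)\<^sup>2)) \<partial>sigma_lambda lam) = 0"
proof -
  define M where "M = (\<lambda>w::complex. max 0 (T - (norm w)\<^sup>2))"
  have Mc: "continuous_on S M" for S unfolding M_def by (intro continuous_intros)
  have int: "integrable (sigma_lambda lam) (\<lambda>w. u w * of_real (\<phi> w * ((Re w) ^ n * M w ^ N)))"
    if "continuous_on UNIV \<phi>" for \<phi> n N
    by (rule integrable_times_continuous[OF lam um ub(1), where R = R]) (auto intro!: continuous_intros that Mc ub(2))
  define Q where "Q = (\<lambda>\<psi>. continuous_on UNIV \<psi> \<and> (\<forall>n N. 0 < N \<longrightarrow>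
     (\<integral>w. u w * of_real (\<psi> w * ((Re w) ^ n * M w ^ N)) \<partial>sigma_lambda lam) = 0))"
  have Q1: "Q (\<lambda>_. 1)" unfolding Q_def using mom by (simp add: M_def)
  have Qc: "Q (\<lambda>w. c * \<psi> w)" if "Q \<psi>" for c \<psi>
  proof -
    have "(\<integral>w. u w * of_real ((c * \<psi> w) * ((Re w) ^ n * M w ^ N)) \<partial>sigma_lambda lam)
      = (\<integral>w. of_real c * (u w * of_real (\<psi> w * ((Re w) ^ n * M w ^ N))) \<partial>sigma_lambda lam)" for n N
      by (rule Bochner_Integration.integral_cong) (simp_all add: mult_ac)
    moreover have "continuous_on UNIV (\<lambda>w. c * \<psi> w)" using that unfolding Q_def by (intro continuous_intros) auto
    ultimately show ?thesis using that unfolding Q_def by simp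
  qed
  have Qadd: "Q (\<lambda>w. \<psi> w + \<theta> w)" if "Q \<psi>" "Q \<theta>" for \<psi> \<theta>
  proof -
    have c: "continuous_on UNIV \<psi>" "continuous_on UNIV \<theta>" using that by (auto simp: Q_def)
    have "(\<integral>w. u w * of_real ((\<psi> w + \<theta> w) * ((Re w) ^ n * M w ^ N)) \<partial>sigma_lambda lam)
       = (\<integral>w. u w * of_real (\<psi> w * ((Re w) ^ n * M w ^ N)) \<partial>sigma_lambda lam)
        + (\<integral>w. u w * of_real (\<theta> w * ((Re w) ^ n * M w ^ N)) \<partial>sigma_lambda lam)" for n N
    proof -
      have "(\<integral>w. u w * of_real ((\<psi> w + \<theta> w) * ((Re w) ^ n * M w ^ N)) \<partial>sigma_lambda lam)
        = (\<integral>w. u w * of_real (\<psi> w * ((Re w) ^ n * M w ^ N)) + u w * of_real (\<theta> w * ((Re w) ^ n * M w ^ N)) \<partial>sigma_lambda lam)"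
        by (rule Bochner_Integration.integral_cong) (simp_all add: algebra_simps)
      also have "\<dots> = (\<integral>w. u w * of_real (\<psi> w * ((Re w) ^ n * M w ^ N)) \<partial>sigma_lambda lam)
        + (\<integral>w. u w * of_real (\<theta> w * ((Re w) ^ n * M w ^ N)) \<partial>sigma_lambda lam)"
        by (rule Bochner_Integration.integral_add[OF int[OF c(1)] int[OF c(2)]])
      finally show ?thesis .
    qed
    thus ?thesis using that c unfolding Q_def by (auto intro: continuous_intros)
  qed
  have QRe: "Q (\<lambda>w. Re w * \<psi> w)" if "Q \<psi>" for \<psi>
    unfolding Q_def
  proof (intro conjI allI impI)
    show "continuous_on UNIV (\<lambda>w. Re w * \<psi> w)" using that unfolding Q_def by (intro continuous_intros) auto
    fix n N :: nat assume N: "0 < N"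
    have "(\<integral>w. u w * of_real ((Re w * \<psi> w) * ((Re w) ^ n * M w ^ N)) \<partial>sigma_lambda lam)
      = (\<integral>w. u w * of_real (\<psi> w * ((Re w) ^ Suc n * M w ^ N)) \<partial>sigma_lambda lam)"
      by (rule Bochner_Integration.integral_cong) (simp_all add: mult_ac)
    also have "\<dots> = 0" using that N unfolding Q_def by blast
    finally show "(\<integral>w. u w * of_real ((Re w * \<psi> w) * ((Re w) ^ n * M w ^ N)) \<partial>sigma_lambda lam) = 0" .
  qed
  have QM: "Q (\<lambda>w. M w * \<psi> w)" if "Q \<psi>" for \<psi>
    unfolding Q_def
  proof (intro conjI allI impI)
    show "continuous_on UNIV (\<lambda>w. M w * \<psi> w)" using that Mc unfolding Q_def by (intro continuous_intros) auto
    fix n N :: nat assume N: "0 < N"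
    have "(\<integral>w. u w * of_real ((M w * \<psi> w) * ((Re w) ^ n * M w ^ N)) \<partial>sigma_lambda lam)
      = (\<integral>w. u w * of_real (\<psi> w * ((Re w) ^ n * M w ^ Suc N)) \<partial>sigma_lambda lam)"
      by (rule Bochner_Integration.integral_cong) (simp_all add: mult_ac)
    also have "\<dots> = 0" using that N unfolding Q_def by blast
    finally show "(\<integral>w. u w * of_real ((M w * \<psi> w) * ((Re w) ^ n * M w ^ N)) \<partial>sigma_lambda lam) = 0" .
  qed
  have "Q \<psi> \<Longrightarrow> Q (\<lambda>w. p (Re w, M w) * \<psi> w)" for \<psi>
    using p
  proof (induction arbitrary: \<psi>)
    case (linear f)
    interpret f: bounded_linear f by fact
    have lf: "f (a, b) = f (1, 0) * a + f (0, 1) * b" for a b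
    proof -
      have "(a, b) = a *\<^sub>R (1, 0) + b *\<^sub>R (0, 1)" by simp
      hence "f (a, b) = f (a *\<^sub>R (1, 0) + b *\<^sub>R (0, 1))" by (rule arg_cong)
      thus ?thesis unfolding f.add f.scaleR by (simp add: mult.commute)
    qed
    have "(\<lambda>w. f (Re w, M w) * \<psi> w) = (\<lambda>w. f (1, 0) * (Re w * \<psi> w) + f (0, 1) * (M w * \<psi> w))"
    proof
      fix w
      show "f (Re w, M w) * \<psi> w = f (1, 0) * (Re w * \<psi> w) + f (0, 1) * (M w * \<psi> w)"
        unfolding lf[of "Re w" "M w"] by (simp add: algebra_simps)
    qed
    thus ?case using Qadd[OF Qc[OF QRe[OF linear(2)]] Qc[OF QM[OF linear(2)]]] by simp
  next
    case (const c)
    thus ?case using Qc by simp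
  next
    case (add f g)
    thus ?case using Qadd[OF add.IH(1)[OF add.prems] add.IH(2)[OF add.prems]] by (simp add: distrib_right)
  next
    case (mult f g)
    thus ?case using mult.IH(1)[OF mult.IH(2)[OF mult.prems]] by (simp add: mult.assoc)
  qed
  from this[OF Q1] have "Q (\<lambda>w. p (Re w, M w))" by simp
  hence "(\<integral>w. u w * of_real (p (Re w, M w) * ((Re w) ^ n * M w ^ N)) \<partial>sigma_lambda lam) = 0" if "0 < N" for n N
    using that unfolding Q_def by blast
  from this[of 1 0] show ?thesis by (simp add: M_def)
qed

text \<open>
  The even part \<open>v\<close> of \<open>u\<close> is a continuous function of \<open>Re w\<close> and \<open>|w|\<^sup>2\<close> on a closed disk. By the
  Stone-Weierstrass theorem its conjugate is a uniform limit of polynomials in these two quantities, and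
  those are orthogonal to \<open>v\<close> with the weight \<open>M = T - |w|\<^sup>2\<close>. Hence the integral of \<open>|v|\<^sup>2 M\<close> is zero.
\<close>

theorem even_part_zero:
  fixes u :: "complex \<Rightarrow> complex"
  assumes lam: "0 \<le> lam" and u: "dunkl_holomorphic lam (ball 0 r) u"
    and u0: "\<And>x. \<bar>x\<bar> < r \<Longrightarrow> u (of_real x) = 0" and z: "z \<in> ball 0 r"
  shows "u z + u (cnj z) = 0"
proof -
  define rho where "rho = (norm z + r) / 2"
  have rho: "norm z < rho" "rho < r" "0 < rho"
    using z norm_ge_zero[of z] by (auto simp: rho_def simp del: norm_ge_zero)
  define T where "T = rho\<^sup>2"
  have T: "0 < T" "sqrt T = rho" using rho by (auto simp: T_def)
  define delta where "delta = (r - rho) / 2"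
  define R where "R = rho + delta"
  have R: "R < r" "0 < delta" "rho < R" using rho by (auto simp: R_def delta_def field_simps)
  have uc: "continuous_on (ball 0 r) u" by (rule dunkl_holomorphic_continuous_on[OF u])
  define F where "F = (\<lambda>w. indicat_real (cball 0 R) w *\<^sub>R u w)"
  have Fm [measurable]: "F \<in> borel_measurable borel"
    unfolding F_def by (rule borel_measurable_continuous_on_indicator[OF _ continuous_on_subset[OF uc]]) (use R in auto)
  have Fu: "F w = u w" if "norm w \<le> R" for w using that by (simp add: F_def)
  have "continuous_on (cball 0 R) u" by (rule continuous_on_subset[OF uc]) (use R in auto)
  then obtain B where B0: "0 \<le> B" and Bb: "\<And>w. w \<in> cball 0 R \<Longrightarrow> norm (u w) \<le> B"
    using continuous_on_compact_bound[OF compact_cball] by blast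
  have FB: "norm (F w) \<le> B" for w
    using Bb[of w] B0 by (cases "norm w \<le> R") (auto simp: F_def)
  have FR: "F w = 0" if "norm w > R" for w using that by (simp add: F_def)
  have mv: "(\<integral>w. F w * of_real (max 0 (T - (norm (w - of_real x))\<^sup>2) ^ N) \<partial>sigma_lambda lam) = 0"
    if x: "\<bar>x\<bar> < delta" and N: "0 < N" for x N
  proof -
    have "(\<integral>w. u w * of_real (max 0 (T - (norm (w - of_real x))\<^sup>2) ^ N) \<partial>sigma_lambda lam) = 0"
      by (rule axis_mean_value_zero[OF lam u u0 T(1) _ N]) (use x R T rho in \<open>auto simp: R_def delta_def field_simps\<close>)
    moreover have e: "u w * of_real (max 0 (T - (norm (w - of_real x))\<^sup>2) ^ N) = F w * of_real (max 0 (T - (norm (w - of_real x))\<^sup>2) ^ N)" for w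
    proof (cases "norm w \<le> R")
      case False
      have "rho \<le> norm (w - of_real x)" using False x norm_triangle_ineq2[of w "of_real x"] by (simp add: R_def)
      hence "T \<le> (norm (w - of_real x))\<^sup>2" unfolding T_def using rho by (intro power_mono) auto
      thus ?thesis using N by simp
    qed (simp add: Fu)
    ultimately show ?thesis by (simp only: e)
  qed
  have mom: "(\<integral>w. F w * of_real ((Re w) ^ n * max 0 (T - (norm w)\<^sup>2) ^ N) \<partial>sigma_lambda lam) = 0" if "0 < N" for n N
  proof -
    have "(\<integral>w. F w * of_real ((Re w - 0) ^ n * max 0 (T - (norm (w - of_real 0))\<^sup>2) ^ N) \<partial>sigma_lambda lam) = 0"
      by (rule axis_moments_zero[OF lam Fm FB FR mv]) (use that R in auto)
    thus ?thesis by (simp only: of_real_0 diff_zero)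
  qed
  define M where "M = (\<lambda>w::complex. max 0 (T - (norm w)\<^sup>2))"
  have Mc: "continuous_on S M" for S unfolding M_def by (intro continuous_intros)
  have Mb: "0 \<le> M w" "M w \<le> T" for w using T by (auto simp: M_def)
  have Mz: "M w = 0" if "norm w \<ge> rho" for w
  proof -
    have "T \<le> (norm w)\<^sup>2" unfolding T_def using that rho by (intro power_mono) auto
    thus ?thesis by (simp add: M_def)
  qed
  have Mm [measurable]: "M \<in> borel_measurable borel" using Mc by (rule borel_measurable_continuous_onI)
  define v where "v = (\<lambda>w. F w + F (cnj w))"
  have vm [measurable]: "v \<in> borel_measurable borel" unfolding v_def by measurable
  have vb: "norm (v w) \<le> 2 * B" for w
    unfolding v_def using norm_triangle_ineq[of "F w" "F (cnj w)"] FB[of w] FB[of "cnj w"] by linarith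
  have vc: "continuous_on (cball 0 rho) v"
  proof -
    have 1: "continuous_on (cball 0 R) F"
      by (rule continuous_on_eq[OF continuous_on_subset[OF uc]]) (use R Fu in auto)
    show ?thesis unfolding v_def
      by (intro continuous_intros continuous_on_subset[OF 1] continuous_on_compose2[OF 1, of _ cnj]) (use R in auto)
  qed
  \<comment> \<open>as an even function, \<open>v\<close> is a continuous function of \<open>Re w\<close> and \<open>T - |w|\<^sup>2\<close>\<close>
  define Z where "Z = (\<lambda>w. (Re w, M w)) ` cball 0 rho"
  have Zc: "compact Z" unfolding Z_def
    by (intro compact_continuous_image continuous_on_Pair Mc) (auto intro: continuous_intros)
  define V where "V = (\<lambda>(a, b). v (Complex a (sqrt (T - b - a\<^sup>2))))"
  have ZM: "M w = T - (norm w)\<^sup>2" if "norm w \<le> rho" for w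
  proof -
    have "(norm w)\<^sup>2 \<le> T" unfolding T_def using that by (intro power_mono) auto
    thus ?thesis by (simp add: M_def)
  qed
  have Zpt: "Complex (Re w) (sqrt (T - M w - (Re w)\<^sup>2)) = Complex (Re w) \<bar>Im w\<bar>" if "norm w \<le> rho" for w
    using ZM[OF that] by (simp add: cmod_power2)
  have Vv: "V (Re w, M w) = v w" if "norm w \<le> rho" for w
  proof -
    have "Complex (Re w) \<bar>Im w\<bar> = w \<or> Complex (Re w) \<bar>Im w\<bar> = cnj w"
      by (auto simp: complex_eq_iff abs_if)
    thus ?thesis using Zpt[OF that] by (auto simp: V_def v_def add.commute)
  qed
  have Vc: "continuous_on Z V"
  proof -
    have "continuous_on Z (\<lambda>p. v (Complex (fst p) (sqrt (T - snd p - (fst p)\<^sup>2))))"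
    proof (rule continuous_on_compose2[OF vc])
      show "continuous_on Z (\<lambda>p. Complex (fst p) (sqrt (T - snd p - (fst p)\<^sup>2)))"
        unfolding Complex_eq by (intro continuous_intros)
      show "(\<lambda>p. Complex (fst p) (sqrt (T - snd p - (fst p)\<^sup>2))) ` Z \<subseteq> cball 0 rho"
      proof (clarsimp simp: Z_def)
        fix w :: complex assume w: "norm w \<le> rho"
        have "norm (Complex (Re w) \<bar>Im w\<bar>) = norm w" by (simp add: cmod_def)
        thus "norm (Complex (Re w) (sqrt (T - M w - (Re w)\<^sup>2))) \<le> rho" using Zpt[OF w] w by simp
      qed
    qed
    thus ?thesis unfolding V_def case_prod_unfold .
  qed
  have integ: "integrable (sigma_lambda lam) (\<lambda>w. G w * of_real (M w))"
    if [measurable]: "G \<in> borel_measurable borel" and Gb: "\<And>w. norm w \<le> rho \<Longrightarrow> norm (G w) \<le> K" for G :: "complex \<Rightarrow> complex" and K :: real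
  proof (rule integrable_sigma_bounded[OF lam, where B = "\<bar>K\<bar> * T" and R = rho])
    show "norm (G w * of_real (M w)) \<le> \<bar>K\<bar> * T" for w
    proof (cases "norm w \<le> rho")
      case True
      have "norm (G w) * M w \<le> \<bar>K\<bar> * T" using Gb[OF True] Mb[of w] by (intro mult_mono) auto
      thus ?thesis using Mb by (simp add: norm_mult)
    qed (use Mz T in auto)
  qed (use Mz in auto)
  have poly: "(\<integral>w. v w * of_real (q (Re w, M w) * M w) \<partial>sigma_lambda lam) = 0" if q: "real_polynomial_function q" for q
  proof -
    have qc: "continuous_on UNIV (\<lambda>w. q (Re w, M w) * M w)"
    proof (intro continuous_intros Mc)
      have "continuous_on UNIV q" using q
        by (intro continuous_at_imp_continuous_on ballI continuous_real_polymonial_function)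
      thus "continuous_on UNIV (\<lambda>w. q (Re w, M w))"
        by (rule continuous_on_compose2) (auto intro!: continuous_intros Mc)
    qed
    have [measurable]: "(\<lambda>w. q (Re w, M w) * M w) \<in> borel_measurable borel"
      using qc by (rule borel_measurable_continuous_onI)
    define G where "G = (\<lambda>w. F w * of_real (q (Re w, M w) * M w))"
    have Gm [measurable]: "G \<in> borel_measurable borel" unfolding G_def by measurable
    have i1: "integrable (sigma_lambda lam) G"
      unfolding G_def by (rule integrable_times_continuous[OF lam Fm FB _ qc, where R = R]) (rule FR)
    have i2: "integrable (sigma_lambda lam) (\<lambda>w. G (cnj w))"
      by (rule integrable_sigma_cnj[OF lam Gm i1])
    have "(\<integral>w. v w * of_real (q (Re w, M w) * M w) \<partial>sigma_lambda lam) = (\<integral>w. G w + G (cnj w) \<partial>sigma_lambda lam)"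
      by (rule Bochner_Integration.integral_cong) (auto simp: G_def v_def M_def algebra_simps)
    also have "\<dots> = 2 * (\<integral>w. G w \<partial>sigma_lambda lam)"
      using i1 i2 by (simp add: integral_sigma_cnj[OF lam Gm])
    also have "(\<integral>w. G w \<partial>sigma_lambda lam) = 0"
      unfolding G_def M_def by (rule moments_annihilate_polynomials[OF lam Fm FB FR mom q])
    finally show ?thesis by simp
  qed
  have iv: "integrable (sigma_lambda lam) (\<lambda>w. v w * cnj (v w) * of_real (M w))"
  proof (rule integ)
    show "norm (v w * cnj (v w)) \<le> 2 * B * (2 * B)" for w
      unfolding norm_mult complex_mod_cnj using vb[of w] by (intro mult_mono) (auto simp: B0)
  qed measurable
  have small: "norm (\<integral>w. v w * cnj (v w) * of_real (M w) \<partial>sigma_lambda lam)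
      \<le> e * (2 * B * T * measure (sigma_lambda lam) (cball 0 rho))" if e: "0 < e" for e
  proof -
    have "continuous_on Z (\<lambda>p. cnj (V p))" by (intro continuous_intros Vc)
    from Stone_Weierstrass_polynomial_function[OF Zc this e]
    obtain g where g: "polynomial_function g" and ge: "\<And>p. p \<in> Z \<Longrightarrow> norm (cnj (V p) - g p) < e"
      by blast
    have g1: "real_polynomial_function (\<lambda>p. Re (g p))" "real_polynomial_function (\<lambda>p. Im (g p))"
      using g unfolding polynomial_function_def by (auto simp: o_def dest: spec[of _ Re] spec[of _ Im] intro: bounded_linear_Re bounded_linear_Im)
    have gcn: "continuous_on UNIV (\<lambda>w. g (Re w, M w))"
    proof -
      have "continuous_on UNIV g" using g
        by (intro continuous_at_imp_continuous_on ballI continuous_polymonial_function)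
      thus ?thesis by (rule continuous_on_compose2) (auto intro!: continuous_intros Mc)
    qed
    have gm [measurable]: "(\<lambda>w. g (Re w, M w)) \<in> borel_measurable borel"
      using gcn by (rule borel_measurable_continuous_onI)
    have ge': "norm (cnj (v w) - g (Re w, M w)) \<le> e" if "norm w \<le> rho" for w
    proof -
      have "(Re w, M w) \<in> Z" unfolding Z_def by (rule imageI) (use that in simp)
      from ge[OF this] show ?thesis using Vv[OF that] by simp
    qed
    have gb: "norm (g (Re w, M w)) \<le> 2 * B + e" if "norm w \<le> rho" for w
      using ge'[OF that] vb[of w] norm_triangle_ineq2[of "g (Re w, M w)" "cnj (v w)"]
      by (simp add: norm_minus_commute)
    have part: "integrable (sigma_lambda lam) (\<lambda>w. v w * of_real (h w * M w))"
      if hm [measurable]: "h \<in> borel_measurable borel" and hb: "\<And>w. norm w \<le> rho \<Longrightarrow> \<bar>h w\<bar> \<le> 2 * B + e" for h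
    proof -
      have "integrable (sigma_lambda lam) (\<lambda>w. (v w * of_real (h w)) * of_real (M w))"
      proof (rule integ)
        show "norm (v w * of_real (h w)) \<le> 2 * B * (2 * B + e)" if "norm w \<le> rho" for w
          unfolding norm_mult norm_of_real using vb[of w] hb[OF that] by (intro mult_mono) (auto simp: B0)
      qed measurable
      thus ?thesis by (simp add: mult.assoc)
    qed
    have i1: "integrable (sigma_lambda lam) (\<lambda>w. v w * of_real (Re (g (Re w, M w)) * M w))"
    proof (rule part)
      show "\<bar>Re (g (Re w, M w))\<bar> \<le> 2 * B + e" if "norm w \<le> rho" for w
        using gb[OF that] abs_Re_le_cmod[of "g (Re w, M w)"] by linarith
    qed measurable
    have i2: "integrable (sigma_lambda lam) (\<lambda>w. v w * of_real (Im (g (Re w, M w)) * M w))"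
    proof (rule part)
      show "\<bar>Im (g (Re w, M w))\<bar> \<le> 2 * B + e" if "norm w \<le> rho" for w
        using gb[OF that] abs_Im_le_cmod[of "g (Re w, M w)"] by linarith
    qed measurable
    have "(\<integral>w. v w * g (Re w, M w) * of_real (M w) \<partial>sigma_lambda lam)
      = (\<integral>w. v w * of_real (Re (g (Re w, M w)) * M w) + \<i> * (v w * of_real (Im (g (Re w, M w)) * M w)) \<partial>sigma_lambda lam)"
    proof (rule Bochner_Integration.integral_cong)
      fix w
      have "g (Re w, M w) = of_real (Re (g (Re w, M w))) + \<i> * of_real (Im (g (Re w, M w)))" by (rule complex_eq)
      hence "v w * g (Re w, M w) * of_real (M w) = v w * (of_real (Re (g (Re w, M w))) + \<i> * of_real (Im (g (Re w, M w)))) * of_real (M w)"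
        by simp
      thus "v w * g (Re w, M w) * of_real (M w) = v w * of_real (Re (g (Re w, M w)) * M w) + \<i> * (v w * of_real (Im (g (Re w, M w)) * M w))"
        by (simp add: algebra_simps)
    qed simp
    also have "\<dots> = 0"
      using i1 i2 poly[OF g1(1)] poly[OF g1(2)] by simp
    finally have g0: "(\<integral>w. v w * g (Re w, M w) * of_real (M w) \<partial>sigma_lambda lam) = 0" .
    have ig: "integrable (sigma_lambda lam) (\<lambda>w. v w * g (Re w, M w) * of_real (M w))"
    proof (rule integ)
      show "norm (v w * g (Re w, M w)) \<le> 2 * B * (2 * B + e)" if "norm w \<le> rho" for w
        unfolding norm_mult using vb[of w] gb[OF that] by (intro mult_mono) (auto simp: B0)
    qed measurable
    have "(\<integral>w. v w * cnj (v w) * of_real (M w) \<partial>sigma_lambda lam)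
        = (\<integral>w. v w * cnj (v w) * of_real (M w) - v w * g (Re w, M w) * of_real (M w) \<partial>sigma_lambda lam)"
      using iv ig g0 by simp
    moreover have "norm (\<integral>w. v w * cnj (v w) * of_real (M w) - v w * g (Re w, M w) * of_real (M w) \<partial>sigma_lambda lam)
       \<le> (\<integral>w. (e * (2 * B * T)) * indicat_real (cball 0 rho) w \<partial>sigma_lambda lam)"
    proof (rule norm_integral_le)
      show "integrable (sigma_lambda lam) (\<lambda>w. (e * (2 * B * T)) * indicat_real (cball 0 rho) w)"
        using sigma_ball_finite[OF lam, of rho] by (intro integrable_mult_right) auto
      fix w
      show "norm (v w * cnj (v w) * of_real (M w) - v w * g (Re w, M w) * of_real (M w)) \<le> (e * (2 * B * T)) * indicat_real (cball 0 rho) w"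
      proof (cases "norm w \<le> rho")
        case True
        have "norm (v w * cnj (v w) * of_real (M w) - v w * g (Re w, M w) * of_real (M w))
          = norm (v w * ((cnj (v w) - g (Re w, M w)) * of_real (M w)))" by (simp add: algebra_simps)
        also have "\<dots> = norm (v w) * (norm (cnj (v w) - g (Re w, M w)) * M w)"
          using Mb by (simp add: norm_mult)
        also have "\<dots> \<le> (2 * B) * (e * T)"
          using vb[of w] ge'[OF True] Mb[of w] e by (intro mult_mono) (auto simp: B0)
        finally show ?thesis using True by (simp add: mult_ac)
      qed (use Mz in auto)
    qed (use iv ig in auto)
    ultimately show ?thesis by (simp add: mult_ac)
  qed
  have zero: "(\<integral>w. v w * cnj (v w) * of_real (M w) \<partial>sigma_lambda lam) = 0"
  proof (rule ccontr)
    let ?I = "\<integral>w. v w * cnj (v w) * of_real (M w) \<partial>sigma_lambda lam"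
    let ?K = "2 * B * T * measure (sigma_lambda lam) (cball 0 rho)"
    assume "?I \<noteq> 0"
    hence I: "0 < norm ?I" by simp
    have K: "0 \<le> ?K" using T by (simp add: B0)
    have "norm ?I \<le> (norm ?I / (2 * (?K + 1))) * ?K"
      by (rule small) (use I K in \<open>auto intro!: divide_pos_pos\<close>)
    also have "\<dots> < norm ?I"
    proof -
      have "(I / (2 * (K + 1))) * K < I" if "0 \<le> K" "0 < I" for I K :: real
        using that by (simp add: field_simps add_pos_nonneg add_nonneg_pos)
      from this[OF K I] show ?thesis .
    qed
    finally show False by simp
  qed
  have sq: "v w * cnj (v w) * of_real (M w) = of_real ((norm (v w))\<^sup>2 * M w)" for w
    using complex_norm_square[of "v w"] by simp
  have ir: "integrable (sigma_lambda lam) (\<lambda>w. (norm (v w))\<^sup>2 * M w)"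
    using iv unfolding sq by (simp only: complex_of_real_integrable_eq)
  have "(\<integral>w. (norm (v w))\<^sup>2 * M w \<partial>sigma_lambda lam) = 0"
    using zero unfolding sq integral_complex_of_real by simp
  hence "AE w in sigma_lambda lam. (norm (v w))\<^sup>2 * M w = 0"
    using integral_nonneg_eq_0_iff_AE[OF ir] Mb by simp
  hence ae: "AE w in lborel. w \<in> ball 0 rho \<longrightarrow> (norm (v w))\<^sup>2 * M w = 0"
    unfolding AE_sigma_iff[OF lam] by eventually_elim simp
  have "(norm (v z))\<^sup>2 * M z = 0"
  proof (rule continuous_AE_zero_imp_zero[OF open_ball _ ae])
    show "continuous_on (ball 0 rho) (\<lambda>w. (norm (v w))\<^sup>2 * M w)"
      by (intro continuous_intros Mc continuous_on_subset[OF vc]) auto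
  qed (use rho in auto)
  moreover have "M z > 0"
  proof -
    have "(norm z)\<^sup>2 < T" unfolding T_def using rho by (intro power_strict_mono) auto
    thus ?thesis by (simp add: M_def)
  qed
  ultimately have "v z = 0" by simp
  moreover have "norm z \<le> R" using rho R by linarith
  ultimately show ?thesis using Fu[of z] Fu[of "cnj z"] by (simp add: v_def)
qed


lemma dunkl_holomorphic_diff:
  assumes "dunkl_holomorphic lam S f" "dunkl_holomorphic lam S g"
  shows "dunkl_holomorphic lam S (\<lambda>z. f z - g z)"
proof -
  obtain fx fy where f: "continuous_on S fx" "continuous_on S fy"
    "\<And>z. z \<in> S \<Longrightarrow> (f has_derivative (real_linear (fx z) (fy z))) (at z)"
    "\<And>z. z \<in> S \<Longrightarrow> Im z \<noteq> 0 \<Longrightarrow> dunkl_E lam f fx fy z = 0"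
    using assms(1) unfolding dunkl_holomorphic_def by blast
  obtain gx gy where g: "continuous_on S gx" "continuous_on S gy"
    "\<And>z. z \<in> S \<Longrightarrow> (g has_derivative (real_linear (gx z) (gy z))) (at z)"
    "\<And>z. z \<in> S \<Longrightarrow> Im z \<noteq> 0 \<Longrightarrow> dunkl_E lam g gx gy z = 0"
    using assms(2) unfolding dunkl_holomorphic_def by blast
  show ?thesis unfolding dunkl_holomorphic_def
  proof (intro exI conjI ballI impI)
    show "continuous_on S (\<lambda>z. fx z - gx z)" "continuous_on S (\<lambda>z. fy z - gy z)"
      using f g by (auto intro: continuous_intros)
    fix z assume z: "z \<in> S"
    show "((\<lambda>z. f z - g z) has_derivative (real_linear (fx z - gx z) (fy z - gy z))) (at z)"
      by (rule has_derivative_eq_rhs[OF has_derivative_diff[OF f(3)[OF z] g(3)[OF z]]])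
        (simp add: fun_eq_iff algebra_simps)
    assume y: "Im z \<noteq> 0"
    have e: "(a1 - a2) + \<i> * ((b1 - b2) + k * ((c1 - c2) - (d1 - d2))) = (a1 + \<i> * (b1 + k * (c1 - d1))) - (a2 + \<i> * (b2 + k * (c2 - d2)))"
      for a1 a2 b1 b2 c1 c2 d1 d2 k :: complex by (simp add: algebra_simps)
    show "fx z - gx z + \<i> * (fy z - gy z + of_real (lam / Im z) * ((f z - g z) - (f (cnj z) - g (cnj z)))) = 0"
      by (simp only: e f(4)[OF z y] g(4)[OF z y] diff_self)
  qed
qed

text \<open>
  What is left after \<open>even_part_zero\<close> is odd in \<open>y\<close>. For an odd solution the equations at \<open>w\<close> and \<open>cnj w\<close>
  combine to \<open>u\<^sub>y + (2\<lambda>/y) u = 0\<close>. So \<open>y\<^sup>2\<^sup>\<lambda> u\<close> is constant on vertical half-lines, and it is zero on the axis.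
\<close>

theorem dunkl_unique:
  fixes u :: "complex \<Rightarrow> complex"
  assumes lam: "0 \<le> lam" and u: "dunkl_holomorphic lam (ball 0 r) u"
    and u0: "\<And>x. \<bar>x\<bar> < r \<Longrightarrow> u (of_real x) = 0" and z: "z \<in> ball 0 r"
  shows "u z = 0"
proof -
  have odd: "u (cnj w) = - u w" if "w \<in> ball 0 r" for w
    using even_part_zero[OF lam u u0 that] by (simp add: eq_neg_iff_add_eq_0 add.commute)
  obtain fx fy where fd: "\<And>z. z \<in> ball 0 r \<Longrightarrow> (u has_derivative (real_linear (fx z) (fy z))) (at z)"
    and fe: "\<And>z. z \<in> ball 0 r \<Longrightarrow> Im z \<noteq> 0 \<Longrightarrow> dunkl_E lam u fx fy z = 0"
    using u unfolding dunkl_holomorphic_def by blast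
  have uc: "continuous_on (ball 0 r) u" by (rule dunkl_holomorphic_continuous_on[OF u])
  \<comment> \<open>for an odd solution the equations at \<open>w\<close> and \<open>cnj w\<close> decouple\<close>
  have refl: "fx (cnj w) = - fx w" "fy (cnj w) = fy w" if w: "w \<in> ball 0 r" for w
  proof -
    have cw: "cnj w \<in> ball 0 r" using w by simp
    have "((\<lambda>z. u (cnj z)) has_derivative (\<lambda>h. of_real (Re (cnj h)) * fx (cnj w) + of_real (Im (cnj h)) * fy (cnj w))) (at w)"
      by (rule has_derivative_compose[OF bounded_linear_imp_has_derivative[OF bounded_linear_cnj] fd[OF cw]])
    hence "((\<lambda>z. - u z) has_derivative (\<lambda>h. of_real (Re (cnj h)) * fx (cnj w) + of_real (Im (cnj h)) * fy (cnj w))) (at w)"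
      by (rule has_derivative_transform_within_open[of _ _ _ _ "ball 0 r"]) (use w odd in auto)
    moreover have "((\<lambda>z. - u z) has_derivative (\<lambda>h. - (of_real (Re h) * fx w + of_real (Im h) * fy w))) (at w)"
      by (rule has_derivative_minus[OF fd[OF w]])
    ultimately have eq: "(\<lambda>h. of_real (Re (cnj h)) * fx (cnj w) + of_real (Im (cnj h)) * fy (cnj w)) = (\<lambda>h. - (of_real (Re h) * fx w + of_real (Im h) * fy w))"
      by (rule has_derivative_unique)
    show "fx (cnj w) = - fx w" using fun_cong[OF eq, of 1] by simp
    show "fy (cnj w) = fy w" using fun_cong[OF eq, of \<i>] by simp
  qed
  have ode: "fy w + of_real (2 * lam / Im w) * u w = 0" if w: "w \<in> ball 0 r" "Im w \<noteq> 0" for w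
  proof -
    have cw: "cnj w \<in> ball 0 r" "Im (cnj w) \<noteq> 0" using w by auto
    have 1: "fx w + \<i> * (fy w + of_real (lam / Im w) * (2 * u w)) = 0"
      using fe[OF w] odd[OF w(1)] by simp
    have 2: "- fx w + \<i> * (fy w + of_real (lam / Im w) * (2 * u w)) = 0"
      using fe[OF cw] odd[OF w(1)] refl[OF w(1)] by simp
    have "2 * (\<i> * (fy w + of_real (lam / Im w) * (2 * u w))) = (fx w + \<i> * (fy w + of_real (lam / Im w) * (2 * u w))) + (- fx w + \<i> * (fy w + of_real (lam / Im w) * (2 * u w)))"
      by simp
    also have "\<dots> = 0" unfolding 1 2 by simp
    finally have 3: "2 * (\<i> * (fy w + of_real (lam / Im w) * (2 * u w))) = 0" .
    have "X = 0" if "2 * (\<i> * X) = 0" for X :: complex using that by simp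
    from this[OF 3] show ?thesis by (simp add: mult_ac)
  qed
  have upper: "u w = 0" if w: "w \<in> ball 0 r" "Im w > 0" for w
  proof -
    define x y where "x = Re w" and "y = Im w"
    have y: "y > 0" using w by (simp add: y_def)
    have pt: "Complex x t \<in> ball 0 r" if "t \<in> {0..y}" for t
    proof -
      have "t\<^sup>2 \<le> y\<^sup>2" using that by (intro power_mono) auto
      hence "norm (Complex x t) \<le> norm w" by (simp add: cmod_def x_def y_def)
      thus ?thesis using w by auto
    qed
    have x0: "u (Complex x 0) = 0"
    proof -
      have "norm (Complex x 0) < r" using pt[of 0] y by auto
      moreover have "Complex x 0 = of_real x" by (simp add: complex_eq_iff)
      ultimately show ?thesis using u0[of x] by simp
    qed
    define H where "H = (\<lambda>t. of_real (t powr (2*lam)) * u (Complex x t))"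
    have uxc: "continuous_on {0..y} (\<lambda>t. u (Complex x t))"
    proof (rule continuous_on_compose2[OF uc])
      show "continuous_on {0..y} (Complex x)" unfolding Complex_eq[abs_def] by (intro continuous_intros)
    qed (use pt in blast)
    have "((\<lambda>_. 0) has_integral (H y - H 0)) {0..y}"
    proof (rule fundamental_theorem_of_calculus_interior)
      show "continuous_on {0..y} H"
      proof (cases "lam = 0")
        case True
        have "H t = u (Complex x t)" if "t \<in> {0..y}" for t
          using that x0 True by (cases "t = 0") (auto simp: H_def)
        thus ?thesis by (intro continuous_on_eq[OF uxc]) auto
      next
        case False
        hence "continuous_on {0..y} (\<lambda>t::real. t powr (2 * lam))"
          using lam by (intro continuous_on_powr') (auto intro!: continuous_intros)
        thus ?thesis unfolding H_def by (intro continuous_on_mult continuous_on_of_real uxc)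
      qed
      fix t assume t: "t \<in> {0<..<y}"
      have p: "((\<lambda>y. complex_of_real (y powr (2*lam))) has_vector_derivative of_real (2*lam * t powr (2*lam - 1))) (at t)"
        by (rule has_vector_derivative_of_real)
          (use t in \<open>auto intro!: derivative_eq_intros simp flip: has_real_derivative_iff_has_vector_derivative\<close>)
      have "(H has_vector_derivative (of_real (t powr (2*lam)) * fy (Complex x t) + of_real (2*lam * t powr (2*lam - 1)) * u (Complex x t))) (at t)"
        unfolding H_def
        by (rule has_vector_derivative_mult[OF p has_derivative_Complex_partials(2)[OF fd[OF pt]]]) (use t in auto)
      moreover have "of_real (t powr (2*lam)) * fy (Complex x t) + of_real (2*lam * t powr (2*lam - 1)) * u (Complex x t)
         = of_real (t powr (2*lam)) * (fy (Complex x t) + of_real (2 * lam / t) * u (Complex x t))"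
        using t by (simp add: powr_diff algebra_simps)
      moreover have "fy (Complex x t) + of_real (2 * lam / t) * u (Complex x t) = 0"
        using ode[OF pt[of t]] t by simp
      ultimately show "(H has_vector_derivative 0) (at t)" by simp
    qed (use y in auto)
    hence "H y - H 0 = 0" using has_integral_unique has_integral_0 by blast
    hence "of_real (y powr (2*lam)) * u (Complex x y) = 0" using x0 by (simp add: H_def)
    thus ?thesis using y by (simp add: x_def y_def)
  qed
  consider "Im z > 0" | "Im z < 0" | "Im z = 0" by linarith
  thus ?thesis
  proof cases
    case 2
    thus ?thesis using upper[of "cnj z"] odd[OF z] z by simp
  next
    case 3
    hence "z = of_real (Re z)" by (simp add: complex_eq_iff)
    moreover have "\<bar>Re z\<bar> < r" using abs_Re_le_cmod[of z] z by simp
    ultimately show ?thesis using u0[of "Re z"] by simp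
  qed (use upper z in auto)
qed

section \<open>The reproducing formula\<close>

text \<open>
  The extension of the Cauchy kernel from a real pole to a complex point \<open>\<zeta>\<close>. For real \<open>\<zeta>\<close> the base of the
  power is \<open>|w - \<zeta>|\<^sup>2\<close>.
\<close>

definition axis_kernel :: "real \<Rightarrow> complex \<Rightarrow> complex \<Rightarrow> complex" where
  "axis_kernel lam \<zeta> w = (cnj w - \<zeta>) * ((w - \<zeta>) * (cnj w - \<zeta>)) powr (of_real (- lam - 1))"

text \<open>
  Up to the positive factor \<open>|w|\<^sup>2\<close> the base is the product of \<open>1 - \<zeta>/w\<close> and \<open>1 - \<zeta>/cnj w\<close>. Both have
  positive real part, and the product of two such numbers is never a nonpositive real.
\<close>

lemma axis_kernel_branch:
  assumes "norm \<zeta> < norm w"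
  shows "(w - \<zeta>) * (cnj w - \<zeta>) \<notin> \<real>\<^sub>\<le>\<^sub>0"
proof
  assume "(w - \<zeta>) * (cnj w - \<zeta>) \<in> \<real>\<^sub>\<le>\<^sub>0"
  have w: "w \<noteq> 0" using assms by auto
  define a b where "a = 1 - \<zeta> / w" and "b = 1 - \<zeta> / cnj w"
  have pos: "Re a > 0" "Re b > 0"
  proof -
    have "norm (\<zeta> / w) < 1" "norm (\<zeta> / cnj w) < 1" using assms w by (auto simp: norm_divide)
    thus "Re a > 0" "Re b > 0"
      using complex_Re_le_cmod[of "\<zeta> / w"] complex_Re_le_cmod[of "\<zeta> / cnj w"] unfolding a_def b_def by auto
  qed
  have "(w - \<zeta>) * (cnj w - \<zeta>) = (w * cnj w) * (a * b)"
    using w by (simp add: a_def b_def field_simps)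
  also have "w * cnj w = of_real ((norm w)\<^sup>2)" using complex_norm_square[of w] by simp
  finally have e: "(w - \<zeta>) * (cnj w - \<zeta>) = of_real ((norm w)\<^sup>2) * (a * b)" .
  then have "of_real ((norm w)\<^sup>2) * (a * b) \<in> \<real>\<^sub>\<le>\<^sub>0"
    using \<open>(w - \<zeta>) * (cnj w - \<zeta>) \<in> \<real>\<^sub>\<le>\<^sub>0\<close> by simp
  then have "Im (a * b) = 0" "Re (a * b) \<le> 0"
    using w by (auto simp: complex_nonpos_Reals_iff mult_le_0_iff)
  hence i: "Re a * Im b = - (Im a * Re b)" and r: "Re a * Re b \<le> Im a * Im b" by auto
  have "Re a * (Re b * Re b + Im b * Im b) = (Re a * Re b) * Re b + (Re a * Im b) * Im b"
    by (simp add: algebra_simps)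
  also have "\<dots> \<le> (Im a * Im b) * Re b + (Re a * Im b) * Im b"
    using r pos by (intro add_right_mono mult_right_mono) auto
  also have "\<dots> = 0" unfolding i by (simp add: algebra_simps)
  finally have "Re a * (Re b * Re b + Im b * Im b) \<le> 0" .
  moreover have "Re a * (Re b * Re b + Im b * Im b) > 0"
    using pos by (intro mult_pos_pos add_pos_nonneg) auto
  ultimately show False by simp
qed

lemma axis_kernel_real:
  assumes "\<bar>x\<bar> < norm w"
  shows "axis_kernel lam (of_real x) w = reg_kernel lam 0 x w"
proof -
  have ne: "w \<noteq> of_real x" using assms by auto
  have "(w - of_real x) * (cnj w - of_real x) = (w - of_real x) * cnj (w - of_real x)" by simp
  also have "\<dots> = of_real ((norm (w - of_real x))\<^sup>2)" by (rule complex_norm_square[symmetric])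
  finally have "(w - of_real x) * (cnj w - of_real x) = of_real ((norm (w - of_real x))\<^sup>2)" .
  moreover have "of_real ((norm (w - of_real x))\<^sup>2) powr (of_real (- lam - 1))
      = complex_of_real (((norm (w - of_real x))\<^sup>2) powr (- lam - 1))"
    by (rule powr_of_real) simp
  ultimately show ?thesis by (simp only: axis_kernel_def reg_kernel_def add_0_right) simp
qed

lemma axis_kernel_norm_le:
  assumes "0 \<le> lam" "0 < d" "norm \<zeta> + d \<le> norm w"
  shows "norm (axis_kernel lam \<zeta> w) \<le> d powr (- 2 * lam - 1)"
proof -
  have 1: "d \<le> norm (w - \<zeta>)" using assms norm_triangle_ineq2[of w \<zeta>] by linarith
  have 2: "d \<le> norm (cnj w - \<zeta>)" using assms norm_triangle_ineq2[of "cnj w" \<zeta>] by simp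
  let ?a = "norm (w - \<zeta>)" and ?b = "norm (cnj w - \<zeta>)"
  have ab: "0 < ?a" "0 < ?b" using 1 2 assms by linarith+
  have "norm (axis_kernel lam \<zeta> w) = ?b * (?a * ?b) powr (- lam - 1)"
    unfolding axis_kernel_def norm_mult by (subst norm_powr_real_powr') (auto simp: norm_mult)
  also have "\<dots> = ?a powr (- lam - 1) * (?b * ?b powr (- lam - 1))"
    using ab by (simp add: powr_mult)
  also have "?b * ?b powr (- lam - 1) = ?b powr (- lam)"
    using ab powr_add[of ?b 1 "- lam - 1"] by simp
  also have "?a powr (- lam - 1) * ?b powr (- lam) \<le> d powr (- lam - 1) * d powr (- lam)"
    using 1 2 assms by (intro mult_mono powr_mono2') auto
  also have "\<dots> = d powr (- 2 * lam - 1)" by (simp flip: powr_add)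
  finally show ?thesis .
qed

definition axis_kernel_deriv :: "real \<Rightarrow> complex \<Rightarrow> complex \<Rightarrow> complex" where
  "axis_kernel_deriv lam \<zeta> w = (let q = (w - \<zeta>) * (cnj w - \<zeta>) in
     - (q powr (of_real (- lam - 1)))
     + (cnj w - \<zeta>) * (of_real (- lam - 1) * q powr (of_real (- lam - 1) - 1) * (- (cnj w - \<zeta>) - (w - \<zeta>))))"

lemma axis_kernel_has_derivative:
  assumes "norm \<zeta> < norm w"
  shows "((\<lambda>\<zeta>. axis_kernel lam \<zeta> w) has_field_derivative axis_kernel_deriv lam \<zeta> w) (at \<zeta>)"
proof -
  have q: "((\<lambda>\<zeta>. (w - \<zeta>) * (cnj w - \<zeta>)) has_field_derivative (- (cnj w - \<zeta>) - (w - \<zeta>))) (at \<zeta>)"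
    by (auto intro!: derivative_eq_intros)
  have p: "((\<lambda>\<zeta>. ((w - \<zeta>) * (cnj w - \<zeta>)) powr (of_real (- lam - 1))) has_field_derivative
      (of_real (- lam - 1) * ((w - \<zeta>) * (cnj w - \<zeta>)) powr (of_real (- lam - 1) - 1) * (- (cnj w - \<zeta>) - (w - \<zeta>)))) (at \<zeta>)"
    by (rule DERIV_chain2[OF has_field_derivative_powr[OF axis_kernel_branch[OF assms]] q])
  have l: "((\<lambda>\<zeta>. cnj w - \<zeta>) has_field_derivative -1) (at \<zeta>)"
    by (auto intro!: derivative_eq_intros)
  show ?thesis unfolding axis_kernel_def axis_kernel_deriv_def Let_def
    by (rule DERIV_cong[OF DERIV_mult[OF l p]]) (simp add: mult.commute)
qed

lemma axis_kernel_continuous: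
  assumes "\<And>p. p \<in> S \<Longrightarrow> norm (fst p) < norm (snd p)"
  shows "continuous_on S (\<lambda>p. axis_kernel lam (fst p) (snd p))"
    and "continuous_on S (\<lambda>p. axis_kernel_deriv lam (fst p) (snd p))"
proof -
  define q where "q = (\<lambda>p. (snd p - fst p) * (cnj (snd p) - fst p))"
  have qc: "continuous_on S q" unfolding q_def by (intro continuous_intros)
  have qn: "q p \<notin> \<real>\<^sub>\<le>\<^sub>0" if "p \<in> S" for p
    unfolding q_def by (rule axis_kernel_branch[OF assms[OF that]])
  have pw: "continuous_on S (\<lambda>p. q p powr c)" for c
  proof (rule continuous_on_eq[of _ "\<lambda>p. exp (c * Ln (q p))"])
    show "continuous_on S (\<lambda>p. exp (c * Ln (q p)))"
      using qc qn by (intro continuous_on_exp continuous_on_mult continuous_on_const continuous_on_Ln') auto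
    show "exp (c * Ln (q p)) = q p powr c" if "p \<in> S" for p
      using qn[OF that] by (auto simp: powr_def)
  qed
  have "continuous_on S (\<lambda>p. (cnj (snd p) - fst p) * q p powr (of_real (- lam - 1)))"
    by (intro continuous_on_mult pw continuous_on_diff continuous_on_cnj continuous_on_snd continuous_on_fst continuous_on_id)
  thus "continuous_on S (\<lambda>p. axis_kernel lam (fst p) (snd p))"
    by (simp only: axis_kernel_def q_def)
  have "continuous_on S (\<lambda>p. - (q p powr (of_real (- lam - 1))) + (cnj (snd p) - fst p)
      * (of_real (- lam - 1) * q p powr (of_real (- lam - 1) - 1) * (- (cnj (snd p) - fst p) - (snd p - fst p))))"
    by (intro continuous_on_add continuous_on_minus continuous_on_mult pw continuous_on_diff continuous_on_cnj
        continuous_on_snd continuous_on_fst continuous_on_id continuous_on_const)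
  thus "continuous_on S (\<lambda>p. axis_kernel_deriv lam (fst p) (snd p))"
    by (simp only: axis_kernel_deriv_def q_def Let_def)
qed

text \<open>
  The derivative of a radial cut-off, as a function of \<open>|w|\<^sup>2\<close>. It is supported in the annulus
  \<open>a \<le> |w| \<le> b\<close>, and \<open>annulus_mass\<close> is its integral. The cut-off itself then has the value
  \<open>- annulus_mass a b\<close> on the disk of radius \<open>a\<close>, which accounts for the normalisation of \<open>axis_transform\<close>.
\<close>

definition annulus_profile :: "real \<Rightarrow> real \<Rightarrow> real \<Rightarrow> real" where
  "annulus_profile a b t = max 0 (t - a\<^sup>2) * max 0 (b\<^sup>2 - t)"

definition annulus_mass :: "real \<Rightarrow> real \<Rightarrow> real" where
  "annulus_mass a b = (b\<^sup>2 - a\<^sup>2) ^ 3 / 6"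

definition axis_transform :: "real \<Rightarrow> real \<Rightarrow> real \<Rightarrow> (complex \<Rightarrow> complex) \<Rightarrow> complex \<Rightarrow> complex" where
  "axis_transform lam a b f \<zeta> = of_real (2 / (pole_constant lam * annulus_mass a b)) *
     (\<integral>w. f w * (axis_kernel lam \<zeta> w * (w * of_real (annulus_profile a b ((norm w)\<^sup>2)))) \<partial>sigma_lambda lam)"

lemma annulus_profile_zero:
  assumes "0 < a" "a < b" "norm w \<le> a \<or> b \<le> norm w"
  shows "annulus_profile a b ((norm (w::complex))\<^sup>2) = 0"
  using assms(3)
proof
  assume "norm w \<le> a"
  hence "(norm w)\<^sup>2 \<le> a\<^sup>2" by (intro power_mono) auto
  thus ?thesis by (simp add: annulus_profile_def)
next
  assume "b \<le> norm w"
  hence "b\<^sup>2 \<le> (norm w)\<^sup>2" using assms by (intro power_mono) auto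
  thus ?thesis by (simp add: annulus_profile_def)
qed

lemma annulus_profile_bounds:
  assumes "0 < a" "a < b" "b \<le> 1"
  shows "0 \<le> annulus_profile a b t" "annulus_profile a b t \<le> 1"
proof -
  have "a\<^sup>2 < b\<^sup>2" "b\<^sup>2 \<le> 1" using assms by (auto intro!: power_strict_mono power_le_one)
  show "0 \<le> annulus_profile a b t" by (simp add: annulus_profile_def)
  show "annulus_profile a b t \<le> 1"
  proof (cases "a\<^sup>2 \<le> t \<and> t \<le> b\<^sup>2")
    case True
    hence "(t - a\<^sup>2) * (b\<^sup>2 - t) \<le> 1 * 1"
      using \<open>b\<^sup>2 \<le> 1\<close> zero_le_power2[of a] by (intro mult_mono) linarith+
    thus ?thesis using True by (simp add: annulus_profile_def)
  qed (auto simp: annulus_profile_def)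
qed

lemma annulus_mass_pos: "0 < a \<Longrightarrow> a < b \<Longrightarrow> 0 < annulus_mass a b"
  unfolding annulus_mass_def by (auto intro!: power_strict_mono)

lemma annulus_integrable:
  assumes lam: "0 \<le> lam" and ab: "0 < a" "a < b" and G: "continuous_on {w. a \<le> norm w \<and> norm w \<le> b} G"
  shows "integrable (sigma_lambda lam) (\<lambda>w. G w * of_real (annulus_profile a b ((norm w)\<^sup>2)) :: complex)"
proof -
  let ?A = "{w::complex. a \<le> norm w \<and> norm w \<le> b}"
  have "?A = cball 0 b - ball 0 a" by auto
  hence cA: "compact ?A" using compact_diff[of "cball (0::complex) b" "ball 0 a"] by simp
  have "continuous_on ?A (\<lambda>w. G w * of_real (annulus_profile a b ((norm w)\<^sup>2)))"
    unfolding annulus_profile_def by (intro continuous_intros G)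
  from continuous_integrable_sigma[OF lam cA this]
  have "integrable (sigma_lambda lam) (\<lambda>w. indicat_real ?A w *\<^sub>R (G w * of_real (annulus_profile a b ((norm w)\<^sup>2))))" .
  moreover have "(\<lambda>w. indicat_real ?A w *\<^sub>R (G w * of_real (annulus_profile a b ((norm w)\<^sup>2)))) = (\<lambda>w. G w * of_real (annulus_profile a b ((norm w)\<^sup>2)))"
    using annulus_profile_zero[OF ab] by (fastforce simp: indicator_def fun_eq_iff)
  ultimately show ?thesis by simp
qed

lemma axis_transform_integrable:
  assumes lam: "0 \<le> lam" and ab: "0 < a" "a < b" and f: "continuous_on (cball 0 b) f" and z: "norm \<zeta> < a"
  shows "integrable (sigma_lambda lam) (\<lambda>w. f w * (axis_kernel lam \<zeta> w * (w * of_real (annulus_profile a b ((norm w)\<^sup>2)))))"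
    and "integrable (sigma_lambda lam) (\<lambda>w. f w * (axis_kernel_deriv lam \<zeta> w * (w * of_real (annulus_profile a b ((norm w)\<^sup>2)))))"
proof -
  let ?A = "{w::complex. a \<le> norm w \<and> norm w \<le> b}"
  have fA: "continuous_on ?A f" by (rule continuous_on_subset[OF f]) auto
  have pc: "continuous_on ?A (\<lambda>w. (\<zeta>, w))" by (intro continuous_intros)
  have "continuous_on ?A (\<lambda>w. axis_kernel lam (fst (\<zeta>, w)) (snd (\<zeta>, w)))"
    by (rule continuous_on_compose2[OF axis_kernel_continuous(1)[of "Pair \<zeta> ` ?A"] pc]) (use z in auto)
  hence k1: "continuous_on ?A (axis_kernel lam \<zeta>)" by simp
  have "continuous_on ?A (\<lambda>w. axis_kernel_deriv lam (fst (\<zeta>, w)) (snd (\<zeta>, w)))"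
    by (rule continuous_on_compose2[OF axis_kernel_continuous(2)[of "Pair \<zeta> ` ?A"] pc]) (use z in auto)
  hence k2: "continuous_on ?A (axis_kernel_deriv lam \<zeta>)" by simp
  show "integrable (sigma_lambda lam) (\<lambda>w. f w * (axis_kernel lam \<zeta> w * (w * of_real (annulus_profile a b ((norm w)\<^sup>2)))))"
    using annulus_integrable[OF lam ab, of "\<lambda>w. f w * (axis_kernel lam \<zeta> w * w)"] fA k1
    by (simp add: mult.assoc continuous_on_mult continuous_on_id)
  show "integrable (sigma_lambda lam) (\<lambda>w. f w * (axis_kernel_deriv lam \<zeta> w * (w * of_real (annulus_profile a b ((norm w)\<^sup>2)))))"
    using annulus_integrable[OF lam ab, of "\<lambda>w. f w * (axis_kernel_deriv lam \<zeta> w * w)"] fA k2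
    by (simp add: mult.assoc continuous_on_mult continuous_on_id)
qed

text \<open>
  The derivative in \<open>\<zeta>\<close> falls on the kernel, not on \<open>f\<close>. So the transform can be applied to a locally
  uniform limit before anything is known about its derivatives.
\<close>

lemma axis_transform_holomorphic:
  assumes lam: "0 \<le> lam" and ab: "0 < a" "a < b" and f: "continuous_on (cball 0 b) f"
  shows "axis_transform lam a b f holomorphic_on ball 0 a"
proof -
  let ?p = "\<lambda>w::complex. w * of_real (annulus_profile a b ((norm w)\<^sup>2))"
  let ?I = "\<lambda>\<zeta>. \<integral>w. f w * (axis_kernel lam \<zeta> w * ?p w) \<partial>sigma_lambda lam"
  have Dz: "(?I has_field_derivative (\<integral>w. f w * (axis_kernel_deriv lam z w * ?p w) \<partial>sigma_lambda lam)) (at z)" if z: "norm z < a" for z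
  proof -
    define r where "r = (norm z + a) / 2"
    have r: "norm z < r" "r < a" using z by (auto simp: r_def)
    let ?C = "cball (0::complex) r \<times> {w::complex. a \<le> norm w \<and> norm w \<le> b}"
    have "{w::complex. a \<le> norm w \<and> norm w \<le> b} = cball 0 b - ball 0 a" by auto
    hence cA: "compact {w::complex. a \<le> norm w \<and> norm w \<le> b}" using compact_diff[of "cball (0::complex) b" "ball 0 a"] by simp
    have "compact ?C" by (intro compact_Times cA) simp
    moreover have "continuous_on ?C (\<lambda>p. axis_kernel_deriv lam (fst p) (snd p))"
      by (rule axis_kernel_continuous) (use r in auto)
    ultimately obtain L where L0: "0 \<le> L" and "\<And>p. p \<in> ?C \<Longrightarrow> norm (axis_kernel_deriv lam (fst p) (snd p)) \<le> L"
      using continuous_on_compact_bound by blast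
    hence L: "norm (axis_kernel_deriv lam \<zeta> w) \<le> L" if "norm \<zeta> \<le> r" "a \<le> norm w" "norm w \<le> b" for \<zeta> w
      using that by force
    obtain B0 where B00: "0 \<le> B0" and "\<And>w. w \<in> cball 0 b \<Longrightarrow> norm (f w) \<le> B0"
      using continuous_on_compact_bound[OF compact_cball f] by blast
    hence B0: "norm (f w) \<le> B0" if "norm w \<le> b" for w using that by simp
    define B where "B = (\<lambda>w::complex. L * B0 * b * annulus_profile a b ((norm w)\<^sup>2))"
    have pn: "0 \<le> annulus_profile a b t" for t by (simp add: annulus_profile_def)
    have fac: "norm (f w * (c * ?p w)) \<le> B w * x"
      if "norm c \<le> L * x" "a < norm w" "norm w < b" "0 \<le> x" for c x w
    proof -
      have "norm (f w * (c * ?p w)) = (norm (f w) * (norm c * norm w)) * annulus_profile a b ((norm w)\<^sup>2)"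
        using pn by (simp add: norm_mult)
      also have "\<dots> \<le> (B0 * ((L * x) * b)) * annulus_profile a b ((norm w)\<^sup>2)"
        using B0[of w] that ab pn L0 B00 by (intro mult_right_mono mult_mono) auto
      finally show ?thesis by (simp add: B_def mult_ac)
    qed
    have zero: "?p w = 0" "B w = 0" if "\<not> (a < norm w \<and> norm w < b)" for w
      using annulus_profile_zero[OF ab, of w] that by (auto simp: B_def)
    have D: "(?I has_derivative (\<lambda>h. \<integral>w. f w * ((h * axis_kernel_deriv lam z w) * ?p w) \<partial>sigma_lambda lam)) (at z)"
    proof (rule has_derivative_integral_param[where U = "ball 0 r" and B = B])
      show "integrable (sigma_lambda lam) (\<lambda>w. f w * (axis_kernel lam \<zeta> w * ?p w))" if "\<zeta> \<in> ball 0 r" for \<zeta>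
        by (rule axis_transform_integrable(1)[OF lam ab f]) (use that r in auto)
      show "integrable (sigma_lambda lam) (\<lambda>w. f w * ((h * axis_kernel_deriv lam z w) * ?p w))" for h
        using integrable_mult_right[OF axis_transform_integrable(2)[OF lam ab f z], of h] by (simp add: mult_ac)
      have "integrable (sigma_lambda lam) (\<lambda>w. of_real (L * B0 * b) * of_real (annulus_profile a b ((norm w)\<^sup>2)) :: complex)"
        by (rule annulus_integrable[OF lam ab]) (intro continuous_intros)
      thus "integrable (sigma_lambda lam) B" unfolding B_def of_real_mult[symmetric] by (simp only: complex_of_real_integrable_eq)
      show "((\<lambda>\<zeta>. f w * (axis_kernel lam \<zeta> w * ?p w)) has_derivative (\<lambda>h. f w * ((h * axis_kernel_deriv lam z w) * ?p w))) (at z)" for w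
      proof (cases "a < norm w \<and> norm w < b")
        case True
        have "((\<lambda>\<zeta>. axis_kernel lam \<zeta> w) has_derivative (\<lambda>h. h * axis_kernel_deriv lam z w)) (at z)"
          using axis_kernel_has_derivative[of z w lam] True z unfolding has_field_derivative_def
          by (auto elim!: has_derivative_eq_rhs simp: fun_eq_iff mult.commute)
        thus ?thesis by (intro has_derivative_mult_right has_derivative_mult_left)
      next
        case False
        show ?thesis unfolding zero(1)[OF False] by simp
      qed
      show "norm (f w * (axis_kernel lam \<zeta> w * ?p w) - f w * (axis_kernel lam z w * ?p w)) \<le> B w * norm (\<zeta> - z)" if "\<zeta> \<in> ball 0 r" for \<zeta> w
      proof (cases "a < norm w \<and> norm w < b")
        case True
        have "norm (axis_kernel lam \<zeta> w - axis_kernel lam z w) \<le> L * norm (\<zeta> - z)"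
        proof (rule field_differentiable_bound[of "cball 0 r" "\<lambda>\<zeta>. axis_kernel lam \<zeta> w" "\<lambda>\<zeta>. axis_kernel_deriv lam \<zeta> w"])
          show "((\<lambda>\<zeta>. axis_kernel lam \<zeta> w) has_field_derivative axis_kernel_deriv lam v w) (at v within cball 0 r)" if "v \<in> cball 0 r" for v
            by (rule has_field_derivative_at_within[OF axis_kernel_has_derivative]) (use that r True in auto)
        qed (use that r True L in auto)
        from fac[OF this] True have "norm (f w * ((axis_kernel lam \<zeta> w - axis_kernel lam z w) * ?p w)) \<le> B w * norm (\<zeta> - z)" by simp
        moreover have "f w * (axis_kernel lam \<zeta> w * ?p w) - f w * (axis_kernel lam z w * ?p w) = f w * ((axis_kernel lam \<zeta> w - axis_kernel lam z w) * ?p w)"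
          by (simp only: left_diff_distrib right_diff_distrib)
        ultimately show ?thesis by simp
      next
        case False
        show ?thesis unfolding zero[OF False] by simp
      qed
      show "norm (f w * ((h * axis_kernel_deriv lam z w) * ?p w)) \<le> B w * norm h" for h w
      proof (cases "a < norm w \<and> norm w < b")
        case True
        have "norm (h * axis_kernel_deriv lam z w) \<le> L * norm h"
          using mult_left_mono[OF L[of z w], of "norm h"] True r by (simp add: norm_mult mult.commute)
        thus ?thesis using fac True by simp
      next
        case False
        show ?thesis unfolding zero[OF False] by simp
      qed
    qed (use r in auto)
    have "(\<lambda>h. \<integral>w. f w * ((h * axis_kernel_deriv lam z w) * ?p w) \<partial>sigma_lambda lam)
        = (\<lambda>h. (\<integral>w. f w * (axis_kernel_deriv lam z w * ?p w) \<partial>sigma_lambda lam) * h)"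
    proof
      fix h
      have "(\<integral>w. f w * ((h * axis_kernel_deriv lam z w) * ?p w) \<partial>sigma_lambda lam)
        = (\<integral>w. h * (f w * (axis_kernel_deriv lam z w * ?p w)) \<partial>sigma_lambda lam)"
        by (rule Bochner_Integration.integral_cong) (simp_all only: mult_ac)
      thus "(\<integral>w. f w * ((h * axis_kernel_deriv lam z w) * ?p w) \<partial>sigma_lambda lam)
        = (\<integral>w. f w * (axis_kernel_deriv lam z w * ?p w) \<partial>sigma_lambda lam) * h"
        by (simp only: integral_mult_right_zero mult.commute)
    qed
    with D show ?thesis unfolding has_field_derivative_def by (simp only:)
  qed
  have "?I holomorphic_on ball 0 a"
    unfolding holomorphic_on_open[OF open_ball]
  proof
    fix z :: complex assume "z \<in> ball 0 a"
    hence "norm z < a" by simp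
    from Dz[OF this] show "\<exists>f'. (?I has_field_derivative f') (at z)" by (rule exI)
  qed
  thus ?thesis unfolding axis_transform_def[abs_def] by (intro holomorphic_intros)
qed

lemma axis_transform_norm_le:
  assumes lam: "0 \<le> lam" and ab: "0 < a" "a < b" "b \<le> 1" and f: "continuous_on (cball 0 b) f"
    and d: "0 < d" "norm \<zeta> + d \<le> a"
  shows "norm (axis_transform lam a b f \<zeta>) \<le> 2 / (pole_constant lam * annulus_mass a b) * d powr (- 2 * lam - 1) *
     (\<integral>w. indicat_real (cball 0 b) w * norm (f w) \<partial>sigma_lambda lam)"
proof -
  let ?D = "d powr (- 2 * lam - 1)"
  have pc: "0 < pole_constant lam * annulus_mass a b"
    using pole_constant_pos[OF lam] annulus_mass_pos[OF ab(1,2)] by simp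
  have int: "integrable (sigma_lambda lam) (\<lambda>w. indicat_real (cball 0 b) w * norm (f w))"
    using continuous_integrable_sigma[OF lam compact_cball continuous_on_norm[OF f]] by simp
  have "norm (\<integral>w. f w * (axis_kernel lam \<zeta> w * (w * of_real (annulus_profile a b ((norm w)\<^sup>2)))) \<partial>sigma_lambda lam)
     \<le> (\<integral>w. ?D * (indicat_real (cball 0 b) w * norm (f w)) \<partial>sigma_lambda lam)"
  proof (rule norm_integral_le)
    show "integrable (sigma_lambda lam) (\<lambda>w. f w * (axis_kernel lam \<zeta> w * (w * of_real (annulus_profile a b ((norm w)\<^sup>2)))))"
      by (rule axis_transform_integrable(1)[OF lam ab(1,2) f]) (use d in auto)
    show "integrable (sigma_lambda lam) (\<lambda>w. ?D * (indicat_real (cball 0 b) w * norm (f w)))"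
      by (intro integrable_mult_right int)
    fix w
    show "norm (f w * (axis_kernel lam \<zeta> w * (w * of_real (annulus_profile a b ((norm w)\<^sup>2))))) \<le> ?D * (indicat_real (cball 0 b) w * norm (f w))"
    proof (cases "a < norm w \<and> norm w < b")
      case True
      have k: "norm (axis_kernel lam \<zeta> w) \<le> ?D"
        by (rule axis_kernel_norm_le[OF lam d(1)]) (use d True in linarith)
      have "norm w * annulus_profile a b ((norm w)\<^sup>2) \<le> 1 * 1"
        using True ab annulus_profile_bounds[OF ab] by (intro mult_mono) auto
      hence "norm (axis_kernel lam \<zeta> w) * (norm w * annulus_profile a b ((norm w)\<^sup>2)) \<le> ?D * 1"
        using k annulus_profile_bounds[OF ab] by (intro mult_mono) auto
      hence "norm (f w) * (norm (axis_kernel lam \<zeta> w) * (norm w * annulus_profile a b ((norm w)\<^sup>2))) \<le> norm (f w) * ?D"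
        by (intro mult_left_mono) auto
      thus ?thesis using True annulus_profile_bounds(1)[OF ab, of "(norm w)\<^sup>2"] by (simp add: norm_mult mult.commute)
    next
      case False
      thus ?thesis using annulus_profile_zero[OF ab(1,2), of w] by auto
    qed
  qed
  hence "norm (axis_transform lam a b f \<zeta>) \<le> 2 / (pole_constant lam * annulus_mass a b) *
      (\<integral>w. ?D * (indicat_real (cball 0 b) w * norm (f w)) \<partial>sigma_lambda lam)"
    unfolding axis_transform_def norm_mult norm_of_real using pc
    by (intro mult_mono) (auto simp: less_imp_le)
  thus ?thesis by (simp only: integral_mult_right_zero mult.assoc)
qed

text \<open>
  By the Cauchy-Pompeiu formula \<open>f\<close> and its transform agree on the real axis, and the intertwining operator
  keeps the values there. So the difference of the two sides is a solution that vanishes on the axis.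
\<close>

theorem dunkl_representation:
  assumes lam: "0 \<le> lam" and f: "dunkl_holomorphic lam (ball 0 R) f" and ab: "0 < a" "a < b" "b < R"
    and z: "z \<in> ball 0 a"
  shows "f z = intertwine lam (axis_transform lam a b f) z"
proof -
  let ?g = "axis_transform lam a b f"
  let ?k = "annulus_profile a b"
  have fc: "continuous_on (cball 0 b) f"
    by (rule continuous_on_subset[OF dunkl_holomorphic_continuous_on[OF f]]) (use ab in auto)
  have gh: "?g holomorphic_on ball 0 a" by (rule axis_transform_holomorphic[OF lam ab(1,2) fc])
  have kc: "continuous_on UNIV ?k" unfolding annulus_profile_def[abs_def] by (intro continuous_intros)
  have kT: "?k t = 0" if "t \<ge> b\<^sup>2" for t using that by (simp add: annulus_profile_def)
  obtain h where h: "\<And>t. (h has_real_derivative ?k t) (at t)" and hT: "\<And>t. t \<ge> b\<^sup>2 \<Longrightarrow> h t = 0"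
    using antiderivative_vanishing[OF kc kT] by blast
  have a2b2: "a\<^sup>2 < b\<^sup>2" using ab by (intro power_strict_mono) auto
  have ha: "h (a\<^sup>2) = - annulus_mass a b"
  proof -
    \<comment> \<open>a primitive of the profile on its support\<close>
    define P where "P = (\<lambda>t. (b\<^sup>2 - a\<^sup>2) * (t - a\<^sup>2)\<^sup>2 / 2 - (t - a\<^sup>2) ^ 3 / 3)"
    have "(?k has_integral (h (b\<^sup>2) - h (a\<^sup>2))) {a\<^sup>2..b\<^sup>2}"
      by (rule fundamental_theorem_of_calculus)
        (use a2b2 h in \<open>auto intro: has_field_derivative_at_within simp flip: has_real_derivative_iff_has_vector_derivative\<close>)
    moreover have "(?k has_integral (P (b\<^sup>2) - P (a\<^sup>2))) {a\<^sup>2..b\<^sup>2}"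
    proof (rule fundamental_theorem_of_calculus)
      fix t assume t: "t \<in> {a\<^sup>2..b\<^sup>2}"
      have "(P has_real_derivative ((b\<^sup>2 - a\<^sup>2) * (t - a\<^sup>2) - (t - a\<^sup>2)\<^sup>2)) (at t)"
        unfolding P_def by (auto intro!: derivative_eq_intros)
      moreover have "(b\<^sup>2 - a\<^sup>2) * (t - a\<^sup>2) - (t - a\<^sup>2)\<^sup>2 = ?k t"
        using t by (simp add: annulus_profile_def power2_eq_square algebra_simps)
      ultimately have "(P has_real_derivative ?k t) (at t)" by simp
      thus "(P has_vector_derivative ?k t) (at t within {a\<^sup>2..b\<^sup>2})"
        by (simp add: has_real_derivative_iff_has_vector_derivative has_vector_derivative_at_within)
    qed (use a2b2 in simp)
    ultimately have "h (b\<^sup>2) - h (a\<^sup>2) = P (b\<^sup>2) - P (a\<^sup>2)" by (rule has_integral_unique)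
    also have "\<dots> = annulus_mass a b"
      by (simp add: P_def annulus_mass_def power2_eq_square power3_eq_cube field_simps)
    finally show ?thesis using hT[of "b\<^sup>2"] by simp
  qed
  have h_low: "h t = - annulus_mass a b" if "t \<le> a\<^sup>2" for t
  proof (cases "t = a\<^sup>2")
    case False
    hence "t < a\<^sup>2" using that by simp
    from MVT2[OF this, of h ?k] h obtain s where "s < a\<^sup>2" "h (a\<^sup>2) - h t = (a\<^sup>2 - t) * ?k s" by auto
    thus ?thesis using ha by (simp add: annulus_profile_def)
  qed (use ha in simp)
  have axis: "?g (of_real x) = f (of_real x)" if x: "\<bar>x\<bar> < a" for x
  proof -
    define d where "d = (a - \<bar>x\<bar>)"
    have d: "0 < d" using x by (simp add: d_def)
    have bd: "norm (w - of_real 0) * \<bar>?k ((norm (w - of_real 0))\<^sup>2)\<bar> \<le> (b * (b\<^sup>2 * b\<^sup>2)) / d powr (2 * lam + 1) * norm (w - of_real x) powr (2 * lam + 1)" for w :: complex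
    proof (cases "a < norm w \<and> norm w < b")
      case True
      have dw: "d \<le> norm (w - of_real x)" using True norm_triangle_ineq2[of w "of_real x"] by (simp add: d_def)
      hence p: "d powr (2 * lam + 1) \<le> norm (w - of_real x) powr (2 * lam + 1)" using d lam by (intro powr_mono2) auto
      have w2: "a\<^sup>2 \<le> (norm w)\<^sup>2" "(norm w)\<^sup>2 \<le> b\<^sup>2" using True ab by (auto intro!: power_mono)
      have "?k ((norm w)\<^sup>2) \<le> b\<^sup>2 * b\<^sup>2"
        unfolding annulus_profile_def
      proof (rule mult_mono)
        show "max 0 ((norm w)\<^sup>2 - a\<^sup>2) \<le> b\<^sup>2" "max 0 (b\<^sup>2 - (norm w)\<^sup>2) \<le> b\<^sup>2"
          using w2 zero_le_power2[of a] zero_le_power2[of "norm w"] zero_le_power2[of b]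
          by (intro max.boundedI; linarith)+
      qed auto
      hence "norm w * \<bar>?k ((norm w)\<^sup>2)\<bar> \<le> b * (b\<^sup>2 * b\<^sup>2)"
        using True ab by (intro mult_mono) (auto simp: annulus_profile_def)
      also have "\<dots> = (b * (b\<^sup>2 * b\<^sup>2)) / d powr (2 * lam + 1) * d powr (2 * lam + 1)" using d by simp
      also have "\<dots> \<le> (b * (b\<^sup>2 * b\<^sup>2)) / d powr (2 * lam + 1) * norm (w - of_real x) powr (2 * lam + 1)"
        using p ab by (intro mult_left_mono) auto
      finally show ?thesis by simp
    next
      case False
      hence "?k ((norm w)\<^sup>2) = 0" using annulus_profile_zero[OF ab(1,2), of w] by auto
      thus ?thesis using ab by simp
    qed
    have A: "of_real (pole_constant lam * h ((x - 0)\<^sup>2)) * f (of_real x)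
     = - (\<integral>w. f w * (reg_kernel lam 0 x w * (2 * (w - of_real 0) * of_real (?k ((norm (w - of_real 0))\<^sup>2)))) \<partial>sigma_lambda lam)"
      by (rule pompeiu_real_axis[OF lam f h kc hT kT _ _ bd]) (use ab in auto)
    have H: "h ((x - 0)\<^sup>2) = - annulus_mass a b"
    proof (rule h_low)
      have "\<bar>x\<bar>\<^sup>2 \<le> a\<^sup>2" using x by (intro power_mono) auto
      thus "(x - 0)\<^sup>2 \<le> a\<^sup>2" by simp
    qed
    have Iw: "f w * (reg_kernel lam 0 x w * (2 * (w - of_real 0) * of_real (?k ((norm (w - of_real 0))\<^sup>2))))
       = 2 * (f w * (axis_kernel lam (of_real x) w * (w * of_real (?k ((norm w)\<^sup>2)))))" for w
    proof (cases "a < norm w")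
      case True
      thus ?thesis using axis_kernel_real[of x w lam] x by simp
    next
      case False
      hence "?k ((norm w)\<^sup>2) = 0" using annulus_profile_zero[OF ab(1,2), of w] by auto
      thus ?thesis by simp
    qed
    have I: "(\<integral>w. f w * (reg_kernel lam 0 x w * (2 * (w - of_real 0) * of_real (?k ((norm (w - of_real 0))\<^sup>2)))) \<partial>sigma_lambda lam)
      = (\<integral>w. 2 * (f w * (axis_kernel lam (of_real x) w * (w * of_real (?k ((norm w)\<^sup>2))))) \<partial>sigma_lambda lam)"
      by (rule Bochner_Integration.integral_cong) (simp_all only: Iw)
    have "of_real (pole_constant lam * annulus_mass a b) * f (of_real x)
      = 2 * (\<integral>w. f w * (axis_kernel lam (of_real x) w * (w * of_real (?k ((norm w)\<^sup>2)))) \<partial>sigma_lambda lam)"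
      using A unfolding H I integral_mult_right_zero by simp
    moreover have "pole_constant lam * annulus_mass a b \<noteq> 0"
      using pole_constant_pos[OF lam] annulus_mass_pos[OF ab(1,2)] by simp
    ultimately show ?thesis unfolding axis_transform_def by (simp add: field_simps)
  qed
  have "(\<lambda>z. f z - intertwine lam ?g z) z = 0"
  proof (rule dunkl_unique[OF lam _ _ z])
    show "dunkl_holomorphic lam (ball 0 a) (\<lambda>z. f z - intertwine lam ?g z)"
      by (intro dunkl_holomorphic_diff dunkl_holomorphic_subset[OF f] intertwine_lambda_analytic(3)[OF lam gh]) (use ab in auto)
    show "f (of_real x) - intertwine lam ?g (of_real x) = 0" if "\<bar>x\<bar> < a" for x
      using axis[OF that] by (simp add: intertwine_real[OF lam])
  qed
  thus ?thesis by simp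
qed


section \<open>Point evaluations are controlled by the norm\<close>

text \<open>
  Constant and exponent of the pointwise bound. For an annulus of radii \<open>|z| + e\<close> and \<open>|z| + 2 e\<close> the kernel
  costs the power \<open>2 \<lambda> + 1\<close> of \<open>1/e\<close>, and the mass of the profile, at least \<open>e\<^sup>6 / 6\<close>, costs six more.
\<close>

definition sup_const :: "real \<Rightarrow> real" where
  "sup_const lam = 12 / pole_constant lam"

definition sup_exp :: "real \<Rightarrow> real" where
  "sup_exp lam = 2 * lam + 7"

lemma sup_const_pos: "0 \<le> lam \<Longrightarrow> 0 < sup_const lam"
  unfolding sup_const_def using pole_constant_pos by simp

lemma dunkl_point_bound:
  assumes lam: "0 \<le> lam" and f: "dunkl_holomorphic lam (ball 0 1) f" and e: "0 < e" "norm z + 2 * e < 1"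
  shows "norm (f z) \<le> sup_const lam * e powr (- sup_exp lam) *
     (\<integral>w. indicat_real (cball 0 (norm z + 2 * e)) w * norm (f w) \<partial>sigma_lambda lam)"
proof -
  define a b where "a = norm z + e" and "b = norm z + 2 * e"
  have ab: "0 < a" "a < b" "b < 1" using e norm_ge_zero[of z] by (auto simp: a_def b_def add_nonneg_pos)
  have fc: "continuous_on (cball 0 b) f"
    by (rule continuous_on_subset[OF dunkl_holomorphic_continuous_on[OF f]]) (use ab in auto)
  let ?J = "\<integral>w. indicat_real (cball 0 b) w * norm (f w) \<partial>sigma_lambda lam"
  have J: "0 \<le> ?J" by (intro Bochner_Integration.integral_nonneg) auto
  have gh: "axis_transform lam a b f holomorphic_on ball 0 a" by (rule axis_transform_holomorphic[OF lam ab(1,2) fc])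
  have z: "z \<in> ball 0 a" using e by (simp add: a_def)
  have "norm (f z) = norm (intertwine lam (axis_transform lam a b f) z)"
    using dunkl_representation[OF lam f ab z] by simp
  also have "\<dots> \<le> 2 / (pole_constant lam * annulus_mass a b) * e powr (- 2 * lam - 1) * ?J"
  proof (rule intertwine_norm_le[OF lam holomorphic_on_imp_continuous_on[OF gh] z])
    show "norm (axis_transform lam a b f w) \<le> 2 / (pole_constant lam * annulus_mass a b) * e powr (- 2 * lam - 1) * ?J"
      if "norm w \<le> norm z" for w
      by (rule axis_transform_norm_le[OF lam ab(1,2) _ fc e(1)]) (use that ab in \<open>auto simp: a_def\<close>)
  qed
  also have "\<dots> \<le> (sup_const lam * e powr (- 6)) * e powr (- 2 * lam - 1) * ?J"
  proof (intro mult_right_mono J)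
    have "e\<^sup>2 \<le> b\<^sup>2 - a\<^sup>2"
    proof -
      have "b\<^sup>2 - a\<^sup>2 = e * (2 * norm z + 3 * e)" by (simp add: a_def b_def power2_eq_square algebra_simps)
      moreover have "e * e \<le> e * (2 * norm z + 3 * e)" using e norm_ge_zero[of z] by (intro mult_left_mono) auto
      ultimately show ?thesis by (simp add: power2_eq_square)
    qed
    hence "(e\<^sup>2) ^ 3 \<le> (b\<^sup>2 - a\<^sup>2) ^ 3" by (intro power_mono) auto
    hence m: "e ^ 6 / 6 \<le> annulus_mass a b" by (simp add: annulus_mass_def flip: power_mult)
    have p: "0 < pole_constant lam" by (rule pole_constant_pos[OF lam])
    have "2 / (pole_constant lam * annulus_mass a b) \<le> 2 / (pole_constant lam * (e ^ 6 / 6))"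
      using m p e by (intro divide_left_mono mult_left_mono mult_pos_pos annulus_mass_pos ab) auto
    also have "\<dots> = sup_const lam * e powr (- 6)"
      using e p by (simp add: sup_const_def powr_minus field_simps)
    finally show "2 / (pole_constant lam * annulus_mass a b) \<le> sup_const lam * e powr (- 6)" .
  qed auto
  also have "(sup_const lam * e powr (- 6)) * e powr (- 2 * lam - 1) = sup_const lam * e powr (- sup_exp lam)"
  proof -
    have "- 6 + (- 2 * lam - 1) = - sup_exp lam" by (simp add: sup_exp_def)
    thus ?thesis by (simp only: mult.assoc powr_add[symmetric])
  qed
  finally show ?thesis by (simp add: b_def)
qed

lemma dunkl_power_integrable:
  assumes lam: "0 \<le> lam" and f: "continuous_on (ball 0 1) f" and b: "b < 1" and p: "0 < p"
  shows "integrable (sigma_lambda lam) (\<lambda>w. indicat_real (cball 0 b) w * norm (f w :: complex) powr p)"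
proof -
  have "continuous_on (cball 0 b) (\<lambda>w. norm (f w) powr p)"
    by (intro continuous_on_powr' continuous_on_norm continuous_on_const continuous_on_subset[OF f])
      (use b p in auto)
  from continuous_integrable_sigma[OF lam compact_cball this] show ?thesis by simp
qed

lemma bergman_integral_mono_ball:
  assumes lam: "0 \<le> lam" and f: "continuous_on (ball 0 1) f" and b: "b < 1" and p: "0 < p" and d: "0 \<le> d" "bergman_integral lam p f \<le> ennreal d"
  shows "(\<integral>w. indicat_real (cball 0 b) w * norm (f w) powr p \<partial>sigma_lambda lam) \<le> d"
proof -
  have "ennreal (\<integral>w. indicat_real (cball 0 b) w * norm (f w) powr p \<partial>sigma_lambda lam)
     = (\<integral>\<^sup>+w. ennreal (indicat_real (cball 0 b) w * norm (f w) powr p) \<partial>sigma_lambda lam)"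
    by (rule nn_integral_eq_integral[symmetric, OF dunkl_power_integrable[OF lam f b p]]) auto
  also have "\<dots> \<le> bergman_integral lam p f"
    unfolding bergman_integral_def by (rule nn_integral_mono) (use b in \<open>auto simp: indicator_def\<close>)
  also have "\<dots> \<le> ennreal d" by (rule d)
  finally show ?thesis using d(1) by (simp add: ennreal_le_iff)
qed

text \<open>
  For \<open>p \<le> 1\<close> the bound by the integral of \<open>|f|\<close> improves itself. In \<open>|f| = |f|\<^sup>p |f|\<^sup>1\<^sup>-\<^sup>p\<close> the second factor is
  estimated by the maximum \<open>M\<close> of \<open>(\<rho> - |z|)\<^sup>a |f(z)|\<close>, which turns the bound at the maximum point into
  \<open>M \<le> C M\<^sup>1\<^sup>-\<^sup>p d\<close>. With \<open>a\<close> the exponent of the bound divided by \<open>p\<close>, all powers of the distance to the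
  circle of radius \<open>\<rho>\<close> cancel.
\<close>

lemma sup_bound_small_exponent:
  assumes lam: "0 \<le> lam" and f: "dunkl_holomorphic lam (ball 0 1) f" and p: "0 < p" "p \<le> 1"
    and rho: "norm z < rho" "rho < 1" and d: "0 \<le> d" "bergman_integral lam p f \<le> ennreal d"
  shows "(rho - norm z) powr (sup_exp lam / p) * norm (f z) \<le> (4 powr (sup_exp lam / p) * sup_const lam * d) powr (1 / p)"
proof -
  define N where "N = sup_exp lam"
  define a where "a = N / p"
  have N0: "N > 0" using lam by (simp add: N_def sup_exp_def)
  hence a0: "a > 0" using p by (simp add: a_def)
  have fc: "continuous_on (ball 0 1) f" by (rule dunkl_holomorphic_continuous_on[OF f])
  define F where "F = (\<lambda>w. (rho - norm w) powr a * norm (f w))"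
  have Fc: "continuous_on (cball 0 rho) F" unfolding F_def
    by (intro continuous_on_mult continuous_on_powr' continuous_on_norm continuous_on_subset[OF fc] continuous_intros)
      (use rho a0 in auto)
  have ne: "cball (0::complex) rho \<noteq> {}" using order_trans[OF norm_ge_zero less_imp_le[OF rho(1)]] by auto
  obtain z0 where z0: "z0 \<in> cball 0 rho" and max: "\<And>w. w \<in> cball 0 rho \<Longrightarrow> F w \<le> F z0"
    using continuous_attains_sup[OF compact_cball ne Fc] by blast
  define M where "M = F z0"
  have M0: "0 \<le> M" by (simp add: M_def F_def)
  have "M \<le> (4 powr a * sup_const lam * d) powr (1 / p)"
  proof (cases "M = 0")
    case False
    hence M: "0 < M" using M0 by simp
    have z0r: "norm z0 < rho"
    proof (rule ccontr)
      assume "\<not> norm z0 < rho"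
      hence "F z0 = 0" using z0 by (simp add: F_def)
      thus False using M by (simp add: M_def)
    qed
    define e where "e = (rho - norm z0) / 4"
    have e: "0 < e" "norm z0 + 2 * e < 1" using z0r rho by (auto simp: e_def field_simps)
    let ?b = "norm z0 + 2 * e"
    have b: "?b < 1" by (rule e)
    let ?I = "\<integral>w. indicat_real (cball 0 ?b) w * norm (f w) powr p \<partial>sigma_lambda lam"
    have I: "?I \<le> d" by (rule bergman_integral_mono_ball[OF lam fc b p(1) d])
    define K where "K = M powr (1 - p) * (2 * e) powr (- a * (1 - p))"
    have pw: "norm (f w) \<le> norm (f w) powr p * K" if w: "norm w \<le> ?b" for w
    proof (cases "f w = 0")
      case False
      hence fw: "0 < norm (f w)" by simp
      have "4 * e = rho - norm z0" by (simp add: e_def)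
      hence rw: "2 * e \<le> rho - norm w" using w by linarith
      have "F w \<le> M" unfolding M_def by (rule max) (use rw e in auto)
      hence "(2 * e) powr a * norm (f w) \<le> M"
        using mult_right_mono[OF powr_mono2[of a "2 * e" "rho - norm w"], of "norm (f w)"] a0 e rw
        by (simp add: F_def)
      hence "norm (f w) \<le> M / (2 * e) powr a" using e by (simp add: field_simps)
      also have "\<dots> = M * (2 * e) powr (- a)" by (simp add: powr_minus field_simps)
      finally have "norm (f w) powr (1 - p) \<le> (M * (2 * e) powr (- a)) powr (1 - p)"
        using p by (intro powr_mono2) auto
      also have "\<dots> = K" using M by (simp add: K_def powr_mult powr_powr)
      finally have "norm (f w) powr p * norm (f w) powr (1 - p) \<le> norm (f w) powr p * K"
        by (intro mult_left_mono) auto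
      moreover have "norm (f w) powr p * norm (f w) powr (1 - p) = norm (f w)"
        using fw by (simp flip: powr_add)
      ultimately show ?thesis by simp
    qed simp
    have K0: "0 \<le> K" by (simp add: K_def)
    have "(\<integral>w. indicat_real (cball 0 ?b) w * norm (f w) \<partial>sigma_lambda lam)
        \<le> (\<integral>w. K * (indicat_real (cball 0 ?b) w * norm (f w) powr p) \<partial>sigma_lambda lam)"
    proof (rule integral_mono)
      show "integrable (sigma_lambda lam) (\<lambda>w. indicat_real (cball 0 ?b) w * norm (f w))"
        using continuous_integrable_sigma[OF lam compact_cball continuous_on_norm[OF continuous_on_subset[OF fc]], of 0 ?b] b
        by (simp add: subset_iff)
      show "integrable (sigma_lambda lam) (\<lambda>w. K * (indicat_real (cball 0 ?b) w * norm (f w) powr p))"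
        by (intro integrable_mult_right dunkl_power_integrable[OF lam fc b p(1)])
      show "indicat_real (cball 0 ?b) w * norm (f w) \<le> K * (indicat_real (cball 0 ?b) w * norm (f w) powr p)" for w
        using pw[of w] by (cases "norm w \<le> ?b") (auto simp: mult.commute)
    qed
    also have "\<dots> = K * ?I" by simp
    also have "\<dots> \<le> K * d" using I K0 by (intro mult_left_mono)
    finally have J: "(\<integral>w. indicat_real (cball 0 ?b) w * norm (f w) \<partial>sigma_lambda lam) \<le> K * d" .
    have "norm (f z0) \<le> sup_const lam * e powr (- N) * (\<integral>w. indicat_real (cball 0 ?b) w * norm (f w) \<partial>sigma_lambda lam)"
      unfolding N_def by (rule dunkl_point_bound[OF lam f e])
    also have "\<dots> \<le> sup_const lam * e powr (- N) * (K * d)"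
      using J sup_const_pos[OF lam] by (intro mult_left_mono) auto
    finally have fz: "norm (f z0) \<le> sup_const lam * e powr (- N) * (K * d)" .
    have "4 * e = rho - norm z0" by (simp add: e_def)
    hence "M = (4 * e) powr a * norm (f z0)" by (simp only: M_def F_def)
    also have "\<dots> \<le> (4 * e) powr a * (sup_const lam * e powr (- N) * (K * d))"
      by (intro mult_left_mono fz) auto
    also have "\<dots> = (4 powr a * sup_const lam * d) * M powr (1 - p) * (2 powr (- a * (1 - p)) * (e powr a * e powr (- N) * e powr (- a * (1 - p))))"
      using e by (simp add: K_def powr_mult)
    also have "e powr a * e powr (- N) * e powr (- a * (1 - p)) = 1"
    proof -
      have "e powr a * e powr (- N) * e powr (- a * (1 - p)) = e powr (a + - N + - a * (1 - p))"
        by (simp only: powr_add)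
      also have "a + - N + - a * (1 - p) = 0" using p by (simp add: a_def field_simps)
      finally show ?thesis using e by simp
    qed
    also have "(4 powr a * sup_const lam * d) * M powr (1 - p) * (2 powr (- a * (1 - p)) * 1) \<le> (4 powr a * sup_const lam * d) * M powr (1 - p) * 1"
    proof (rule mult_left_mono)
      have "2 powr (- a * (1 - p)) \<le> 2 powr 0" using a0 p by (intro powr_mono) (auto simp: mult_nonneg_nonneg)
      thus "2 powr (- a * (1 - p)) * 1 \<le> (1::real)" by simp
      show "0 \<le> 4 powr a * sup_const lam * d * M powr (1 - p)" using sup_const_pos[OF lam] d by auto
    qed
    finally have "M \<le> (4 powr a * sup_const lam * d) * M powr (1 - p)" by simp
    moreover have "M = M powr p * M powr (1 - p)" using M by (simp flip: powr_add)
    ultimately have "M powr p * M powr (1 - p) \<le> (4 powr a * sup_const lam * d) * M powr (1 - p)" by simp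
    hence "M powr p \<le> 4 powr a * sup_const lam * d" using M by simp
    hence "(M powr p) powr (1 / p) \<le> (4 powr a * sup_const lam * d) powr (1 / p)"
      using p by (intro powr_mono2) auto
    thus ?thesis using M p by (simp add: powr_powr)
  qed simp
  moreover have "F z \<le> M" unfolding M_def by (rule max) (use rho in auto)
  ultimately show ?thesis by (simp add: F_def a_def N_def)
qed

text \<open>
  The two ranges of \<open>p\<close> are different: up to one, \<open>sup_bound_small_exponent\<close> applies; above one, the
  integral of \<open>|f|\<close> is controlled by that of \<open>|f|\<^sup>p\<close> because the disk has finite measure.
\<close>

theorem small_norm_imp_uniformly_small:
  assumes lam: "0 \<le> lam" and p: "0 < p" and r: "0 \<le> r" "r < 1" and eps: "0 < eps"
  obtains d where "0 < d" "\<And>f z. dunkl_holomorphic lam (ball 0 1) f \<Longrightarrow> bergman_integral lam p f \<le> ennreal d \<Longrightarrow> norm z \<le> r \<Longrightarrow> norm (f z) \<le> eps"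
proof (cases "p \<le> 1")
  case True
  define rho where "rho = (r + 1) / 2"
  have rho: "r < rho" "rho < 1" using r by (auto simp: rho_def)
  define a where "a = sup_exp lam / p"
  define C where "C = 4 powr a * sup_const lam"
  have C: "0 < C" using sup_const_pos[OF lam] by (simp add: C_def)
  have a0: "0 \<le> a" using lam p by (simp add: a_def sup_exp_def)
  define t where "t = (rho - r) powr a * eps"
  have t: "0 < t" using rho eps by (simp add: t_def)
  show ?thesis
  proof (rule that[of "t powr p / C"])
    show "0 < t powr p / C" using t C by simp
    fix f :: "complex \<Rightarrow> complex" and z :: complex
    assume f: "dunkl_holomorphic lam (ball 0 1) f" and i: "bergman_integral lam p f \<le> ennreal (t powr p / C)" and z: "norm z \<le> r"
    have "(rho - norm z) powr a * norm (f z) \<le> (C * (t powr p / C)) powr (1 / p)"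
      unfolding a_def C_def
      by (rule sup_bound_small_exponent[OF lam f p True]) (use i z rho C t in \<open>auto simp: C_def a_def\<close>)
    also have "\<dots> = t" using C t p by (simp add: powr_powr)
    finally have "(rho - norm z) powr a * norm (f z) \<le> t" .
    moreover have "(rho - r) powr a * norm (f z) \<le> (rho - norm z) powr a * norm (f z)"
      using z rho a0 by (intro mult_right_mono powr_mono2) auto
    ultimately have "(rho - r) powr a * norm (f z) \<le> (rho - r) powr a * eps" by (simp add: t_def)
    thus "norm (f z) \<le> eps" using rho by simp
  qed
next
  case False
  hence p1: "1 \<le> p" by simp
  define e where "e = (1 - r) / 4"
  have e: "0 < e" using r by (simp add: e_def)
  define C where "C = sup_const lam * e powr (- sup_exp lam)"
  have C: "0 < C" using sup_const_pos[OF lam] e by (simp add: C_def)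
  define S where "S = measure (sigma_lambda lam) (cball 0 1)"
  have S: "0 \<le> S" by (simp add: S_def)
  \<comment> \<open>pointwise \<open>|f| \<le> s + s\<^sup>1\<^sup>-\<^sup>p |f|\<^sup>p\<close>, with \<open>s\<close> chosen so that the first term costs half of the bound\<close>
  define s where "s = eps / (2 * C * (S + 1))"
  have s: "0 < s" using eps C S by (simp add: s_def)
  show ?thesis
  proof (rule that[of "eps / (2 * C) * s powr (p - 1)"])
    show "0 < eps / (2 * C) * s powr (p - 1)" using eps C s by simp
    fix f :: "complex \<Rightarrow> complex" and z :: complex
    assume f: "dunkl_holomorphic lam (ball 0 1) f" and i: "bergman_integral lam p f \<le> ennreal (eps / (2 * C) * s powr (p - 1))" and z: "norm z \<le> r"
    have fc: "continuous_on (ball 0 1) f" by (rule dunkl_holomorphic_continuous_on[OF f])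
    let ?b = "norm z + 2 * e"
    have b: "?b < 1" using z r by (auto simp: e_def field_simps)
    let ?I = "\<integral>w. indicat_real (cball 0 ?b) w * norm (f w) powr p \<partial>sigma_lambda lam"
    have I: "?I \<le> eps / (2 * C) * s powr (p - 1)"
      by (rule bergman_integral_mono_ball[OF lam fc b p _ i]) (use eps C in auto)
    have pw: "norm (f w) \<le> s + s powr (1 - p) * norm (f w) powr p" for w
    proof (cases "norm (f w) \<le> s")
      case False
      hence fw: "s < norm (f w)" by simp
      have "norm (f w) powr (1 - p) \<le> s powr (1 - p)" using fw s p1 by (intro powr_mono2') auto
      hence "norm (f w) powr (1 - p) * norm (f w) powr p \<le> s powr (1 - p) * norm (f w) powr p"
        by (intro mult_right_mono) auto
      moreover have "norm (f w) powr (1 - p) * norm (f w) powr p = norm (f w)"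
        using fw s by (simp flip: powr_add)
      ultimately show ?thesis using s by simp
    qed (simp add: add_increasing2)
    have ii: "integrable (sigma_lambda lam) (\<lambda>w. s * indicat_real (cball 0 1) w)"
      using sigma_ball_finite[OF lam, of 1] by (intro integrable_mult_right) auto
    have ij: "integrable (sigma_lambda lam) (\<lambda>w. s powr (1 - p) * (indicat_real (cball 0 ?b) w * norm (f w) powr p))"
      by (intro integrable_mult_right dunkl_power_integrable[OF lam fc b p])
    have "(\<integral>w. indicat_real (cball 0 ?b) w * norm (f w) \<partial>sigma_lambda lam)
       \<le> (\<integral>w. s * indicat_real (cball 0 1) w + s powr (1 - p) * (indicat_real (cball 0 ?b) w * norm (f w) powr p) \<partial>sigma_lambda lam)"
    proof (rule integral_mono)
      show "integrable (sigma_lambda lam) (\<lambda>w. indicat_real (cball 0 ?b) w * norm (f w))"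
        using continuous_integrable_sigma[OF lam compact_cball continuous_on_norm[OF continuous_on_subset[OF fc]], of 0 ?b] b
        by (simp add: subset_iff)
      show "integrable (sigma_lambda lam) (\<lambda>w. s * indicat_real (cball 0 1) w + s powr (1 - p) * (indicat_real (cball 0 ?b) w * norm (f w) powr p))"
        by (rule Bochner_Integration.integrable_add[OF ii ij])
      show "indicat_real (cball 0 ?b) w * norm (f w) \<le> s * indicat_real (cball 0 1) w + s powr (1 - p) * (indicat_real (cball 0 ?b) w * norm (f w) powr p)" for w
        using pw[of w] b s by (cases "norm w \<le> ?b") (auto simp: indicator_def)
    qed
    also have "\<dots> = s * S + s powr (1 - p) * ?I"
      unfolding Bochner_Integration.integral_add[OF ii ij] by (simp add: S_def)
    also have "\<dots> \<le> s * S + s powr (1 - p) * (eps / (2 * C) * s powr (p - 1))"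
      by (intro add_left_mono mult_left_mono I) auto
    also have "s powr (1 - p) * (eps / (2 * C) * s powr (p - 1)) = eps / (2 * C)"
    proof -
      have "s powr (1 - p) * s powr (p - 1) = 1" using s by (simp flip: powr_add)
      moreover have "s powr (1 - p) * (eps / (2 * C) * s powr (p - 1)) = (s powr (1 - p) * s powr (p - 1)) * (eps / (2 * C))"
        by (simp only: mult_ac)
      ultimately show ?thesis by simp
    qed
    also have "s * S \<le> eps / (2 * C)"
    proof -
      have "s * S \<le> s * (S + 1)" using s by (intro mult_left_mono) auto
      also have "\<dots> = eps / (2 * C)" using S C by (simp add: s_def)
      finally show ?thesis .
    qed
    finally have "(\<integral>w. indicat_real (cball 0 ?b) w * norm (f w) \<partial>sigma_lambda lam) \<le> eps / (2 * C) + eps / (2 * C)" by simp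
    hence J: "(\<integral>w. indicat_real (cball 0 ?b) w * norm (f w) \<partial>sigma_lambda lam) \<le> eps / C" by simp
    have "norm (f z) \<le> C * (\<integral>w. indicat_real (cball 0 ?b) w * norm (f w) \<partial>sigma_lambda lam)"
      unfolding C_def by (rule dunkl_point_bound[OF lam f e b])
    also have "\<dots> \<le> C * (eps / C)" using J C by (intro mult_left_mono) auto
    finally show "norm (f z) \<le> eps" using C by simp
  qed
qed


section \<open>The metric\<close>

lemma bergman_measurable:
  assumes "continuous_on (ball 0 1) f"
  shows "(\<lambda>z. ennreal (norm (f z :: complex) powr p) * indicator (ball 0 1) z) \<in> borel_measurable borel"
proof -
  define F where "F = (\<lambda>z. indicat_real (ball 0 1) z *\<^sub>R f z)"
  have [measurable]: "F \<in> borel_measurable borel"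
    unfolding F_def by (rule borel_measurable_continuous_on_indicator[OF _ assms]) simp
  have "(\<lambda>z. ennreal (norm (f z) powr p) * indicator (ball 0 1) z) = (\<lambda>z. ennreal (norm (F z) powr p))"
    by (auto simp: F_def indicator_def)
  moreover have "(\<lambda>z. ennreal (norm (F z) powr p)) \<in> borel_measurable borel"
    by measurable
  ultimately show ?thesis by simp
qed

lemma bergman_integral_cong:
  assumes "\<And>z. norm z < 1 \<Longrightarrow> norm (f z) = norm (g z)"
  shows "bergman_integral lam p f = bergman_integral lam p g"
  unfolding bergman_integral_def
  by (rule nn_integral_cong) (use assms in \<open>auto simp: indicator_def\<close>)

text \<open>
  Every form of the triangle inequality below is a pointwise inequality between \<open>p\<close>-th powers, integrated.
\<close>

lemma bergman_integral_combination:
  assumes lam: "0 \<le> lam" and c: "continuous_on (ball 0 1) f" "continuous_on (ball 0 1) g"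
    and ab: "0 \<le> a" "0 \<le> b" and p: "0 < p"
    and le: "\<And>z. norm z < 1 \<Longrightarrow> norm (h z) powr p \<le> a * norm (f z) powr p + b * norm (g z) powr p"
  shows "bergman_integral lam p h \<le> ennreal a * bergman_integral lam p f + ennreal b * bergman_integral lam p g"
proof -
  note [measurable] = bergman_measurable[OF c(1)] bergman_measurable[OF c(2)]
  have "bergman_integral lam p h \<le> (\<integral>\<^sup>+z. ennreal a * (ennreal (norm (f z) powr p) * indicator (ball 0 1) z)
      + ennreal b * (ennreal (norm (g z) powr p) * indicator (ball 0 1) z) \<partial>sigma_lambda lam)"
    unfolding bergman_integral_def
  proof (rule nn_integral_mono)
    fix z
    show "ennreal (norm (h z) powr p) * indicator (ball 0 1) z \<le> ennreal a * (ennreal (norm (f z) powr p) * indicator (ball 0 1) z)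
      + ennreal b * (ennreal (norm (g z) powr p) * indicator (ball 0 1) z)"
    proof (cases "norm z < 1")
      case True
      have "ennreal (norm (h z) powr p) \<le> ennreal (a * norm (f z) powr p + b * norm (g z) powr p)"
        by (rule ennreal_leI[OF le[OF True]])
      also have "\<dots> = ennreal a * ennreal (norm (f z) powr p) + ennreal b * ennreal (norm (g z) powr p)"
        using ab by (simp add: ennreal_plus ennreal_mult)
      finally show ?thesis using True by simp
    qed simp
  qed
  also have "\<dots> = ennreal a * bergman_integral lam p f + ennreal b * bergman_integral lam p g"
    unfolding bergman_integral_def
    by (subst nn_integral_add) (auto simp: nn_integral_cmult)
  finally show ?thesis .
qed

lemma powr_add_le:
  fixes a b p :: real
  assumes "0 \<le> a" "0 \<le> b" "0 < p" "p \<le> 1"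
  shows "(a + b) powr p \<le> a powr p + b powr p"
proof (cases "a + b = 0")
  case False
  hence s: "0 < a + b" using assms by simp
  have t: "x / (a + b) \<le> (x / (a + b)) powr p" if "0 \<le> x" "x \<le> a + b" for x
    using powr_mono'[OF assms(4), of "x / (a + b)"] that s by simp
  have "1 = a / (a + b) + b / (a + b)" using s by (simp add: add_divide_distrib[symmetric])
  also have "\<dots> \<le> (a / (a + b)) powr p + (b / (a + b)) powr p"
    using assms by (intro add_mono t) auto
  also have "\<dots> = (a powr p + b powr p) / (a + b) powr p"
    using assms s by (simp add: powr_divide add_divide_distrib)
  finally show ?thesis using s by (simp add: field_simps)
qed (use assms in auto)

text \<open>
  Convexity of the power at the weighted mean of \<open>x / A\<close> and \<open>y / B\<close>. When \<open>A\<close> and \<open>B\<close> are bounds of two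
  norms, its integral is Minkowski's inequality.
\<close>

lemma powr_convex_split:
  fixes x y A B p :: real
  assumes "1 \<le> p" "0 \<le> x" "0 \<le> y" "0 < A" "0 < B"
  shows "(x + y) powr p \<le> (A + B) powr p * (A / (A + B) * (x / A) powr p + B / (A + B) * (y / B) powr p)"
proof -
  have s: "0 < A + B" using assms by simp
  have conv: "((1 - t) * u + t * v) powr p \<le> (1 - t) * u powr p + t * v powr p"
    if uv: "0 \<le> u" "0 \<le> v" and t: "0 \<le> t" "t \<le> 1" for u v t :: real
  proof -
    have shrink: "(t * v) powr p \<le> t * v powr p" if "0 \<le> t" "t \<le> 1" "0 \<le> v" for t v :: real
    proof -
      have "(t * v) powr p = t powr p * v powr p" using that by (simp add: powr_mult)
      also have "\<dots> \<le> t powr 1 * v powr p" using that assms(1) by (intro mult_right_mono powr_mono') auto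
      finally show ?thesis using that by simp
    qed
    consider "u = 0" | "v = 0" | "0 < u" "0 < v" using uv by fastforce
    thus ?thesis
    proof cases
      case 3
      have "convex_on {0<..} (\<lambda>x::real. x powr p)" by (rule powr_convex[OF assms(1)])
      from convex_onD[OF this t, of u v] 3 show ?thesis by simp
    qed (use shrink[of t v] shrink[of "1 - t" u] uv t assms(1) in auto)
  qed
  let ?t = "B / (A + B)"
  have t: "0 \<le> ?t" "?t \<le> 1" "1 - ?t = A / (A + B)" using assms s by (auto simp: field_simps)
  have "x + y = (A + B) * ((1 - ?t) * (x / A) + ?t * (y / B))"
  proof -
    have "(A + B) * (A / (A + B) * (x / A)) = x" "(A + B) * (B / (A + B) * (y / B)) = y"
      using assms s by simp_all
    thus ?thesis unfolding t(3) by (simp add: distrib_left)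
  qed
  hence "(x + y) powr p = (A + B) powr p * ((1 - ?t) * (x / A) + ?t * (y / B)) powr p"
    using assms s t by (simp add: powr_mult)
  also have "\<dots> \<le> (A + B) powr p * ((1 - ?t) * (x / A) powr p + ?t * (y / B) powr p)"
    by (intro mult_left_mono conv t) (use assms in auto)
  finally show ?thesis unfolding t(3) .
qed

lemma bergman_norm_triangle:
  assumes lam: "0 \<le> lam" and p: "1 \<le> p" and c: "continuous_on (ball 0 1) f" "continuous_on (ball 0 1) g"
    and fin: "bergman_integral lam p f < \<infinity>" "bergman_integral lam p g < \<infinity>"
    and h: "\<And>z. norm z < 1 \<Longrightarrow> norm (h z) \<le> norm (f z) + norm (g z)"
  shows "bergman_norm lam p h \<le> bergman_norm lam p f + bergman_norm lam p g"
proof (rule field_le_epsilon)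
  fix e :: real assume e: "0 < e"
  \<comment> \<open>the summand \<open>e / 2\<close> makes both numbers positive, so that they may divide\<close>
  define A B where "A = bergman_norm lam p f + e / 2" and "B = bergman_norm lam p g + e / 2"
  have AB: "0 < A" "0 < B" using e by (auto simp: A_def B_def bergman_norm_def add_nonneg_pos)
  have le: "bergman_integral lam p u \<le> ennreal (X powr p)" if fu: "bergman_integral lam p u < \<infinity>" and X: "X = bergman_norm lam p u + e / 2" for u X
  proof -
    obtain r where r: "0 \<le> r" "bergman_integral lam p u = ennreal r"
      using fu by (cases "bergman_integral lam p u") auto
    have "r = (r powr (1 / p)) powr p" using r p by (simp add: powr_powr)
    also have "\<dots> \<le> X powr p" using r e p X by (intro powr_mono2) (auto simp: bergman_norm_def)
    finally show ?thesis using r by (simp add: ennreal_leI)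
  qed
  have "norm (h z) powr p \<le> ((A + B) powr p * (A / (A + B)) / A powr p) * norm (f z) powr p + ((A + B) powr p * (B / (A + B)) / B powr p) * norm (g z) powr p"
    if "norm z < 1" for z
  proof -
    have "norm (h z) powr p \<le> (norm (f z) + norm (g z)) powr p" using h[OF that] p by (intro powr_mono2) auto
    also have "\<dots> \<le> (A + B) powr p * (A / (A + B) * (norm (f z) / A) powr p + B / (A + B) * (norm (g z) / B) powr p)"
      by (rule powr_convex_split[OF p]) (use AB in auto)
    also have "\<dots> = ((A + B) powr p * (A / (A + B)) / A powr p) * norm (f z) powr p + ((A + B) powr p * (B / (A + B)) / B powr p) * norm (g z) powr p"
      using AB by (simp add: powr_divide distrib_left)
    finally show ?thesis .
  qed
  from bergman_integral_combination[OF lam c _ _ _ this]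
  have "bergman_integral lam p h \<le> ennreal ((A + B) powr p * (A / (A + B)) / A powr p) * bergman_integral lam p f
      + ennreal ((A + B) powr p * (B / (A + B)) / B powr p) * bergman_integral lam p g"
    using AB p by simp
  also have "\<dots> \<le> ennreal ((A + B) powr p * (A / (A + B)) / A powr p) * ennreal (A powr p)
      + ennreal ((A + B) powr p * (B / (A + B)) / B powr p) * ennreal (B powr p)"
    using le[OF fin(1) A_def] le[OF fin(2) B_def] by (intro add_mono mult_left_mono) auto
  also have "\<dots> = ennreal ((A + B) powr p)"
  proof -
    have sumeq: "(A + B) powr p * (A / (A + B)) / A powr p * A powr p + (A + B) powr p * (B / (A + B)) / B powr p * B powr p = (A + B) powr p"
    proof -
      have "(A + B) powr p * (A / (A + B)) / A powr p * A powr p = (A + B) powr p * (A / (A + B))"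
        "(A + B) powr p * (B / (A + B)) / B powr p * B powr p = (A + B) powr p * (B / (A + B))"
        using AB by simp_all
      moreover have "(A + B) powr p * (A / (A + B)) + (A + B) powr p * (B / (A + B)) = (A + B) powr p * ((A + B) / (A + B))"
        by (simp only: add_divide_distrib distrib_left)
      moreover have "(A + B) / (A + B) = 1" using AB by simp
      ultimately show ?thesis by (simp only: mult_1_right)
    qed
    have em: "ennreal a * ennreal b + ennreal c * ennreal d = ennreal (a * b + c * d)" if "0 \<le> a" "0 \<le> c" "0 \<le> b" "0 \<le> d" for a b c d
      using that by (simp add: ennreal_plus ennreal_mult)
    have "0 \<le> (A + B) powr p * (A / (A + B)) / A powr p" "0 \<le> (A + B) powr p * (B / (A + B)) / B powr p"
      using AB by simp_all
    from em[OF this powr_ge_zero powr_ge_zero, of A p B p] show ?thesis by (simp only: sumeq)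
  qed
  finally have "enn2real (bergman_integral lam p h) \<le> (A + B) powr p"
    by (metis enn2real_ennreal enn2real_mono ennreal_less_top powr_ge_zero)
  hence "bergman_norm lam p h \<le> ((A + B) powr p) powr (1 / p)"
    unfolding bergman_norm_def using p by (intro powr_mono2) auto
  also have "\<dots> = A + B" using AB p by (simp add: powr_powr)
  finally show "bergman_norm lam p h \<le> bergman_norm lam p f + bergman_norm lam p g + e"
    by (simp add: A_def B_def)
qed

lemma bergman_integral_diff_finite:
  assumes lam: "0 \<le> lam" and p: "0 < p" and c: "continuous_on (ball 0 1) f" "continuous_on (ball 0 1) g"
    and fin: "bergman_integral lam p f < \<infinity>" "bergman_integral lam p g < \<infinity>"
    and h: "\<And>z. norm z < 1 \<Longrightarrow> norm (h z) \<le> norm (f z) + norm (g z)"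
  shows "bergman_integral lam p h < \<infinity>"
proof -
  have "norm (h z) powr p \<le> 2 powr p * norm (f z) powr p + 2 powr p * norm (g z) powr p" if "norm z < 1" for z
  proof -
    let ?m = "max (norm (f z)) (norm (g z))"
    have "norm (h z) \<le> 2 * ?m" using h[OF that] by linarith
    hence "norm (h z) powr p \<le> (2 * ?m) powr p" using p by (intro powr_mono2) auto
    also have "\<dots> = 2 powr p * ?m powr p" by (simp add: powr_mult)
    also have "\<dots> \<le> 2 powr p * (norm (f z) powr p + norm (g z) powr p)"
      by (intro mult_left_mono) (auto simp: max_def)
    finally show ?thesis by (simp add: distrib_left)
  qed
  from bergman_integral_combination[OF lam c _ _ p this]
  have "bergman_integral lam p h \<le> ennreal (2 powr p) * bergman_integral lam p f + ennreal (2 powr p) * bergman_integral lam p g"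
    by simp
  also have "\<dots> < \<infinity>" using fin by (auto simp: ennreal_mult_less_top)
  finally show ?thesis .
qed

lemma bergman_spaceD:
  assumes "f \<in> bergman_space lam p"
  shows "dunkl_holomorphic lam (ball 0 1) f" "continuous_on (ball 0 1) f" "bergman_integral lam p f < \<infinity>"
    "f \<in> extensional (ball 0 1)"
proof -
  show d: "dunkl_holomorphic lam (ball 0 1) f"
    using assms by (auto simp: bergman_space_def intro: lambda_analytic_imp_dunkl_holomorphic)
  show "continuous_on (ball 0 1) f" by (rule dunkl_holomorphic_continuous_on[OF d])
qed (use assms in \<open>auto simp: bergman_space_def\<close>)

lemma bergman_diff_finite:
  assumes lam: "0 \<le> lam" and p: "0 < p" and f: "f \<in> bergman_space lam p" "g \<in> bergman_space lam p"
  shows "bergman_integral lam p (\<lambda>z. f z - g z) < \<infinity>"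
  by (rule bergman_integral_diff_finite[OF lam p bergman_spaceD(2)[OF f(1)] bergman_spaceD(2)[OF f(2)] bergman_spaceD(3)[OF f(1)] bergman_spaceD(3)[OF f(2)]])
    (rule norm_triangle_ineq4)

lemma bergman_dist_small_exponent:
  "p < 1 \<Longrightarrow> 0 < p \<Longrightarrow> bergman_dist lam p f g = enn2real (bergman_integral lam p (\<lambda>z. f z - g z))"
  by (simp add: bergman_dist_def bergman_norm_def powr_powr)

lemma bergman_integral_zero_imp_zero:
  assumes lam: "0 \<le> lam" and p: "0 < p" and c: "continuous_on (ball 0 1) h" and z: "bergman_integral lam p h = 0" and w: "norm w < 1"
  shows "h w = 0"
proof -
  have "AE z in sigma_lambda lam. ennreal (norm (h z) powr p) * indicator (ball 0 1) z = 0"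
    using z bergman_measurable[OF c, of p] unfolding bergman_integral_def by (subst (asm) nn_integral_0_iff_AE) auto
  hence ae: "AE z in lborel. z \<in> ball 0 1 \<longrightarrow> norm (h z) = 0"
    unfolding AE_sigma_iff[OF lam] by eventually_elim (auto simp: indicator_def)
  have "norm (h w) = 0"
    by (rule continuous_AE_zero_imp_zero[OF open_ball _ ae]) (use w c in \<open>auto intro: continuous_on_norm\<close>)
  thus ?thesis by simp
qed

theorem bergman_metric:
  assumes lam: "0 \<le> lam" and p: "0 < p"
  shows "Metric_space (bergman_space lam p) (bergman_dist lam p)"
proof
  show "0 \<le> bergman_dist lam p f g" for f g
    by (simp add: bergman_dist_def bergman_norm_def)
  show "bergman_dist lam p f g = bergman_dist lam p g f" for f g
    using bergman_integral_cong[of "\<lambda>z. f z - g z" "\<lambda>z. g z - f z" lam p]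
    by (simp add: bergman_dist_def bergman_norm_def norm_minus_commute)
  show "bergman_dist lam p f g = 0 \<longleftrightarrow> f = g" if f: "f \<in> bergman_space lam p" and g: "g \<in> bergman_space lam p" for f g
  proof
    assume "bergman_dist lam p f g = 0"
    hence "enn2real (bergman_integral lam p (\<lambda>z. f z - g z)) = 0"
      using p by (auto simp: bergman_dist_def bergman_norm_def split: if_splits)
    hence z: "bergman_integral lam p (\<lambda>z. f z - g z) = 0"
      using bergman_diff_finite[OF lam p f g] by (auto simp: enn2real_eq_0_iff)
    have "f w = g w" if "w \<in> ball 0 1" for w
      using bergman_integral_zero_imp_zero[OF lam p _ z, of w] that bergman_spaceD(2)[OF f] bergman_spaceD(2)[OF g]
      by (auto intro: continuous_on_diff)
    thus "f = g" using bergman_spaceD(4)[OF f] bergman_spaceD(4)[OF g] by (rule extensionalityI[rotated 2])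
  next
    assume "f = g"
    thus "bergman_dist lam p f g = 0"
      using p by (simp add: bergman_dist_def bergman_norm_def bergman_integral_def)
  qed
  show "bergman_dist lam p f h \<le> bergman_dist lam p f g + bergman_dist lam p g h"
    if f: "f \<in> bergman_space lam p" and g: "g \<in> bergman_space lam p" and h: "h \<in> bergman_space lam p" for f g h
  proof -
    have c: "continuous_on (ball 0 1) (\<lambda>z. f z - g z)" "continuous_on (ball 0 1) (\<lambda>z. g z - h z)"
      using bergman_spaceD(2)[OF f] bergman_spaceD(2)[OF g] bergman_spaceD(2)[OF h] by (auto intro: continuous_on_diff)
    note fin = bergman_diff_finite[OF lam p f g] bergman_diff_finite[OF lam p g h]
    have tri: "norm (f z - h z) \<le> norm (f z - g z) + norm (g z - h z)" for z
      using norm_triangle_ineq[of "f z - g z" "g z - h z"] by simp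
    show ?thesis
    proof (cases "1 \<le> p")
      case True
      thus ?thesis using bergman_norm_triangle[OF lam True c fin tri] by (simp add: bergman_dist_def)
    next
      case False
      hence p1: "p \<le> 1" "p < 1" by auto
      have "norm (f z - h z) powr p \<le> 1 * norm (f z - g z) powr p + 1 * norm (g z - h z) powr p" for z
      proof -
        have "norm (f z - h z) powr p \<le> (norm (f z - g z) + norm (g z - h z)) powr p"
          using tri[of z] p by (intro powr_mono2) auto
        also have "\<dots> \<le> norm (f z - g z) powr p + norm (g z - h z) powr p"
          by (rule powr_add_le) (use p p1 in auto)
        finally show ?thesis by simp
      qed
      from bergman_integral_combination[OF lam c _ _ p this]
      have "bergman_integral lam p (\<lambda>z. f z - h z) \<le> bergman_integral lam p (\<lambda>z. f z - g z) + bergman_integral lam p (\<lambda>z. g z - h z)"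
        by simp
      hence "enn2real (bergman_integral lam p (\<lambda>z. f z - h z)) \<le> enn2real (bergman_integral lam p (\<lambda>z. f z - g z) + bergman_integral lam p (\<lambda>z. g z - h z))"
        using fin by (intro enn2real_mono) auto
      also have "\<dots> = enn2real (bergman_integral lam p (\<lambda>z. f z - g z)) + enn2real (bergman_integral lam p (\<lambda>z. g z - h z))"
        using fin by (intro enn2real_plus) auto
      finally show ?thesis using p1 p by (simp add: bergman_dist_small_exponent)
    qed
  qed
qed


section \<open>Completeness\<close>

lemma C2_on_cong:
  assumes "open S" "\<And>z. z \<in> S \<Longrightarrow> f z = g z" "C2_on S g"
  shows "C2_on S f"
proof -
  obtain g' g'' where g': "\<And>z. z \<in> S \<Longrightarrow> (g has_derivative blinfun_apply (g' z)) (at z)"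
    and g'': "\<And>z. z \<in> S \<Longrightarrow> (g' has_derivative blinfun_apply (g'' z)) (at z)" "continuous_on S g''"
    using assms(3) unfolding C2_on_def by blast
  have "(f has_derivative blinfun_apply (g' z)) (at z)" if "z \<in> S" for z
    by (rule has_derivative_transform_within_open[OF g'[OF that] assms(1) that]) (simp add: assms(2))
  thus ?thesis unfolding C2_on_def using g'' by blast
qed

text \<open>
  Derivatives are unique, so those on the smaller disks fit together; the disk of radius \<open>al z\<close> contains \<open>z\<close>.
\<close>

lemma C2_on_exhaust:
  assumes "\<And>a. 0 < a \<Longrightarrow> a < 1 \<Longrightarrow> C2_on (ball 0 a) f"
  shows "C2_on (ball 0 1) f"
proof -
  have "\<exists>f' f''. (\<forall>z\<in>ball 0 a. (f has_derivative blinfun_apply (f' z)) (at z)) \<and>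
      (\<forall>z\<in>ball 0 a. (f' has_derivative blinfun_apply (f'' z)) (at z)) \<and> continuous_on (ball 0 a) f''" if "0 < a" "a < 1" for a
    using assms[OF that] unfolding C2_on_def by blast
  then obtain D1 D2 where
      D1: "\<And>a z. 0 < a \<Longrightarrow> a < 1 \<Longrightarrow> z \<in> ball 0 a \<Longrightarrow> (f has_derivative blinfun_apply (D1 a z)) (at z)"
    and D2: "\<And>a z. 0 < a \<Longrightarrow> a < 1 \<Longrightarrow> z \<in> ball 0 a \<Longrightarrow> (D1 a has_derivative blinfun_apply (D2 a z)) (at z)"
    and D2c: "\<And>a. 0 < a \<Longrightarrow> a < 1 \<Longrightarrow> continuous_on (ball 0 a) (D2 a)"
    by metis
  define al where "al = (\<lambda>z::complex. (1 + norm z) / 2)"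
  have al: "0 < al z" "al z < 1" "z \<in> ball 0 (al z)" if "z \<in> ball 0 1" for z
    using that by (auto simp: al_def add_pos_nonneg)
  define F1 where "F1 = (\<lambda>z. D1 (al z) z)"
  define F2 where "F2 = (\<lambda>z. D2 (al z) z)"
  have eq1: "F1 w = D1 a w" if a: "0 < a" "a < 1" "w \<in> ball 0 a" for a w
  proof -
    have w: "w \<in> ball 0 1" using a by auto
    have "blinfun_apply (F1 w) = blinfun_apply (D1 a w)"
      unfolding F1_def by (rule has_derivative_unique[OF D1[OF al[OF w]] D1[OF a]])
    thus ?thesis by (simp add: blinfun_apply_inject)
  qed
  have d1: "(F1 has_derivative blinfun_apply (D2 a w)) (at w)" if a: "0 < a" "a < 1" "w \<in> ball 0 a" for a w
    by (rule has_derivative_transform_within_open[OF D2[OF a] open_ball a(3)]) (use eq1 a in auto)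
  have eq2: "F2 w = D2 a w" if a: "0 < a" "a < 1" "w \<in> ball 0 a" for a w
  proof -
    have w: "w \<in> ball 0 1" using a by auto
    have "blinfun_apply (F2 w) = blinfun_apply (D2 a w)"
      unfolding F2_def by (rule has_derivative_unique[OF d1[OF al[OF w]] d1[OF a]])
    thus ?thesis by (simp add: blinfun_apply_inject)
  qed
  show ?thesis unfolding C2_on_def
  proof (intro exI[of _ F1] exI[of _ F2] conjI ballI)
    fix z :: complex assume z: "z \<in> ball 0 1"
    show "(f has_derivative blinfun_apply (F1 z)) (at z)" unfolding F1_def by (rule D1[OF al[OF z]])
    show "(F1 has_derivative blinfun_apply (F2 z)) (at z)" unfolding F2_def by (rule d1[OF al[OF z]])
  next
    show "continuous_on (ball 0 1) F2"
    proof (intro continuous_at_imp_continuous_on ballI)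
      fix z :: complex assume z: "z \<in> ball 0 1"
      have "continuous_on (ball 0 (al z)) F2"
        by (rule continuous_on_eq[OF D2c[OF al(1,2)[OF z]]]) (use eq2 al[OF z] in auto)
      thus "isCont F2 z" using al(3)[OF z] by (simp add: continuous_on_eq_continuous_at)
    qed
  qed
qed

lemma dunkl_dzbar_cong:
  assumes "open S" "z \<in> S" "cnj z \<in> S" "\<And>w. w \<in> S \<Longrightarrow> f w = g w" and g: "dunkl_holomorphic lam S g"
  shows "dunkl_dzbar lam f z = dunkl_dzbar lam g z"
proof -
  obtain gx gy where gd: "(g has_derivative (real_linear (gx z) (gy z))) (at z)"
    using g assms(2) unfolding dunkl_holomorphic_def by blast
  have fd: "(f has_derivative (real_linear (gx z) (gy z))) (at z)"
    by (rule has_derivative_transform_within_open[OF gd assms(1,2)]) (simp add: assms(4))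
  show ?thesis
    using partials_eq[OF gd] partials_eq[OF fd] assms(2-4)
    by (simp add: dunkl_dzbar_def dzbar_def)
qed

lemma lambda_analytic_if_locally_intertwined:
  assumes lam: "0 \<le> lam"
    and rep: "\<And>a. 0 < a \<Longrightarrow> a < 1 \<Longrightarrow> \<exists>g. g holomorphic_on ball 0 a \<and> (\<forall>z\<in>ball 0 a. f z = intertwine lam g z)"
  shows "lambda_analytic lam f"
  unfolding lambda_analytic_def
proof (intro conjI ballI)
  show "C2_on (ball 0 1) f"
  proof (rule C2_on_exhaust)
    fix a :: real assume "0 < a" "a < 1"
    from rep[OF this] obtain g where g: "g holomorphic_on ball 0 a" "\<And>z. z \<in> ball 0 a \<Longrightarrow> f z = intertwine lam g z" by blast
    show "C2_on (ball 0 a) f"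
      by (rule C2_on_cong[OF open_ball g(2) intertwine_lambda_analytic(1)[OF lam g(1)]])
  qed
  fix z :: complex assume z: "z \<in> ball 0 1"
  define a where "a = (1 + norm z) / 2"
  have a: "0 < a" "a < 1" "z \<in> ball 0 a" "cnj z \<in> ball 0 a" using z by (auto simp: a_def add_pos_nonneg)
  from rep[OF a(1,2)] obtain g where g: "g holomorphic_on ball 0 a" "\<And>z. z \<in> ball 0 a \<Longrightarrow> f z = intertwine lam g z" by blast
  have "dunkl_dzbar lam f z = dunkl_dzbar lam (intertwine lam g) z"
    by (rule dunkl_dzbar_cong[OF open_ball a(3,4) g(2) intertwine_lambda_analytic(3)[OF lam g(1)]])
  also have "\<dots> = 0" by (rule intertwine_lambda_analytic(2)[OF lam g(1) a(3)])
  finally show "dunkl_dzbar lam f z = 0" .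
qed

lemma axis_transform_diff:
  assumes lam: "0 \<le> lam" and ab: "0 < a" "a < b" and f: "continuous_on (cball 0 b) f" "continuous_on (cball 0 b) g" and z: "norm \<zeta> < a"
  shows "axis_transform lam a b (\<lambda>w. f w - g w) \<zeta> = axis_transform lam a b f \<zeta> - axis_transform lam a b g \<zeta>"
proof -
  have "(\<integral>w. (f w - g w) * (axis_kernel lam \<zeta> w * (w * of_real (annulus_profile a b ((norm w)\<^sup>2)))) \<partial>sigma_lambda lam)
    = (\<integral>w. f w * (axis_kernel lam \<zeta> w * (w * of_real (annulus_profile a b ((norm w)\<^sup>2)))) \<partial>sigma_lambda lam)
    - (\<integral>w. g w * (axis_kernel lam \<zeta> w * (w * of_real (annulus_profile a b ((norm w)\<^sup>2)))) \<partial>sigma_lambda lam)"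
    unfolding left_diff_distrib
    by (rule Bochner_Integration.integral_diff[OF axis_transform_integrable(1)[OF lam ab f(1) z] axis_transform_integrable(1)[OF lam ab f(2) z]])
  thus ?thesis unfolding axis_transform_def by (simp only: right_diff_distrib)
qed

text \<open>
  The representation contains no derivative of \<open>f\<close>. Both of its sides depend continuously on \<open>f\<close> in the
  topology of uniform convergence on the disk of radius \<open>b\<close>, so it passes to the limit.
\<close>

lemma uniform_limit_representation:
  assumes lam: "0 \<le> lam" and F: "\<And>n. dunkl_holomorphic lam (ball 0 1) (F n)"
    and ab: "0 < a" "a < b" "b < 1" and fc: "continuous_on (cball 0 b) f"
    and lim: "\<And>e. 0 < e \<Longrightarrow> \<exists>n. \<forall>w\<in>cball 0 b. norm (F n w - f w) \<le> e" and z: "z \<in> ball 0 a"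
  shows "f z = intertwine lam (axis_transform lam a b f) z"
proof -
  let ?T = "axis_transform lam a b"
  have Fc: "continuous_on (cball 0 b) (F n)" for n
    by (rule continuous_on_subset[OF dunkl_holomorphic_continuous_on[OF F]]) (use ab in auto)
  define d where "d = a - norm z"
  have d: "0 < d" using z by (simp add: d_def)
  define C where "C = 2 / (pole_constant lam * annulus_mass a b) * d powr (- 2 * lam - 1)"
  have C: "0 \<le> C" unfolding C_def using pole_constant_pos[OF lam] annulus_mass_pos[OF ab(1,2)] by simp
  define S where "S = measure (sigma_lambda lam) (cball 0 b)"
  have S: "0 \<le> S" by (simp add: S_def)
  have Th: "continuous_on (ball 0 a) (?T u)" if "continuous_on (cball 0 b) u" for u
    by (intro holomorphic_on_imp_continuous_on axis_transform_holomorphic[OF lam ab(1,2) that])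
  have close: "norm (f z - intertwine lam (?T f) z) \<le> e" if e: "0 < e" for e
  proof -
    define s where "s = e / (C * S + 1)"
    have s: "0 < s" "s * (C * S + 1) = e" using e C S by (auto simp: s_def add_nonneg_pos add_nonneg_eq_0_iff)
    obtain n where n: "\<And>w. w \<in> cball 0 b \<Longrightarrow> norm (F n w - f w) \<le> s" using lim[OF s(1)] by blast
    have dc: "continuous_on (cball 0 b) (\<lambda>w. F n w - f w)" by (intro continuous_on_diff Fc fc)
    have J: "(\<integral>w. indicat_real (cball 0 b) w * norm (F n w - f w) \<partial>sigma_lambda lam) \<le> s * S"
    proof -
      have "(\<integral>w. indicat_real (cball 0 b) w * norm (F n w - f w) \<partial>sigma_lambda lam) \<le> (\<integral>w. s * indicat_real (cball 0 b) w \<partial>sigma_lambda lam)"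
      proof (rule integral_mono)
        show "integrable (sigma_lambda lam) (\<lambda>w. indicat_real (cball 0 b) w * norm (F n w - f w))"
          using continuous_integrable_sigma[OF lam compact_cball continuous_on_norm[OF dc]] by simp
        show "integrable (sigma_lambda lam) (\<lambda>w. s * indicat_real (cball 0 b) w)"
          using sigma_ball_finite[OF lam, of b] by (intro integrable_mult_right) auto
        show "indicat_real (cball 0 b) w * norm (F n w - f w) \<le> s * indicat_real (cball 0 b) w" for w
          using n[of w] by (cases "w \<in> cball 0 b") auto
      qed
      thus ?thesis by (simp add: S_def)
    qed
    have "norm (intertwine lam (\<lambda>w. ?T (F n) w - ?T f w) z) \<le> C * (s * S)"
    proof (rule intertwine_norm_le[OF lam continuous_on_diff[OF Th[OF Fc] Th[OF fc]] z])
      fix w :: complex assume w: "norm w \<le> norm z"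
      hence wa: "norm w < a" "norm w + d \<le> a" using z by (auto simp: d_def)
      have "norm (?T (F n) w - ?T f w) = norm (?T (\<lambda>w. F n w - f w) w)"
        using axis_transform_diff[OF lam ab(1,2) Fc fc wa(1)] by simp
      also have "\<dots> \<le> C * (\<integral>w. indicat_real (cball 0 b) w * norm (F n w - f w) \<partial>sigma_lambda lam)"
        unfolding C_def by (rule axis_transform_norm_le[OF lam ab(1,2) less_imp_le[OF ab(3)] dc d wa(2)])
      also have "\<dots> \<le> C * (s * S)" by (rule mult_left_mono[OF J C])
      finally show "norm (?T (F n) w - ?T f w) \<le> C * (s * S)" .
    qed
    hence 1: "norm (F n z - intertwine lam (?T f) z) \<le> C * (s * S)"
      using intertwine_diff[OF lam Th[OF Fc] Th[OF fc] z, of n] dunkl_representation[OF lam F ab z, of n] by simp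
    have 2: "norm (F n z - f z) \<le> s" by (rule n) (use z ab in auto)
    have "norm (f z - intertwine lam (?T f) z) = norm ((F n z - intertwine lam (?T f) z) - (F n z - f z))" by simp
    also have "\<dots> \<le> C * (s * S) + s" using 1 2 norm_triangle_ineq4 by (rule order_trans[rotated, OF add_mono])
    also have "\<dots> = e" using s(2) by (simp add: algebra_simps)
    finally show ?thesis .
  qed
  have "norm (f z - intertwine lam (?T f) z) \<le> 0"
    by (rule field_le_epsilon) (use close in simp)
  thus ?thesis by simp
qed

lemma bergman_integral_Fatou:
  assumes lam: "0 \<le> lam" and p: "0 < p" and c: "\<And>n. continuous_on (ball 0 1) (G n)" 
    and lim: "\<And>z. norm z < 1 \<Longrightarrow> (\<lambda>n. G n z) \<longlonglongrightarrow> g z"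
    and le: "\<And>n. n \<ge> N \<Longrightarrow> bergman_integral lam p (G n) \<le> D"
  shows "bergman_integral lam p g \<le> D"
proof -
  note [measurable] = bergman_measurable[OF c]
  have "bergman_integral lam p g = (\<integral>\<^sup>+z. liminf (\<lambda>n. ennreal (norm (G n z) powr p) * indicator (ball 0 1) z) \<partial>sigma_lambda lam)"
    unfolding bergman_integral_def
  proof (rule nn_integral_cong)
    fix z
    show "ennreal (norm (g z) powr p) * indicator (ball 0 1) z = liminf (\<lambda>n. ennreal (norm (G n z) powr p) * indicator (ball 0 1) z)"
    proof (cases "norm z < 1")
      case True
      have "(\<lambda>n. norm (G n z) powr p) \<longlonglongrightarrow> norm (g z) powr p"
        using p by (intro tendsto_powr' tendsto_norm lim[OF True] tendsto_const) auto
      hence "(\<lambda>n. ennreal (norm (G n z) powr p)) \<longlonglongrightarrow> ennreal (norm (g z) powr p)" by (rule tendsto_ennrealI)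
      hence "liminf (\<lambda>n. ennreal (norm (G n z) powr p)) = ennreal (norm (g z) powr p)"
        by (intro lim_imp_Liminf) auto
      thus ?thesis using True by simp
    qed (simp add: Liminf_const)
  qed
  also have "\<dots> \<le> liminf (\<lambda>n. \<integral>\<^sup>+z. ennreal (norm (G n z) powr p) * indicator (ball 0 1) z \<partial>sigma_lambda lam)"
    by (rule nn_integral_liminf) simp
  also have "\<dots> = liminf (\<lambda>n. bergman_integral lam p (G n))" by (simp add: bergman_integral_def)
  also have "\<dots> \<le> limsup (\<lambda>n. bergman_integral lam p (G n))"
    by (rule Liminf_le_Limsup) simp
  also have "\<dots> \<le> D"
    by (rule Limsup_bounded) (use le in \<open>auto simp: eventually_sequentially\<close>)
  finally show ?thesis .
qed

text \<open>
  The next two lemmas treat the two definitions of the metric, for \<open>p \<ge> 1\<close> and for \<open>p < 1\<close>, at the same time.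
\<close>

lemma bergman_dist_small_imp_integral_small:
  assumes p: "0 < p" and d: "0 < d"
  obtains e where "0 < e"
    "\<And>f g. bergman_dist lam p f g < e \<Longrightarrow> bergman_integral lam p (\<lambda>z. f z - g z) < \<infinity> \<Longrightarrow> bergman_integral lam p (\<lambda>z. f z - g z) \<le> ennreal d"
proof (cases "1 \<le> p")
  case True
  show ?thesis
  proof (rule that[of "d powr (1 / p)"])
    show "0 < d powr (1 / p)" using d by simp
    fix f g assume *: "bergman_dist lam p f g < d powr (1 / p)" and fin: "bergman_integral lam p (\<lambda>z. f z - g z) < \<infinity>"
    obtain r where r: "0 \<le> r" "bergman_integral lam p (\<lambda>z. f z - g z) = ennreal r"
      using fin by (cases "bergman_integral lam p (\<lambda>z. f z - g z)") auto
    have lt: "r powr (1 / p) < d powr (1 / p)" using * True r by (simp add: bergman_dist_def bergman_norm_def)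
    have "(r powr (1 / p)) powr p \<le> (d powr (1 / p)) powr p"
      by (rule powr_mono2[OF less_imp_le[OF p] powr_ge_zero less_imp_le[OF lt]])
    hence "r \<le> d" using r d p by (simp add: powr_powr)
    thus "bergman_integral lam p (\<lambda>z. f z - g z) \<le> ennreal d" using r by (simp add: ennreal_leI)
  qed
next
  case False
  show ?thesis
  proof (rule that[of d])
    fix f g assume *: "bergman_dist lam p f g < d" and fin: "bergman_integral lam p (\<lambda>z. f z - g z) < \<infinity>"
    obtain r where r: "0 \<le> r" "bergman_integral lam p (\<lambda>z. f z - g z) = ennreal r"
      using fin by (cases "bergman_integral lam p (\<lambda>z. f z - g z)") auto
    have "r < d" using * False p r by (simp add: bergman_dist_small_exponent)
    thus "bergman_integral lam p (\<lambda>z. f z - g z) \<le> ennreal d" using r by (simp add: ennreal_leI)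
  qed (rule d)
qed

lemma bergman_integral_small_imp_dist_small:
  assumes p: "0 < p" and e: "0 < e"
  obtains d where "0 < d" "\<And>f g. bergman_integral lam p (\<lambda>z. f z - g z) \<le> ennreal d \<Longrightarrow> bergman_dist lam p f g < e"
proof (cases "1 \<le> p")
  case True
  show ?thesis
  proof (rule that[of "(e / 2) powr p"])
    show "0 < (e / 2) powr p" using e by simp
    fix f g assume "bergman_integral lam p (\<lambda>z. f z - g z) \<le> ennreal ((e / 2) powr p)"
    hence "enn2real (bergman_integral lam p (\<lambda>z. f z - g z)) \<le> (e / 2) powr p"
      by (rule enn2real_leI[rotated]) simp
    hence "enn2real (bergman_integral lam p (\<lambda>z. f z - g z)) powr (1 / p) \<le> ((e / 2) powr p) powr (1 / p)"
      using p by (intro powr_mono2) auto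
    also have "\<dots> = e / 2" using e p by (simp add: powr_powr)
    finally show "bergman_dist lam p f g < e" using True e by (simp add: bergman_dist_def bergman_norm_def)
  qed
next
  case False
  show ?thesis
  proof (rule that[of "e / 2"])
    show "0 < e / 2" using e by simp
    fix f g assume "bergman_integral lam p (\<lambda>z. f z - g z) \<le> ennreal (e / 2)"
    hence "enn2real (bergman_integral lam p (\<lambda>z. f z - g z)) \<le> e / 2"
      using e by (intro enn2real_leI) auto
    thus "bergman_dist lam p f g < e" using False e p by (simp add: bergman_dist_small_exponent)
  qed
qed

text \<open>
  A Cauchy sequence converges locally uniformly to some \<open>f\<close>, which is \<open>\<lambda>\<close>-analytic by the representation.
  Fatou's lemma, applied to \<open>F n - F m\<close> as \<open>m\<close> tends to infinity, bounds the distance of \<open>F n\<close> from \<open>f\<close>.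
\<close>

theorem bergman_complete:
  assumes lam: "0 \<le> lam" and p: "0 < p"
  shows "Metric_space.mcomplete (bergman_space lam p) (bergman_dist lam p)"
proof -
  interpret Metric_space "bergman_space lam p" "bergman_dist lam p" by (rule bergman_metric[OF lam p])
  show ?thesis unfolding mcomplete_def
  proof (intro allI impI)
    fix F assume F: "MCauchy F"
    have FA: "F n \<in> bergman_space lam p" for n using F by (auto simp: MCauchy_def)
    note Fd = bergman_spaceD(1)[OF FA] and Fc = bergman_spaceD(2)[OF FA]
    have cau: "\<exists>N. \<forall>m\<ge>N. \<forall>n\<ge>N. bergman_integral lam p (\<lambda>z. F m z - F n z) \<le> ennreal d" if d: "0 < d" for d
    proof -
      obtain e where e: "0 < e" "\<And>f g. bergman_dist lam p f g < e \<Longrightarrow> bergman_integral lam p (\<lambda>z. f z - g z) < \<infinity> \<Longrightarrow> bergman_integral lam p (\<lambda>z. f z - g z) \<le> ennreal d"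
        using bergman_dist_small_imp_integral_small[OF p d] by blast
      obtain N where "\<forall>m n. N \<le> m \<longrightarrow> N \<le> n \<longrightarrow> bergman_dist lam p (F m) (F n) < e"
        using F e(1) unfolding MCauchy_def by blast
      thus ?thesis using e(2) bergman_diff_finite[OF lam p FA FA] by blast
    qed
    have unif: "\<exists>N. \<forall>m\<ge>N. \<forall>n\<ge>N. \<forall>z. norm z \<le> r \<longrightarrow> norm (F m z - F n z) \<le> e" if r: "0 \<le> r" "r < 1" and e: "0 < e" for r e
    proof -
      obtain d where d: "0 < d" "\<And>f z. dunkl_holomorphic lam (ball 0 1) f \<Longrightarrow> bergman_integral lam p f \<le> ennreal d \<Longrightarrow> norm z \<le> r \<Longrightarrow> norm (f z) \<le> e"
        using small_norm_imp_uniformly_small[OF lam p r e] by blast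
      obtain N where "\<forall>m\<ge>N. \<forall>n\<ge>N. bergman_integral lam p (\<lambda>z. F m z - F n z) \<le> ennreal d" using cau[OF d(1)] by blast
      thus ?thesis using d(2)[OF dunkl_holomorphic_diff[OF Fd Fd]] by blast
    qed
    have "\<exists>l. (\<lambda>n. F n z) \<longlonglongrightarrow> l" if z: "norm z < 1" for z
    proof -
      have "Cauchy (\<lambda>n. F n z)"
      proof (rule CauchyI)
        fix e :: real assume "0 < e"
        hence "0 < e / 2" by simp
        from unif[OF norm_ge_zero z this] obtain N where "\<forall>m\<ge>N. \<forall>n\<ge>N. norm (F m z - F n z) \<le> e / 2" by blast
        thus "\<exists>N. \<forall>m\<ge>N. \<forall>n\<ge>N. norm (F m z - F n z) < e" using \<open>0 < e\<close> by (intro exI[of _ N]) force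
      qed
      thus ?thesis using Cauchy_convergent convergent_def by blast
    qed
    then obtain l where l: "\<And>z. norm z < 1 \<Longrightarrow> (\<lambda>n. F n z) \<longlonglongrightarrow> l z" by metis
    define f where "f = restrict l (ball 0 1)"
    have f: "(\<lambda>n. F n z) \<longlonglongrightarrow> f z" if "norm z < 1" for z using l[OF that] that by (simp add: f_def)
    have funif: "\<exists>N. \<forall>n\<ge>N. \<forall>z. norm z \<le> r \<longrightarrow> norm (F n z - f z) \<le> e" if r: "0 \<le> r" "r < 1" and e: "0 < e" for r e
    proof -
      obtain N where N: "\<And>m n z. m \<ge> N \<Longrightarrow> n \<ge> N \<Longrightarrow> norm z \<le> r \<Longrightarrow> norm (F m z - F n z) \<le> e" using unif[OF r e] by blast
      have "norm (F n z - f z) \<le> e" if "n \<ge> N" "norm z \<le> r" for n z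
      proof (rule LIMSEQ_le_const2)
        show "(\<lambda>m. norm (F n z - F m z)) \<longlonglongrightarrow> norm (F n z - f z)"
          using that r by (intro tendsto_norm tendsto_diff tendsto_const f) auto
        show "\<exists>M. \<forall>m\<ge>M. norm (F n z - F m z) \<le> e" using N that by blast
      qed
      thus ?thesis by blast
    qed
    have fcb: "continuous_on (cball 0 b) f" if b: "0 \<le> b" "b < 1" for b
    proof (rule uniform_limit_theorem)
      show "\<forall>\<^sub>F n in sequentially. continuous_on (cball 0 b) (F n)"
        using b by (intro always_eventually allI continuous_on_subset[OF Fc]) auto
      show "uniform_limit (cball 0 b) F f sequentially"
        unfolding uniform_limit_iff
      proof (intro allI impI)
        fix e :: real assume "0 < e"
        hence "0 < e / 2" by simp
        from funif[OF b this] obtain N where "\<forall>n\<ge>N. \<forall>z. norm z \<le> b \<longrightarrow> norm (F n z - f z) \<le> e / 2" by blast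
        thus "\<forall>\<^sub>F n in sequentially. \<forall>z\<in>cball 0 b. dist (F n z) (f z) < e"
          using \<open>0 < e\<close> unfolding eventually_sequentially dist_norm by (intro exI[of _ N]) force
      qed
    qed simp
    have fc: "continuous_on (ball 0 1) f"
    proof (intro continuous_at_imp_continuous_on ballI)
      fix z :: complex assume z: "z \<in> ball 0 1"
      define b where "b = (1 + norm z) / 2"
      have b: "0 \<le> b" "b < 1" "z \<in> ball 0 b" using z by (auto simp: b_def)
      have "continuous_on (ball 0 b) f" by (rule continuous_on_subset[OF fcb[OF b(1,2)]]) auto
      thus "isCont f z" using b(3) by (simp add: continuous_on_eq_continuous_at)
    qed
    have "lambda_analytic lam f"
    proof (rule lambda_analytic_if_locally_intertwined[OF lam])
      fix a :: real assume a: "0 < a" "a < 1"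
      define b where "b = (a + 1) / 2"
      have b: "a < b" "b < 1" "0 \<le> b" using a by (auto simp: b_def)
      have "\<exists>n. \<forall>w\<in>cball 0 b. norm (F n w - f w) \<le> e" if "0 < e" for e
        using funif[OF b(3,2) that] by (metis mem_cball_0 order_refl)
      from uniform_limit_representation[OF lam Fd a(1) b(1,2) fcb[OF b(3,2)] this]
      have "\<forall>z\<in>ball 0 a. f z = intertwine lam (axis_transform lam a b f) z" by blast
      thus "\<exists>g. g holomorphic_on ball 0 a \<and> (\<forall>z\<in>ball 0 a. f z = intertwine lam g z)"
        using axis_transform_holomorphic[OF lam a(1) b(1) fcb[OF b(3,2)]] by blast
    qed
    have close: "\<exists>N. \<forall>n\<ge>N. bergman_integral lam p (\<lambda>z. F n z - f z) \<le> ennreal d" if d: "0 < d" for d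
    proof -
      obtain N where N: "\<And>m n. m \<ge> N \<Longrightarrow> n \<ge> N \<Longrightarrow> bergman_integral lam p (\<lambda>z. F m z - F n z) \<le> ennreal d" using cau[OF d] by blast
      have "bergman_integral lam p (\<lambda>z. F n z - f z) \<le> ennreal d" if n: "n \<ge> N" for n
      proof (rule bergman_integral_Fatou[OF lam p, where G = "\<lambda>m z. F n z - F m z" and N = N])
        show "continuous_on (ball 0 1) (\<lambda>z. F n z - F m z)" for m by (intro continuous_on_diff Fc)
        show "(\<lambda>m. F n z - F m z) \<longlonglongrightarrow> F n z - f z" if "norm z < 1" for z by (intro tendsto_diff tendsto_const f that)
        show "bergman_integral lam p (\<lambda>z. F n z - F m z) \<le> ennreal d" if "m \<ge> N" for m using N n that by blast
      qed
      thus ?thesis by blast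
    qed
    have "bergman_integral lam p f < \<infinity>"
    proof -
      obtain N where N: "bergman_integral lam p (\<lambda>z. F N z - f z) \<le> ennreal 1" using close[of 1] by auto
      hence "bergman_integral lam p (\<lambda>z. F N z - f z) < \<infinity>" by (rule le_less_trans) simp
      thus ?thesis
      proof (rule bergman_integral_diff_finite[OF lam p Fc[of N] continuous_on_diff[OF Fc[of N] fc] bergman_spaceD(3)[OF FA[of N]]])
        show "norm (f z) \<le> norm (F N z) + norm (F N z - f z)" for z
          using norm_triangle_ineq4[of "F N z" "F N z - f z"] by simp
      qed
    qed
    moreover have "f \<in> extensional (ball 0 1)" by (simp add: f_def)
    ultimately have fA: "f \<in> bergman_space lam p" using \<open>lambda_analytic lam f\<close> by (simp add: bergman_space_def)
    have "limitin mtopology F f sequentially"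
      unfolding limitin_metric
    proof (intro conjI allI impI fA)
      fix e :: real assume e: "0 < e"
      obtain d where d: "0 < d" "\<And>f g. bergman_integral lam p (\<lambda>z. f z - g z) \<le> ennreal d \<Longrightarrow> bergman_dist lam p f g < e"
        using bergman_integral_small_imp_dist_small[OF p e] by blast
      obtain N where "\<And>n. n \<ge> N \<Longrightarrow> bergman_integral lam p (\<lambda>z. F n z - f z) \<le> ennreal d" using close[OF d(1)] by blast
      thus "\<forall>\<^sub>F n in sequentially. F n \<in> bergman_space lam p \<and> bergman_dist lam p (F n) f < e"
        unfolding eventually_sequentially using d(2) FA by blast
    qed
    thus "\<exists>x. limitin mtopology F x sequentially" by blast
  qed
qed

theorem theorem5p6:
  fixes lam p :: real
  assumes "0 \<le> lam" and "2 * lam / (2 * lam + 1) \<le> p" and "0 < p"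
  shows "Metric_space (bergman_space lam p) (bergman_dist lam p) \<and>
         Metric_space.mcomplete (bergman_space lam p) (bergman_dist lam p)"
  using bergman_metric[OF assms(1,3)] bergman_complete[OF assms(1,3)] by (rule conjI)

end
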